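(* Let $H$ be a Koszul--Vinberg structure on a left-symmetric algebroid $(\mathcal{A},\ast_{\mathcal{A}},a_{\mathcal{A}})$ and let $H_{(n)}=\sum_{i=0}^n\mathcal{H}_it^i$ be an order $n$ deformation of $H$. Define $$\Theta=\frac12\sum_{\substack{i+j=n+1\\ i,j\ge1}}[\![\mathcal{H}_i,\mathcal{H}_j]\!]_{\mathrm{KV}}.$$ Then the $3$-cochain $\Theta$ is closed, i.e. $\delta_{\mathcal{A}^*}\Theta=0$. Furthermore, $H_{(n)}$ is extendable if and only if the cohomology class $[\Theta]$ in $\tilde H^3_{\mathrm{KV}}(\mathcal{A}^* )$ is trivial.
   Context: Vector bundles are smooth real vector bundles over a smooth manifold $M$. A left-symmetric algebroid $(\mathcal{A},\ast_{\mathcal{A}},a_{\mathcal{A}})$ is a vector bundle $\mathcal{A}\to M$ with an $\mathbb{R}$-bilinear product $\ast_{\mathcal{A}}$ on $\Gamma(\mathcal{A})$ satisfying $x\ast(y\ast z)-(x\ast y)\ast z=y\ast(x\ast z)-(y\ast x)\ast z$ and a bundle map $a_{\mathcal{A}}:\mathcal{A}\to TM$ with $x\ast_{\mathcal{A}}(fy)=f(x\ast_{\mathcal{A}}y)+a_{\mathcal{A}}(x)(f)y$, $(fx)\ast_{\mathcal{A}}y=f(x\ast_{\mathcal{A}}y)$. Its sub-adjacent Lie algebroid $\mathcal{A}^c$ has bracket $[x,y]_{\mathcal{A}}=x\ast_{\mathcal{A}}y-y\ast_{\mathcal{A}}x$ and anchor $a_{\mathcal{A}}$. On $\Gamma(\mathcal{A}^*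 )$: $\langle L_x\xi,y\rangle=a_{\mathcal{A}}(x)\langle\xi,y\rangle-\langle\xi,x\ast_{\mathcal{A}}y\rangle$ and $\langle R_x\xi,y\rangle=-\langle\xi,y\ast_{\mathcal{A}}x\rangle$. $\mathrm{Sym}^2(\mathcal{A})$ is the set of (sections) $H$ of $\mathcal{A}\otimes\mathcal{A}$ with $H(\alpha,\beta)=H(\beta,\alpha)$; $H^\sharp:\mathcal{A}^*\to\mathcal{A}$ is $\langle H^\sharp(\alpha),\beta\rangle=H(\alpha,\beta)$. Define $$\begin{aligned}[][H,H](\alpha_1,\alpha_2,\alpha_3)={}&a_{\mathcal{A}}(H^\sharp(\alpha_1))\langle H^\sharp(\alpha_2),\alpha_3\rangle-a_{\mathcal{A}}(H^\sharp(\alpha_2))\langle H^\sharp(\alpha_1),\alpha_3\rangle+\langle\alpha_1,H^\sharp(\alpha_2)\ast_{\mathcal{A}}H^\sharp(\alpha_3)\rangle\\&-\langle\alpha_2,H^\sharp(\alpha_1)\ast_{\mathcal{A}}H^\sharp(\alpha_3)\rangle-\langle\alpha_3,[H^\sharp(\alpha_1),H^\sharp(\alpha_2)]_{\mathcal{A}}\rangle.\end{aligned}$$ $H$ is a Koszul--Vinberg structure if $[H,H]=0$. Let $\mathcal{C}^k(\mathcal{A}^*,\mathcal{A})=\Gamma(\mathrm{Hom}(\wedge^k\mathcal{A}^*,\mathcal{A}))$, $k\ge0$. For $P\in \mathcal{C}^n(\mathcal{A}^*,\mathcal{A})$, $Q\in \mathcal{C}^m(\mathcal{A}^*,\mathcal{A})$,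 $$\begin{aligned} [\![P,Q]\!](\alpha_1,\dots,\alpha_{m+n})={}&\sum_{\sigma\in\mathbb{S}_{(m,1,n-1)}} (-1)^\sigma P(L_{Q(\alpha_{\sigma(1)},\dots,\alpha_{\sigma(m)})}\alpha_{\sigma(m+1)},\alpha_{\sigma(m+2)},\dots,\alpha_{\sigma(m+n)})\\ &-(-1)^{mn}\sum_{\sigma\in\mathbb{S}_{(n,1,m-1)}} (-1)^\sigma Q(L_{P(\alpha_{\sigma(1)},\dots,\alpha_{\sigma(n)})}\alpha_{\sigma(n+1)},\alpha_{\sigma(n+2)},\dots,\alpha_{\sigma(m+n)})\\ &+(-1)^{mn}\sum_{\sigma\in\mathbb{S}_{(n,m)}} (-1)^\sigma [P(\alpha_{\sigma(1)},\dots,\alpha_{\sigma(n)}),Q(\alpha_{\sigma(n+1)},\dots,\alpha_{\sigma(m+n)})]_{\mathcal{A}}, \end{aligned}$$ where $\mathbb{S}_{(i_1,\dots,i_k)}$ is the set of unshuffles (permutations increasing on consecutive blocks of lengths $i_1,\dots,i_k$) and a sum involving a block of length $-1$ is zero. $\Psi:\Gamma(\wedge^k\mathcal{A}\otimes\mathcal{A})\to\mathcal{C}^k(\mathcal{A}^*,\mathcal{A})$, $\langle\Psi(\varphi)(\alpha_1,\dots,\alpha_k),\alpha_{k+1}\rangle=\varphi(\alpha_1,\dots,\alpha_{k+1})$, is bijective; put $C^k_{\mathrm{KV}}(\mathcal{A}^* )=\Gamma(\wedge^{k-1}\mathcal{A}\otimes\mathcal{A})$ ($k\ge1$) and $[\![\varphi,\phi]\!]_{\mathrm{KV}}=\Psi^{-1}[\![\Psi(\varphi),\Psi(\phi)]\!]$,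 a graded Lie bracket with $C^{k}_{\mathrm{KV}}$ in degree $k-1$. For a Koszul--Vinberg structure $H$, $\delta_{\mathcal{A}^*}\varphi=(-1)^{k-1}[\![H,\varphi]\!]_{\mathrm{KV}}$ for $\varphi\in C^k_{\mathrm{KV}}(\mathcal{A}^* )$ is a differential on $C^*_{\mathrm{KV}}(\mathcal{A}^* )$. The subcomplex $\tilde C^*_{\mathrm{KV}}(\mathcal{A}^* )$ is given by $\tilde C^1_{\mathrm{KV}}=\{x\in C^1_{\mathrm{KV}}=\Gamma(\mathcal{A}): H(R_x\alpha_1,\alpha_2)=H(\alpha_1,R_x\alpha_2)\ \forall\alpha_1,\alpha_2\in\Gamma(\mathcal{A}^* )\}$; $\tilde C^2_{\mathrm{KV}}=\{\varphi\in C^2_{\mathrm{KV}}:\varphi(\alpha_1,\alpha_2)=\varphi(\alpha_2,\alpha_1)\}$; $\tilde C^3_{\mathrm{KV}}=\{\varphi\in C^3_{\mathrm{KV}}:\varphi(\alpha_1,\alpha_2,\alpha_3)+\text{cyclic permutations}=0\}$; $\tilde C^k_{\mathrm{KV}}=C^k_{\mathrm{KV}}$ for $k\ge4$. Its $k$-th cohomology group is $\tilde H^k_{\mathrm{KV}}(\mathcal{A}^* )$. Extend all structures $\mathbb{R}[[t]]$-linearly. An order $n$ deformation of $H$ is $H_{(n)}=\sum_{i=0}^n\mathcal{H}_it^i$ with $\mathcal{H}_0=H$, $\mathcal{H}_i\in\mathrm{Sym}^2(\mathcal{A})$, which is a Koszul--Vinberg structure over $\mathbb{R}[[t]]/(t^{n+1})$,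 i.e. $[H_{(n)},H_{(n)}]=0$ modulo $t^{n+1}$. It is extendable if there is $\mathcal{H}_{n+1}\in\mathrm{Sym}^2(\mathcal{A})$ such that $H_{(n)}+t^{n+1}\mathcal{H}_{n+1}$ is an order $n+1$ deformation of $H$. *)

theory Defs
  imports "HOL-Analysis.Analysis" "HOL-Combinatorics.Permutations"
begin

section \<open>Smooth functions and manifolds\<close>

text \<open>Points of \<open>\<real>\<^sup>d\<close> are sequences vanishing from index \<open>d\<close> on, as in
  \<^const>\<open>Euclidean_space\<close>; in particular \<open>d = 0\<close> is allowed.  A function on an open subset
  of \<open>\<real>\<^sup>d\<close> is smooth if all its iterated partial derivatives exist and are continuous.\<close>

definition partial_deriv :: "nat \<Rightarrow> ((nat \<Rightarrow> real) \<Rightarrow> real) \<Rightarrow> (nat \<Rightarrow> real) \<Rightarrow> real" where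
  "partial_deriv i f x = deriv (\<lambda>t. f (x(i := t))) (x i)"

primrec Ck_on :: "nat \<Rightarrow> nat \<Rightarrow> (nat \<Rightarrow> real) set \<Rightarrow> ((nat \<Rightarrow> real) \<Rightarrow> real) \<Rightarrow> bool" where
  "Ck_on 0 d W f \<longleftrightarrow> continuous_map (subtopology (Euclidean_space d) W) euclideanreal f"
| "Ck_on (Suc k) d W f \<longleftrightarrow>
     continuous_map (subtopology (Euclidean_space d) W) euclideanreal f \<and>
     (\<forall>i<d. (\<forall>x\<in>W. (\<lambda>t. f (x(i := t))) differentiable at (x i)) \<and>
            Ck_on k d W (partial_deriv i f))"

definition Cinf_on :: "nat \<Rightarrow> (nat \<Rightarrow> real) set \<Rightarrow> ((nat \<Rightarrow> real) \<Rightarrow> real) \<Rightarrow> bool" where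
  "Cinf_on d W f \<longleftrightarrow> (\<forall>k. Ck_on k d W f)"

text \<open>A manifold is given by its dimension and a smooth atlas, a set of pairs \<open>(U, c)\<close> of a chart
  domain and a chart map; its points are all the points of the type \<open>'m\<close>, with the topology of
  that type.\<close>

record 'm smooth_atlas =
  mdim :: nat
  charts :: "('m set \<times> ('m \<Rightarrow> nat \<Rightarrow> real)) set"

definition smooth_manifold ::
    "('m::{t2_space,second_countable_topology}, 'z) smooth_atlas_scheme \<Rightarrow> bool" where
  "smooth_manifold M \<longleftrightarrow>
     (\<Union>(U,c)\<in>charts M. U) = UNIV \<and>
     (\<forall>(U,c)\<in>charts M. open U \<and> openin (Euclidean_space (mdim M)) (c ` U) \<and>
        homeomorphic_map (top_of_set U) (subtopology (Euclidean_space (mdim M)) (c ` U)) c) \<and>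
     (\<forall>(U,c)\<in>charts M. \<forall>(V,e)\<in>charts M. \<forall>j<mdim M.
        Cinf_on (mdim M) (c ` (U \<inter> V)) (\<lambda>x. e (inv_into U c x) j))"

definition smooth_fun_on ::
    "('m, 'z) smooth_atlas_scheme \<Rightarrow> 'm set \<Rightarrow> ('m \<Rightarrow> real) \<Rightarrow> bool" where
  "smooth_fun_on M S f \<longleftrightarrow>
     (\<forall>(U,c)\<in>charts M. Cinf_on (mdim M) (c ` (U \<inter> S)) (\<lambda>x. f (inv_into U c x)))"

abbreviation smooth_funs :: "('m, 'z) smooth_atlas_scheme \<Rightarrow> ('m \<Rightarrow> real) set" where
  "smooth_funs M \<equiv> {f. smooth_fun_on M UNIV f}"

text \<open>Tangent vectors at a point are derivations of the algebra of smooth functions at that point.\<close>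

definition tangent_space ::
    "('m, 'z) smooth_atlas_scheme \<Rightarrow> 'm \<Rightarrow> (('m \<Rightarrow> real) \<Rightarrow> real) set" where
  "tangent_space M p =
     {v. (\<forall>f\<in>smooth_funs M. \<forall>g\<in>smooth_funs M.
            (\<forall>a b. v (\<lambda>q. a * f q + b * g q) = a * v f + b * v g) \<and>
            v (\<lambda>q. f q * g q) = f p * v g + g p * v f)}"

section \<open>Vector bundles\<close>

text \<open>The fibre over \<open>p\<close> is a subspace \<open>fibre A p\<close> of an ambient real vector space \<open>'v\<close>.  The
  ambient space only serves as a container: it has no topology and need not be finite-dimensional,
  so it does not restrict the bundles.
  The bundle structure comes solely from the local trivialisations \<open>(U, \<Phi>)\<close>, where, for \<open>p \<in> U\<close>,
  \<open>\<Phi> p\<close> is a linear isomorphism from the fibre onto \<open>\<real>\<^sup>r\<close>.\<close>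

record ('m, 'v) vec_bundle = "'m smooth_atlas" +
  vrank :: nat
  fibre :: "'m \<Rightarrow> 'v set"
  trivs :: "('m set \<times> ('m \<Rightarrow> 'v \<Rightarrow> nat \<Rightarrow> real)) set"

definition unit_vec :: "nat \<Rightarrow> nat \<Rightarrow> real" where
  "unit_vec j = (\<lambda>i. if i = j then 1 else 0)"

definition frame ::
    "('m, 'v, 'z) vec_bundle_scheme \<Rightarrow> ('m \<Rightarrow> 'v \<Rightarrow> nat \<Rightarrow> real) \<Rightarrow> nat \<Rightarrow> 'm \<Rightarrow> 'v" where
  "frame A \<Phi> j p = inv_into (fibre A p) (\<Phi> p) (unit_vec j)"

definition vector_bundle ::
    "('m::{t2_space,second_countable_topology}, 'v::real_vector, 'z) vec_bundle_scheme \<Rightarrow> bool" where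
  "vector_bundle A \<longleftrightarrow>
     smooth_manifold A \<and> (\<forall>p. subspace (fibre A p)) \<and>
     (\<Union>(U,\<Phi>)\<in>trivs A. U) = UNIV \<and>
     (\<forall>(U,\<Phi>)\<in>trivs A. open U \<and>
        (\<forall>p\<in>U. bij_betw (\<Phi> p) (fibre A p) (topspace (Euclidean_space (vrank A))) \<and>
           (\<forall>x\<in>fibre A p. \<forall>y\<in>fibre A p. \<forall>a b i.
              \<Phi> p (a *\<^sub>R x + b *\<^sub>R y) i = a * \<Phi> p x i + b * \<Phi> p y i))) \<and>
     (\<forall>(U,\<Phi>)\<in>trivs A. \<forall>(V,\<Psi>)\<in>trivs A. \<forall>i<vrank A. \<forall>j<vrank A.
        smooth_fun_on A (U \<inter> V) (\<lambda>p. \<Psi> p (frame A \<Phi> j p) i))"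

definition sections :: "('m, 'v, 'z) vec_bundle_scheme \<Rightarrow> ('m \<Rightarrow> 'v) set" where
  "sections A =
     {x. (\<forall>p. x p \<in> fibre A p) \<and>
         (\<forall>(U,\<Phi>)\<in>trivs A. \<forall>i<vrank A. smooth_fun_on A U (\<lambda>p. \<Phi> p (x p) i))}"

text \<open>Covectors and tensors are functions on all of \<open>'v\<close> and on all lists of covectors; they are
  taken to be \<open>0\<close> outside their mathematical domain, so that equality is equality on that domain.\<close>

definition dual_fibre ::
    "('m, 'v::real_vector, 'z) vec_bundle_scheme \<Rightarrow> 'm \<Rightarrow> ('v \<Rightarrow> real) set" where
  "dual_fibre A p =
     {\<xi>. (\<forall>x\<in>fibre A p. \<forall>y\<in>fibre A p. \<forall>a b. \<xi> (a *\<^sub>R x + b *\<^sub>R y) = a * \<xi> x + b * \<xi> y) \<and>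
         (\<forall>x. x \<notin> fibre A p \<longrightarrow> \<xi> x = 0)}"

definition coframe ::
    "('m, 'v, 'z) vec_bundle_scheme \<Rightarrow> ('m \<Rightarrow> 'v \<Rightarrow> nat \<Rightarrow> real) \<Rightarrow> nat \<Rightarrow> 'm \<Rightarrow> 'v \<Rightarrow> real" where
  "coframe A \<Phi> j p = (\<lambda>x. if x \<in> fibre A p then \<Phi> p x j else 0)"

definition dual_sections ::
    "('m, 'v::real_vector, 'z) vec_bundle_scheme \<Rightarrow> ('m \<Rightarrow> 'v \<Rightarrow> real) set" where
  "dual_sections A =
     {\<alpha>. (\<forall>p. \<alpha> p \<in> dual_fibre A p) \<and>
         (\<forall>(U,\<Phi>)\<in>trivs A. \<forall>i<vrank A. smooth_fun_on A U (\<lambda>p. \<alpha> p (frame A \<Phi> i p)))}"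

definition multilinear ::
    "('v \<Rightarrow> real) set \<Rightarrow> nat \<Rightarrow> (('v \<Rightarrow> real) list \<Rightarrow> 'w::real_vector) \<Rightarrow> bool" where
  "multilinear D k F \<longleftrightarrow>
     (\<forall>\<xi>s \<xi> \<eta> a b i. length \<xi>s = k \<and> set \<xi>s \<subseteq> D \<and> \<xi> \<in> D \<and> \<eta> \<in> D \<and> i < k \<longrightarrow>
        F (\<xi>s[i := (\<lambda>x. a * \<xi> x + b * \<eta> x)]) = a *\<^sub>R F (\<xi>s[i := \<xi>]) + b *\<^sub>R F (\<xi>s[i := \<eta>])) \<and>
     (\<forall>\<xi>s. \<not> (length \<xi>s = k \<and> set \<xi>s \<subseteq> D) \<longrightarrow> F \<xi>s = 0)"

definition alternating_in_first :: "nat \<Rightarrow> (('v \<Rightarrow> real) list \<Rightarrow> 'w::real_vector) \<Rightarrow> bool" where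
  "alternating_in_first k F \<longleftrightarrow>
     (\<forall>\<xi>s i j. i < j \<and> j < k \<and> k \<le> length \<xi>s \<and> \<xi>s ! i = \<xi>s ! j \<longrightarrow> F \<xi>s = 0)"

type_synonym ('m, 'v) tensor_field = "'m \<Rightarrow> ('v \<Rightarrow> real) list \<Rightarrow> real"
type_synonym ('m, 'v) hom_field = "'m \<Rightarrow> ('v \<Rightarrow> real) list \<Rightarrow> 'v"

text \<open>\<open>\<Gamma>(\<Lambda>\<^sup>k A \<otimes> A)\<close>: an element of the fibre over \<open>p\<close> is a multilinear form in \<open>k + 1\<close>
  covectors, alternating in the first \<open>k\<close>.\<close>

definition wedge_tensor_sections ::
    "('m, 'v::real_vector, 'z) vec_bundle_scheme \<Rightarrow> nat \<Rightarrow> ('m, 'v) tensor_field set" where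
  "wedge_tensor_sections A k =
     {\<phi>. (\<forall>p. multilinear (dual_fibre A p) (k + 1) (\<phi> p) \<and> alternating_in_first k (\<phi> p)) \<and>
         (\<forall>(U,\<Phi>)\<in>trivs A. \<forall>js. length js = k + 1 \<and> set js \<subseteq> {..<vrank A} \<longrightarrow>
            smooth_fun_on A U (\<lambda>p. \<phi> p (map (\<lambda>j. coframe A \<Phi> j p) js)))}"

text \<open>\<open>\<Gamma>(Hom(\<Lambda>\<^sup>k A\<^sup>*, A))\<close>\<close>

definition hom_sections ::
    "('m, 'v::real_vector, 'z) vec_bundle_scheme \<Rightarrow> nat \<Rightarrow> ('m, 'v) hom_field set" where
  "hom_sections A k =
     {P. (\<forall>p. multilinear (dual_fibre A p) k (P p) \<and> alternating_in_first k (P p) \<and>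
              (\<forall>\<xi>s. P p \<xi>s \<in> fibre A p)) \<and>
         (\<forall>(U,\<Phi>)\<in>trivs A. \<forall>js. \<forall>i<vrank A. length js = k \<and> set js \<subseteq> {..<vrank A} \<longrightarrow>
            smooth_fun_on A U (\<lambda>p. \<Phi> p (P p (map (\<lambda>j. coframe A \<Phi> j p) js)) i))}"

definition field_apply :: "('m \<Rightarrow> 'a list \<Rightarrow> 'b) \<Rightarrow> ('m \<Rightarrow> 'a) list \<Rightarrow> 'm \<Rightarrow> 'b" where
  "field_apply P \<alpha>s = (\<lambda>p. P p (map (\<lambda>\<alpha>. \<alpha> p) \<alpha>s))"

definition pairing :: "('m \<Rightarrow> 'v \<Rightarrow> real) \<Rightarrow> ('m \<Rightarrow> 'v) \<Rightarrow> 'm \<Rightarrow> real" where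
  "pairing \<alpha> x = (\<lambda>p. \<alpha> p (x p))"

text \<open>The map \<open>\<Psi>\<close> from \<open>\<Gamma>(\<Lambda>\<^sup>k A \<otimes> A)\<close> to \<open>\<Gamma>(Hom(\<Lambda>\<^sup>k A\<^sup>*, A))\<close>\<close>

definition Psi ::
    "('m, 'v::real_vector, 'z) vec_bundle_scheme \<Rightarrow> nat \<Rightarrow> ('m, 'v) tensor_field \<Rightarrow> ('m, 'v) hom_field" where
  "Psi A k \<phi> = (\<lambda>p \<xi>s.
     if length \<xi>s = k \<and> set \<xi>s \<subseteq> dual_fibre A p
     then (THE x. x \<in> fibre A p \<and> (\<forall>\<eta>\<in>dual_fibre A p. \<eta> x = \<phi> p (\<xi>s @ [\<eta>])))
     else 0)"

section \<open>Left-symmetric algebroids\<close>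

record ('m, 'v) algebroid = "('m, 'v) vec_bundle" +
  star :: "('m \<Rightarrow> 'v) \<Rightarrow> ('m \<Rightarrow> 'v) \<Rightarrow> 'm \<Rightarrow> 'v"
  anchor :: "'m \<Rightarrow> 'v \<Rightarrow> ('m \<Rightarrow> real) \<Rightarrow> real"

text \<open>\<open>a(x)(f)\<close> for a section \<open>x\<close> and a smooth function \<open>f\<close>\<close>

definition anchor_deriv ::
    "('m, 'v, 'z) algebroid_scheme \<Rightarrow> ('m \<Rightarrow> 'v) \<Rightarrow> ('m \<Rightarrow> real) \<Rightarrow> 'm \<Rightarrow> real" where
  "anchor_deriv A x f = (\<lambda>p. anchor A p (x p) f)"

text \<open>A smooth bundle map from \<open>A\<close> to the tangent bundle: linear on fibres and sending local frames
  to smooth local vector fields, where smoothness of a vector field is tested on smooth functions.\<close>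

definition bundle_map_to_tangent ::
    "('m, 'v::real_vector, 'z) vec_bundle_scheme \<Rightarrow> ('m \<Rightarrow> 'v \<Rightarrow> ('m \<Rightarrow> real) \<Rightarrow> real) \<Rightarrow> bool" where
  "bundle_map_to_tangent A \<rho> \<longleftrightarrow>
     (\<forall>p. \<forall>x\<in>fibre A p. \<rho> p x \<in> tangent_space A p) \<and>
     (\<forall>p. \<forall>x\<in>fibre A p. \<forall>y\<in>fibre A p. \<forall>a b. \<forall>f\<in>smooth_funs A.
        \<rho> p (a *\<^sub>R x + b *\<^sub>R y) f = a * \<rho> p x f + b * \<rho> p y f) \<and>
     (\<forall>(U,\<Phi>)\<in>trivs A. \<forall>i<vrank A. \<forall>f\<in>smooth_funs A.
        smooth_fun_on A U (\<lambda>p. \<rho> p (frame A \<Phi> i p) f))"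

definition left_symmetric_algebroid ::
    "('m::{t2_space,second_countable_topology}, 'v::real_vector, 'z) algebroid_scheme \<Rightarrow> bool" where
  "left_symmetric_algebroid A \<longleftrightarrow>
     vector_bundle A \<and> bundle_map_to_tangent A (anchor A) \<and>
     (\<forall>x\<in>sections A. \<forall>y\<in>sections A. star A x y \<in> sections A) \<and>
     (\<forall>x\<in>sections A. \<forall>y\<in>sections A. \<forall>z\<in>sections A. \<forall>a b.
        star A (\<lambda>p. a *\<^sub>R x p + b *\<^sub>R y p) z = (\<lambda>p. a *\<^sub>R star A x z p + b *\<^sub>R star A y z p) \<and>
        star A z (\<lambda>p. a *\<^sub>R x p + b *\<^sub>R y p) = (\<lambda>p. a *\<^sub>R star A z x p + b *\<^sub>R star A z y p)) \<and>
     (\<forall>x\<in>sections A. \<forall>y\<in>sections A. \<forall>z\<in>sections A. \<forall>p.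
        star A x (star A y z) p - star A (star A x y) z p =
        star A y (star A x z) p - star A (star A y x) z p) \<and>
     (\<forall>x\<in>sections A. \<forall>y\<in>sections A. \<forall>f\<in>smooth_funs A. \<forall>p.
        star A x (\<lambda>q. f q *\<^sub>R y q) p = f p *\<^sub>R star A x y p + anchor_deriv A x f p *\<^sub>R y p \<and>
        star A (\<lambda>q. f q *\<^sub>R x q) y p = f p *\<^sub>R star A x y p)"

definition lie_bracket ::
    "('m, 'v::real_vector, 'z) algebroid_scheme \<Rightarrow> ('m \<Rightarrow> 'v) \<Rightarrow> ('m \<Rightarrow> 'v) \<Rightarrow> 'm \<Rightarrow> 'v" where
  "lie_bracket A x y = (\<lambda>p. star A x y p - star A y x p)"

definition Lop :: "('m, 'v::real_vector, 'z) algebroid_scheme \<Rightarrow>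
    ('m \<Rightarrow> 'v) \<Rightarrow> ('m \<Rightarrow> 'v \<Rightarrow> real) \<Rightarrow> 'm \<Rightarrow> 'v \<Rightarrow> real" where
  "Lop A x \<xi> = (THE \<eta>. \<eta> \<in> dual_sections A \<and> (\<forall>y\<in>sections A. \<forall>p.
     pairing \<eta> y p = anchor_deriv A x (pairing \<xi> y) p - pairing \<xi> (star A x y) p))"

definition Rop :: "('m, 'v::real_vector, 'z) algebroid_scheme \<Rightarrow>
    ('m \<Rightarrow> 'v) \<Rightarrow> ('m \<Rightarrow> 'v \<Rightarrow> real) \<Rightarrow> 'm \<Rightarrow> 'v \<Rightarrow> real" where
  "Rop A x \<xi> = (THE \<eta>. \<eta> \<in> dual_sections A \<and> (\<forall>y\<in>sections A. \<forall>p.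
     pairing \<eta> y p = - pairing \<xi> (star A y x) p))"

section \<open>Koszul--Vinberg structures\<close>

definition Sym2 :: "('m, 'v::real_vector, 'z) vec_bundle_scheme \<Rightarrow> ('m, 'v) tensor_field set" where
  "Sym2 A = {H \<in> wedge_tensor_sections A 1.
     \<forall>\<alpha>\<in>dual_sections A. \<forall>\<beta>\<in>dual_sections A. field_apply H [\<alpha>, \<beta>] = field_apply H [\<beta>, \<alpha>]}"

definition sharp :: "('m, 'v::real_vector, 'z) vec_bundle_scheme \<Rightarrow>
    ('m, 'v) tensor_field \<Rightarrow> ('m \<Rightarrow> 'v \<Rightarrow> real) \<Rightarrow> 'm \<Rightarrow> 'v" where
  "sharp A H \<alpha> = (\<lambda>p. THE x. x \<in> fibre A p \<and> (\<forall>\<beta>\<in>dual_fibre A p. \<beta> x = H p [\<alpha> p, \<beta>]))"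

definition KV_square :: "('m, 'v::real_vector, 'z) algebroid_scheme \<Rightarrow> ('m, 'v) tensor_field \<Rightarrow>
    ('m \<Rightarrow> 'v \<Rightarrow> real) \<Rightarrow> ('m \<Rightarrow> 'v \<Rightarrow> real) \<Rightarrow> ('m \<Rightarrow> 'v \<Rightarrow> real) \<Rightarrow> 'm \<Rightarrow> real" where
  "KV_square A H \<alpha>1 \<alpha>2 \<alpha>3 = (\<lambda>p.
       anchor_deriv A (sharp A H \<alpha>1) (pairing \<alpha>3 (sharp A H \<alpha>2)) p
     - anchor_deriv A (sharp A H \<alpha>2) (pairing \<alpha>3 (sharp A H \<alpha>1)) p
     + pairing \<alpha>1 (star A (sharp A H \<alpha>2) (sharp A H \<alpha>3)) p
     - pairing \<alpha>2 (star A (sharp A H \<alpha>1) (sharp A H \<alpha>3)) p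
     - pairing \<alpha>3 (lie_bracket A (sharp A H \<alpha>1) (sharp A H \<alpha>2)) p)"

definition KV_structure ::
    "('m, 'v::real_vector, 'z) algebroid_scheme \<Rightarrow> ('m, 'v) tensor_field \<Rightarrow> bool" where
  "KV_structure A H \<longleftrightarrow> H \<in> Sym2 A \<and>
     (\<forall>\<alpha>1\<in>dual_sections A. \<forall>\<alpha>2\<in>dual_sections A. \<forall>\<alpha>3\<in>dual_sections A.
        KV_square A H \<alpha>1 \<alpha>2 \<alpha>3 = (\<lambda>p. 0))"

section \<open>The graded Lie bracket and the cohomology\<close>

text \<open>\<open>unshuffles [i\<^sub>1, \<dots>, i\<^sub>k]\<close> consists of permutations of \<open>{..<i\<^sub>1 + \<dots> + i\<^sub>k}\<close>; indices start at
  \<open>0\<close>, here and in the bracket below.\<close>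

definition unshuffles :: "nat list \<Rightarrow> (nat \<Rightarrow> nat) set" where
  "unshuffles bs = {\<sigma>. \<sigma> permutes {..<sum_list bs} \<and>
     (\<forall>j<length bs. strict_mono_on {sum_list (take j bs)..<sum_list (take (Suc j) bs)} \<sigma>)}"

text \<open>The value of the bracket of \<open>P\<close> (of arity \<open>n\<close>) and \<open>Q\<close> (of arity \<open>m\<close>) on sections of the
  dual bundle.  The case distinctions treat the blocks of length \<open>-1\<close>.\<close>

definition hom_bracket_eval :: "('m, 'v::real_vector, 'z) algebroid_scheme \<Rightarrow>
    nat \<Rightarrow> ('m, 'v) hom_field \<Rightarrow> nat \<Rightarrow> ('m, 'v) hom_field \<Rightarrow> ('m \<Rightarrow> 'v \<Rightarrow> real) list \<Rightarrow> 'm \<Rightarrow> 'v" where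
  "hom_bracket_eval A n P m Q \<alpha>s = (\<lambda>p.
     (if n = 0 then 0 else
        \<Sum>\<sigma>\<in>unshuffles [m, 1, n - 1]. of_int (sign \<sigma>) *\<^sub>R
          field_apply P
            (Lop A (field_apply Q (map (\<lambda>i. \<alpha>s ! \<sigma> i) [0..<m])) (\<alpha>s ! \<sigma> m)
             # map (\<lambda>i. \<alpha>s ! \<sigma> i) [m + 1..<m + n]) p)
     - (-1) ^ (m * n) *\<^sub>R
       (if m = 0 then 0 else
        \<Sum>\<sigma>\<in>unshuffles [n, 1, m - 1]. of_int (sign \<sigma>) *\<^sub>R
          field_apply Q
            (Lop A (field_apply P (map (\<lambda>i. \<alpha>s ! \<sigma> i) [0..<n])) (\<alpha>s ! \<sigma> n)
             # map (\<lambda>i. \<alpha>s ! \<sigma> i) [n + 1..<m + n]) p)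
     + (-1) ^ (m * n) *\<^sub>R
       (\<Sum>\<sigma>\<in>unshuffles [n, m]. of_int (sign \<sigma>) *\<^sub>R
          lie_bracket A
            (field_apply P (map (\<lambda>i. \<alpha>s ! \<sigma> i) [0..<n]))
            (field_apply Q (map (\<lambda>i. \<alpha>s ! \<sigma> i) [n..<m + n])) p))"

definition hom_bracket :: "('m, 'v::real_vector, 'z) algebroid_scheme \<Rightarrow>
    nat \<Rightarrow> ('m, 'v) hom_field \<Rightarrow> nat \<Rightarrow> ('m, 'v) hom_field \<Rightarrow> ('m, 'v) hom_field" where
  "hom_bracket A n P m Q = (THE R. R \<in> hom_sections A (m + n) \<and>
     (\<forall>\<alpha>s. length \<alpha>s = m + n \<and> set \<alpha>s \<subseteq> dual_sections A \<longrightarrow>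
        field_apply R \<alpha>s = hom_bracket_eval A n P m Q \<alpha>s))"

text \<open>Cochain spaces \<open>KV_cochains A k\<close> are meant for \<open>k \<ge> 1\<close> only.\<close>

definition KV_cochains ::
    "('m, 'v::real_vector, 'z) vec_bundle_scheme \<Rightarrow> nat \<Rightarrow> ('m, 'v) tensor_field set" where
  "KV_cochains A k = wedge_tensor_sections A (k - 1)"

text \<open>\<open>KV_bracket A k \<phi> l \<psi>\<close> is the bracket of a \<open>k\<close>-cochain \<open>\<phi>\<close> and an \<open>l\<close>-cochain \<open>\<psi>\<close>; it is a
  \<open>(k + l - 1)\<close>-cochain.\<close>

definition KV_bracket :: "('m, 'v::real_vector, 'z) algebroid_scheme \<Rightarrow>
    nat \<Rightarrow> ('m, 'v) tensor_field \<Rightarrow> nat \<Rightarrow> ('m, 'v) tensor_field \<Rightarrow> ('m, 'v) tensor_field" where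
  "KV_bracket A k \<phi> l \<psi> =
     the_inv_into (KV_cochains A (k + l - 1)) (Psi A (k + l - 2))
       (hom_bracket A (k - 1) (Psi A (k - 1) \<phi>) (l - 1) (Psi A (l - 1) \<psi>))"

definition KV_delta :: "('m, 'v::real_vector, 'z) algebroid_scheme \<Rightarrow> ('m, 'v) tensor_field \<Rightarrow>
    nat \<Rightarrow> ('m, 'v) tensor_field \<Rightarrow> ('m, 'v) tensor_field" where
  "KV_delta A H k \<phi> = (\<lambda>p \<xi>s. (-1) ^ (k - 1) * KV_bracket A 2 H k \<phi> p \<xi>s)"

text \<open>The section of \<open>A\<close> corresponding to a \<open>1\<close>-cochain \<open>\<phi>\<close> is \<open>field_apply (Psi A 0 \<phi>) []\<close>.\<close>

definition KV_cochains_tilde :: "('m, 'v::real_vector, 'z) algebroid_scheme \<Rightarrow>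
    ('m, 'v) tensor_field \<Rightarrow> nat \<Rightarrow> ('m, 'v) tensor_field set" where
  "KV_cochains_tilde A H k =
     (if k = 1 then {\<phi> \<in> KV_cochains A 1. \<forall>\<alpha>1\<in>dual_sections A. \<forall>\<alpha>2\<in>dual_sections A.
        let x = field_apply (Psi A 0 \<phi>) [] in
        field_apply H [Rop A x \<alpha>1, \<alpha>2] = field_apply H [\<alpha>1, Rop A x \<alpha>2]}
      else if k = 2 then {\<phi> \<in> KV_cochains A 2. \<forall>\<alpha>1\<in>dual_sections A. \<forall>\<alpha>2\<in>dual_sections A.
        field_apply \<phi> [\<alpha>1, \<alpha>2] = field_apply \<phi> [\<alpha>2, \<alpha>1]}
      else if k = 3 then {\<phi> \<in> KV_cochains A 3.
        \<forall>\<alpha>1\<in>dual_sections A. \<forall>\<alpha>2\<in>dual_sections A. \<forall>\<alpha>3\<in>dual_sections A. \<forall>p.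
        field_apply \<phi> [\<alpha>1, \<alpha>2, \<alpha>3] p + field_apply \<phi> [\<alpha>2, \<alpha>3, \<alpha>1] p
          + field_apply \<phi> [\<alpha>3, \<alpha>1, \<alpha>2] p = 0}
      else KV_cochains A k)"

definition KV_cocycles_tilde :: "('m, 'v::real_vector, 'z) algebroid_scheme \<Rightarrow>
    ('m, 'v) tensor_field \<Rightarrow> nat \<Rightarrow> ('m, 'v) tensor_field set" where
  "KV_cocycles_tilde A H k = {\<phi> \<in> KV_cochains_tilde A H k. KV_delta A H k \<phi> = (\<lambda>p \<xi>s. 0)}"

definition KV_coboundaries_tilde :: "('m, 'v::real_vector, 'z) algebroid_scheme \<Rightarrow>
    ('m, 'v) tensor_field \<Rightarrow> nat \<Rightarrow> ('m, 'v) tensor_field set" where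
  "KV_coboundaries_tilde A H k =
     (if k \<le> 1 then {\<lambda>p \<xi>s. 0} else KV_delta A H (k - 1) ` KV_cochains_tilde A H (k - 1))"

definition KV_cohomologous_tilde :: "('m, 'v::real_vector, 'z) algebroid_scheme \<Rightarrow>
    ('m, 'v) tensor_field \<Rightarrow> nat \<Rightarrow> ('m, 'v) tensor_field rel" where
  "KV_cohomologous_tilde A H k =
     {(\<phi>, \<psi>). \<phi> \<in> KV_cocycles_tilde A H k \<and> \<psi> \<in> KV_cocycles_tilde A H k \<and>
        (\<lambda>p \<xi>s. \<phi> p \<xi>s - \<psi> p \<xi>s) \<in> KV_coboundaries_tilde A H k}"

definition KV_cohomology_tilde :: "('m, 'v::real_vector, 'z) algebroid_scheme \<Rightarrow>
    ('m, 'v) tensor_field \<Rightarrow> nat \<Rightarrow> ('m, 'v) tensor_field set set" where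
  "KV_cohomology_tilde A H k = KV_cocycles_tilde A H k // KV_cohomologous_tilde A H k"

definition KV_class_tilde :: "('m, 'v::real_vector, 'z) algebroid_scheme \<Rightarrow>
    ('m, 'v) tensor_field \<Rightarrow> nat \<Rightarrow> ('m, 'v) tensor_field \<Rightarrow> ('m, 'v) tensor_field set" where
  "KV_class_tilde A H k \<phi> = KV_cohomologous_tilde A H k `` {\<phi>}"

section \<open>Deformations\<close>

text \<open>A formal power series in \<open>t\<close> with coefficients sections, functions or tensors is its sequence
  of coefficients.  The following operations are the \<open>\<real>[[t]]\<close>-linear extensions of the structure
  maps; the last argument selects the coefficient.\<close>

definition ps_star :: "('m, 'v::real_vector, 'z) algebroid_scheme \<Rightarrow>
    (nat \<Rightarrow> 'm \<Rightarrow> 'v) \<Rightarrow> (nat \<Rightarrow> 'm \<Rightarrow> 'v) \<Rightarrow> nat \<Rightarrow> 'm \<Rightarrow> 'v" where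
  "ps_star A x y = (\<lambda>k p. \<Sum>i\<le>k. star A (x i) (y (k - i)) p)"

definition ps_lie_bracket :: "('m, 'v::real_vector, 'z) algebroid_scheme \<Rightarrow>
    (nat \<Rightarrow> 'm \<Rightarrow> 'v) \<Rightarrow> (nat \<Rightarrow> 'm \<Rightarrow> 'v) \<Rightarrow> nat \<Rightarrow> 'm \<Rightarrow> 'v" where
  "ps_lie_bracket A x y = (\<lambda>k p. ps_star A x y k p - ps_star A y x k p)"

definition ps_anchor_deriv :: "('m, 'v, 'z) algebroid_scheme \<Rightarrow>
    (nat \<Rightarrow> 'm \<Rightarrow> 'v) \<Rightarrow> (nat \<Rightarrow> 'm \<Rightarrow> real) \<Rightarrow> nat \<Rightarrow> 'm \<Rightarrow> real" where
  "ps_anchor_deriv A x f = (\<lambda>k p. \<Sum>i\<le>k. anchor_deriv A (x i) (f (k - i)) p)"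

definition ps_pairing :: "('m \<Rightarrow> 'v \<Rightarrow> real) \<Rightarrow> (nat \<Rightarrow> 'm \<Rightarrow> 'v) \<Rightarrow> nat \<Rightarrow> 'm \<Rightarrow> real" where
  "ps_pairing \<alpha> x = (\<lambda>k. pairing \<alpha> (x k))"

definition ps_sharp :: "('m, 'v::real_vector, 'z) vec_bundle_scheme \<Rightarrow>
    (nat \<Rightarrow> ('m, 'v) tensor_field) \<Rightarrow> ('m \<Rightarrow> 'v \<Rightarrow> real) \<Rightarrow> nat \<Rightarrow> 'm \<Rightarrow> 'v" where
  "ps_sharp A Ht \<alpha> = (\<lambda>k. sharp A (Ht k) \<alpha>)"

definition ps_KV_square ::
    "('m, 'v::real_vector, 'z) algebroid_scheme \<Rightarrow> (nat \<Rightarrow> ('m, 'v) tensor_field) \<Rightarrow>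
     ('m \<Rightarrow> 'v \<Rightarrow> real) \<Rightarrow> ('m \<Rightarrow> 'v \<Rightarrow> real) \<Rightarrow> ('m \<Rightarrow> 'v \<Rightarrow> real) \<Rightarrow> nat \<Rightarrow> 'm \<Rightarrow> real" where
  "ps_KV_square A Ht \<alpha>1 \<alpha>2 \<alpha>3 = (\<lambda>k p.
       ps_anchor_deriv A (ps_sharp A Ht \<alpha>1) (ps_pairing \<alpha>3 (ps_sharp A Ht \<alpha>2)) k p
     - ps_anchor_deriv A (ps_sharp A Ht \<alpha>2) (ps_pairing \<alpha>3 (ps_sharp A Ht \<alpha>1)) k p
     + ps_pairing \<alpha>1 (ps_star A (ps_sharp A Ht \<alpha>2) (ps_sharp A Ht \<alpha>3)) k p
     - ps_pairing \<alpha>2 (ps_star A (ps_sharp A Ht \<alpha>1) (ps_sharp A Ht \<alpha>3)) k p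
     - ps_pairing \<alpha>3 (ps_lie_bracket A (ps_sharp A Ht \<alpha>1) (ps_sharp A Ht \<alpha>2)) k p)"

definition ps_truncate ::
    "nat \<Rightarrow> (nat \<Rightarrow> ('m, 'v) tensor_field) \<Rightarrow> nat \<Rightarrow> ('m, 'v) tensor_field" where
  "ps_truncate n Hs = (\<lambda>i. if i \<le> n then Hs i else (\<lambda>p \<xi>s. 0))"

text \<open>\<open>Hs i\<close> is the coefficient of \<open>t\<^sup>i\<close>; only the values for \<open>i \<le> n\<close> matter.\<close>

definition order_deformation :: "('m, 'v::real_vector, 'z) algebroid_scheme \<Rightarrow>
    ('m, 'v) tensor_field \<Rightarrow> nat \<Rightarrow> (nat \<Rightarrow> ('m, 'v) tensor_field) \<Rightarrow> bool" where
  "order_deformation A H n Hs \<longleftrightarrow>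
     Hs 0 = H \<and> (\<forall>i\<le>n. Hs i \<in> Sym2 A) \<and>
     (\<forall>\<alpha>1\<in>dual_sections A. \<forall>\<alpha>2\<in>dual_sections A. \<forall>\<alpha>3\<in>dual_sections A. \<forall>k\<le>n.
        ps_KV_square A (ps_truncate n Hs) \<alpha>1 \<alpha>2 \<alpha>3 k = (\<lambda>p. 0))"

definition extendable_deformation :: "('m, 'v::real_vector, 'z) algebroid_scheme \<Rightarrow>
    ('m, 'v) tensor_field \<Rightarrow> nat \<Rightarrow> (nat \<Rightarrow> ('m, 'v) tensor_field) \<Rightarrow> bool" where
  "extendable_deformation A H n Hs \<longleftrightarrow>
     (\<exists>K\<in>Sym2 A. order_deformation A H (n + 1) (Hs(n + 1 := K)))"

end

theory Submission
  imports Defs "HOL-Library.Function_Algebras"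
begin

text \<open>The bracket of a cochain \<open>P\<close> of arity one with itself is twice
  \<open>P(L\<^bsub>P\<alpha>\<^esub>\<beta> - L\<^bsub>P\<beta>\<^esub>\<alpha>) - [P\<alpha>, P\<beta>]\<close>; if \<open>P = H\<^sup>\<sharp>\<close> with \<open>H\<close> symmetric, the pairing of this
  expression with a third covector is \<open>[H, H]\<close>.  Hence the coefficient of \<open>t\<^sup>k\<close> in \<open>[H\<^sub>t, H\<^sub>t]\<close> is
  half the sum of the brackets of \<open>\<H>\<^sub>i\<close> and \<open>\<H>\<^sub>j\<close> over \<open>i + j = k\<close>; for \<open>k = n + 1\<close> and an additional term \<open>t\<^sup>n\<^sup>+\<^sup>1 K\<close> it equals \<open>\<Theta> - \<delta>K\<close>.
  That \<open>\<Theta>\<close> is closed follows from the Jacobi identity for arity-one cochains, which uses only that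
  \<open>L\<close> is a representation of the sub-adjacent Lie algebra and that the cochains are additive.
  The brackets are defined as fields with prescribed values on global sections; their existence is
  tensoriality, which rests on bump functions.\<close>

section \<open>Calculus of smooth functions\<close>

text \<open>\<open>Lop\<close>, \<open>Psi\<close>, \<open>sharp\<close> and the brackets are
  definite descriptions, and the product is given on global sections only, so each formula about
  them needs an object constructed beforehand. Cut-off frames show that a C-infinity-linear map
  depends only on values at a point, and every point value extends to a global section. That the
  anchor respects brackets is extracted from left symmetry applied to multiples f z; together with
  left symmetry it makes L a representation. The algebraic core lives over abelian groups, without
  scalars. The Jacobi identity is proved for three equal arguments, where it reduces to the identity
  for the sub-adjacent bracket, and then polarised; this is why equations 2 x = 0 and 6 x = 0 are
  carried along until they are cancelled in a real vector space. In the coefficient of order n + 1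
  the new term K meets H at both ends of the convolution, so the coefficient is twice [H, K] +
  Theta. Since delta K = -[H, K] on 2-cochains, the extension equation is delta K = Theta, and
  symmetric K are exactly the 2-cochains of the subcomplex.\<close>

lemma Euclidean_space_eq_top_of_set:
  "Euclidean_space d = top_of_set (topspace (Euclidean_space d))"
  by (metis Euclidean_space_def euclidean_product_topology topspace_Euclidean_space)

text \<open>Passes from the abstract topology of the definitions to \<open>continuous_on\<close>, to
  which the usual continuity rules apply.\<close>

lemma continuous_map_Euclidean_subtopology:
  assumes "W \<subseteq> topspace (Euclidean_space d)"
  shows "continuous_map (subtopology (Euclidean_space d) W) euclidean f \<longleftrightarrow> continuous_on W f"
  using assms
  by (subst Euclidean_space_eq_top_of_set)
    (simp add: subtopology_subtopology inf.absorb2)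

text \<open>W is open only relative to the subspace of sequences vanishing from d on. The line in
  direction i stays in that subspace because i < d, and the rest is continuity of the line.\<close>

lemma eventually_line_in_open:
  assumes W: "openin (Euclidean_space d) W" and x: "x \<in> W" and i: "i < d"
  shows "eventually (\<lambda>t. x(i := t) \<in> W) (nhds (x i))"
proof -
  obtain T where T: "open T" "W = topspace (Euclidean_space d) \<inter> T"
    using W by (subst (asm) Euclidean_space_eq_top_of_set) (auto simp: openin_open)
  have line: "x(i := t) \<in> topspace (Euclidean_space d)" for t
    using x i T by (auto simp: topspace_Euclidean_space)
  have "continuous_on UNIV (\<lambda>t. x(i := t))"
  proof (rule continuous_on_coordinatewise_then_product)
    show "continuous_on UNIV (\<lambda>t. (x(i := t)) j)" for j
      by (cases "j = i") simp_all
  qed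
  then have "open ((\<lambda>t. x(i := t)) -` T)"
    using T(1) open_vimage by blast
  moreover have "x i \<in> (\<lambda>t. x(i := t)) -` T" using x T by simp
  ultimately show ?thesis
    using line T(2) by (auto simp: eventually_nhds)
qed

lemma partial_deriv_cong:
  assumes W: "openin (Euclidean_space d) W" and x: "x \<in> W" and i: "i < d"
    and fg: "\<And>x. x \<in> W \<Longrightarrow> f x = g x"
  shows "partial_deriv i f x = partial_deriv i g x"
    and "(\<lambda>t. f (x(i := t))) differentiable (at (x i)) \<longleftrightarrow> (\<lambda>t. g (x(i := t))) differentiable (at (x i))"
proof -
  have ev: "eventually (\<lambda>t. f (x(i := t)) = g (x(i := t))) (nhds (x i))"
    using eventually_line_in_open[OF W x i] by eventually_elim (simp add: fg)
  then show "partial_deriv i f x = partial_deriv i g x"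
    unfolding partial_deriv_def by (rule deriv_cong_ev) simp
  have "(\<lambda>t. f (x(i := t))) differentiable (at (x i))"
    if "(\<lambda>t. g (x(i := t))) differentiable (at (x i))"
      "eventually (\<lambda>t. f (x(i := t)) = g (x(i := t))) (nhds (x i))" for f g :: "(nat \<Rightarrow> real) \<Rightarrow> real"
    using that by (metis DERIV_cong_ev real_differentiable_def)
  note imp = this
  have ev': "eventually (\<lambda>t. g (x(i := t)) = f (x(i := t))) (nhds (x i))"
    using ev by eventually_elim simp
  show "(\<lambda>t. f (x(i := t))) differentiable (at (x i)) \<longleftrightarrow> (\<lambda>t. g (x(i := t))) differentiable (at (x i))"
    using imp[OF _ ev] imp[OF _ ev'] by blast
qed

text \<open>Chart representatives are composed with \<open>inv_into\<close> and hence arbitrary off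
  the chart range, so regularity must be insensitive to values outside W. Openness of W makes this
  true of partial derivatives.\<close>

lemma Ck_on_cong:
  assumes W: "openin (Euclidean_space d) W" and "\<And>x. x \<in> W \<Longrightarrow> f x = g x"
  shows "Ck_on k d W f \<longleftrightarrow> Ck_on k d W g"
  using assms(2)
proof (induction k arbitrary: f g)
  case 0
  then show ?case
    using openin_subset[OF W] by (auto simp: continuous_map_Euclidean_subtopology cong: continuous_on_cong)
next
  case (Suc k)
  have "continuous_on W f \<longleftrightarrow> continuous_on W g"
    using Suc.prems by (rule continuous_on_cong[OF refl])
  moreover have "Ck_on k d W (partial_deriv i f) \<longleftrightarrow> Ck_on k d W (partial_deriv i g)" if "i < d" for i
    by (rule Suc.IH) (rule partial_deriv_cong(1)[OF W _ that Suc.prems])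
  moreover have "(\<lambda>t. f (x(i := t))) differentiable at (x i) \<longleftrightarrow> (\<lambda>t. g (x(i := t))) differentiable at (x i)"
    if "x \<in> W" "i < d" for x i
    by (rule partial_deriv_cong(2)[OF W that Suc.prems])
  ultimately show ?case
    unfolding Ck_on.simps continuous_map_Euclidean_subtopology[OF openin_subset[OF W]] by blast
qed

lemma Ck_on_0:
  "openin (Euclidean_space d) W \<Longrightarrow> Ck_on 0 d W f \<longleftrightarrow> continuous_on W f"
  by (simp add: continuous_map_Euclidean_subtopology openin_subset)

lemma Ck_on_Suc:
  assumes "openin (Euclidean_space d) W"
  shows "Ck_on (Suc k) d W f \<longleftrightarrow> continuous_on W f \<and>
     (\<forall>i<d. (\<forall>x\<in>W. (\<lambda>t. f (x(i := t))) differentiable at (x i)) \<and> Ck_on k d W (partial_deriv i f))"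
  by (simp add: continuous_map_Euclidean_subtopology openin_subset[OF assms])

text \<open>Lets the derivatives be given by explicit formulas f' valid on W only, in place of
  \<open>partial_deriv\<close>, so that the rules below can be proved by induction on k.\<close>

lemma Ck_on_SucI:
  assumes W: "openin (Euclidean_space d) W" and "continuous_on W f"
    and f': "\<And>i x. i < d \<Longrightarrow> x \<in> W \<Longrightarrow> ((\<lambda>t. f (x(i := t))) has_real_derivative f' i x) (at (x i))"
    and "\<And>i. i < d \<Longrightarrow> Ck_on k d W (f' i)"
  shows "Ck_on (Suc k) d W f"
proof -
  have "partial_deriv i f x = f' i x" if "i < d" "x \<in> W" for i x
    unfolding partial_deriv_def using f'[OF that] by (rule DERIV_imp_deriv)
  then have "Ck_on k d W (partial_deriv i f)" if "i < d" for i
    using Ck_on_cong[OF W, of "partial_deriv i f" "f' i" k] assms(4) that by blast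
  then show ?thesis
    using assms by (auto simp: Ck_on_Suc[OF W] real_differentiable_def simp del: Ck_on.simps)
qed

lemma Ck_on_SucD:
  assumes "openin (Euclidean_space d) W" "Ck_on (Suc k) d W f" "i < d"
  shows "x \<in> W \<Longrightarrow> ((\<lambda>t. f (x(i := t))) has_real_derivative partial_deriv i f x) (at (x i))"
    and "Ck_on k d W (partial_deriv i f)"
  using assms(2,3) unfolding partial_deriv_def Ck_on_Suc[OF assms(1)]
  by (blast intro: DERIV_deriv_iff_real_differentiable[THEN iffD2])+

lemma Ck_on_continuous:
  "openin (Euclidean_space d) W \<Longrightarrow> Ck_on k d W f \<Longrightarrow> continuous_on W f"
  by (cases k) (simp_all only: Ck_on_0 Ck_on_Suc)

lemma Ck_on_Suc_imp:
  assumes W: "openin (Euclidean_space d) W"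
  shows "Ck_on (Suc k) d W f \<Longrightarrow> Ck_on k d W f"
proof (induction k arbitrary: f)
  case 0
  then show ?case by (simp only: Ck_on_0[OF W] Ck_on_Suc[OF W])
next
  case (Suc k)
  then show ?case by (subst Ck_on_Suc[OF W]) (metis Ck_on_Suc[OF W])
qed

section \<open>Algebra and composition of differentiable functions\<close>

lemma Ck_on_const:
  assumes W: "openin (Euclidean_space d) W"
  shows "Ck_on k d W (\<lambda>x. c)"
proof (induction k arbitrary: c)
  case 0
  then show ?case by (simp add: Ck_on_0[OF W] del: Ck_on.simps)
next
  case (Suc k)
  show ?case by (rule Ck_on_SucI[OF W, where f' = "\<lambda>i x. 0"]) (auto intro: Suc)
qed

lemma Ck_on_add:
  assumes W: "openin (Euclidean_space d) W"
  shows "Ck_on k d W f \<Longrightarrow> Ck_on k d W g \<Longrightarrow> Ck_on k d W (\<lambda>x. f x + g x)"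
proof (induction k arbitrary: f g)
  case 0
  then show ?case by (simp add: Ck_on_0[OF W] continuous_on_add del: Ck_on.simps)
next
  case (Suc k)
  note D = Ck_on_SucD[OF W Suc.prems(1)] Ck_on_SucD[OF W Suc.prems(2)]
  show ?case
    by (rule Ck_on_SucI[OF W, where f' = "\<lambda>i x. partial_deriv i f x + partial_deriv i g x"])
      (blast intro: continuous_on_add Ck_on_continuous[OF W] Suc.prems, (rule DERIV_add D Suc.IH | assumption)+)
qed

lemma Ck_on_mult:
  assumes W: "openin (Euclidean_space d) W"
  shows "Ck_on k d W f \<Longrightarrow> Ck_on k d W g \<Longrightarrow> Ck_on k d W (\<lambda>x. f x * g x)"
proof (induction k arbitrary: f g)
  case 0
  then show ?case by (simp add: Ck_on_0[OF W] continuous_on_mult del: Ck_on.simps)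
next
  case (Suc k)
  note D = Ck_on_SucD[OF W Suc.prems(1)] Ck_on_SucD[OF W Suc.prems(2)]
  note k = Suc.prems[THEN Ck_on_Suc_imp[OF W]]
  show ?case
  proof (rule Ck_on_SucI[OF W, where f' = "\<lambda>i x. f x * partial_deriv i g x + partial_deriv i f x * g x"])
    show "continuous_on W (\<lambda>x. f x * g x)"
      using Suc.prems Ck_on_continuous[OF W] by (blast intro: continuous_on_mult)
    fix i assume i: "i < d"
    show "Ck_on k d W (\<lambda>x. f x * partial_deriv i g x + partial_deriv i f x * g x)"
      using i k D by (intro Ck_on_add[OF W] Suc.IH)
    fix x assume x: "x \<in> W"
    show "((\<lambda>t. f (x(i := t)) * g (x(i := t))) has_real_derivative
        f x * partial_deriv i g x + partial_deriv i f x * g x) (at (x i))"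
      using DERIV_mult'[OF D(1)[OF i x] D(3)[OF i x]] by (simp only: fun_upd_triv)
  qed
qed

lemma Ck_on_inverse:
  assumes W: "openin (Euclidean_space d) W" and nz: "\<And>x. x \<in> W \<Longrightarrow> f x \<noteq> 0"
  shows "Ck_on k d W f \<Longrightarrow> Ck_on k d W (\<lambda>x. inverse (f x))"
proof (induction k)
  case 0
  then show ?case using nz by (simp add: Ck_on_0[OF W] continuous_on_inverse del: Ck_on.simps)
next
  case (Suc k)
  note D = Ck_on_SucD[OF W Suc.prems(1)]
  have k: "Ck_on k d W (\<lambda>x. inverse (f x))"
    using Suc Ck_on_Suc_imp[OF W] by blast
  show ?case
  proof (rule Ck_on_SucI[OF W, where f' = "\<lambda>i x. (-1) * (inverse (f x) * partial_deriv i f x * inverse (f x))"])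
    show "continuous_on W (\<lambda>x. inverse (f x))"
      using Suc.prems Ck_on_continuous[OF W] nz by (blast intro: continuous_on_inverse)
    fix i assume i: "i < d"
    show "Ck_on k d W (\<lambda>x. (-1) * (inverse (f x) * partial_deriv i f x * inverse (f x)))"
      using i k D by (intro Ck_on_mult[OF W] Ck_on_const[OF W])
    fix x assume x: "x \<in> W"
    show "((\<lambda>t. inverse (f (x(i := t)))) has_real_derivative
        (-1) * (inverse (f x) * partial_deriv i f x * inverse (f x))) (at (x i))"
      using DERIV_inverse'[OF D(1)[OF i x]] nz[OF x] by (simp only: fun_upd_triv mult_minus1 not_False_eq_True simp_thms)
  qed
qed

text \<open>Smoothness of the outer function is expressed by membership in a family closed under
  differentiation; the induction then needs only the chain rule, with h replaced by its derivative
  in the same family.\<close>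

lemma Ck_on_compose:
  assumes W: "openin (Euclidean_space d) W"
    and F: "\<And>h. h \<in> F \<Longrightarrow> \<exists>h'\<in>F. \<forall>t. (h has_real_derivative h' t) (at t)"
  shows "Ck_on k d W g \<Longrightarrow> h \<in> F \<Longrightarrow> Ck_on k d W (\<lambda>x. h (g x))"
proof (induction k arbitrary: h)
  have cont: "continuous_on W (\<lambda>x. h (g x))" if "h \<in> F" "continuous_on W g" for h
  proof -
    have "continuous_on UNIV h" using F[OF that(1)]
      by (meson DERIV_isCont continuous_at_imp_continuous_on)
    then show ?thesis using continuous_on_compose2 that(2) by blast
  qed
  {
    case 0
    then show ?case using cont by (simp add: Ck_on_0[OF W] del: Ck_on.simps)
  next
    case (Suc k)
    obtain h' where h': "h' \<in> F" "\<And>t. (h has_real_derivative h' t) (at t)"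
      using F[OF Suc.prems(2)] by blast
    note D = Ck_on_SucD[OF W Suc.prems(1)]
    show ?case
    proof (rule Ck_on_SucI[OF W, where f' = "\<lambda>i x. h' (g x) * partial_deriv i g x"])
      show "continuous_on W (\<lambda>x. h (g x))"
        using cont Suc.prems Ck_on_continuous[OF W] by blast
      fix i assume i: "i < d"
      show "Ck_on k d W (\<lambda>x. h' (g x) * partial_deriv i g x)"
        using Suc.IH[OF Ck_on_Suc_imp[OF W Suc.prems(1)] h'(1)] D(2)[OF i]
        by (intro Ck_on_mult[OF W])
      fix x assume x: "x \<in> W"
      show "((\<lambda>t. h (g (x(i := t)))) has_real_derivative h' (g x) * partial_deriv i g x) (at (x i))"
        using DERIV_chain2[of h "h' (g x)" "\<lambda>t. g (x(i := t))" "x i" "partial_deriv i g x" UNIV]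
          h'(2) D(1)[OF i x] by (simp only: fun_upd_triv)
    qed
  }
qed

section \<open>Restriction and locality\<close>

lemma Ck_on_subset:
  assumes W: "openin (Euclidean_space d) W" and W': "openin (Euclidean_space d) W'" "W' \<subseteq> W"
  shows "Ck_on k d W f \<Longrightarrow> Ck_on k d W' f"
proof (induction k arbitrary: f)
  case 0
  then show ?case using W'(2) continuous_on_subset unfolding Ck_on_0[OF W] Ck_on_0[OF W'(1)] by blast
next
  case (Suc k)
  then show ?case using W'(2) continuous_on_subset
    unfolding Ck_on_Suc[OF W] Ck_on_Suc[OF W'(1)] by blast
qed

lemma Ck_on_local:
  assumes W: "openin (Euclidean_space d) W"
    and "\<And>x. x \<in> W \<Longrightarrow> \<exists>V. openin (Euclidean_space d) V \<and> x \<in> V \<and> Ck_on k d V f"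
  shows "Ck_on k d W f"
  using assms(2)
proof (induction k arbitrary: f)
  have cont: "continuous_on W f"
    if loc: "\<And>x. x \<in> W \<Longrightarrow> \<exists>V. openin (Euclidean_space d) V \<and> x \<in> V \<and> continuous_on V f" for f :: "_ \<Rightarrow> real"
  proof -
    have "continuous (at x within W) f" if x: "x \<in> W" for x
    proof -
      obtain V where V: "openin (Euclidean_space d) V" "x \<in> V" "continuous_on V f" using loc[OF x] by blast
      then obtain T where T: "open T" "V = topspace (Euclidean_space d) \<inter> T"
        by (subst (asm) Euclidean_space_eq_top_of_set) (auto simp: openin_open)
      have "continuous (at x within V) f" using V continuous_on_eq_continuous_within by blast
      \<comment> \<open>V is relatively open, so near x it coincides with the whole subspace;
        continuity within the subspace then restricts to W.\<close>
      moreover have "at x within V = at x within topspace (Euclidean_space d)"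
        using T V(2) by (intro at_within_nhd[of x T]) auto
      ultimately have "continuous (at x within (topspace (Euclidean_space d))) f" by simp
      then show ?thesis
        using continuous_within_subset openin_subset[OF W] by blast
    qed
    then show ?thesis by (simp add: continuous_on_eq_continuous_within)
  qed
  {
    case 0
    show ?case unfolding Ck_on_0[OF W] by (rule cont) (metis 0 Ck_on_0)
  next
    case (Suc k)
    have "continuous_on W f" by (rule cont) (meson Suc.prems Ck_on_Suc)
    moreover have "(\<lambda>t. f (x(i := t))) differentiable at (x i)" if "i < d" "x \<in> W" for i x
      using Suc.prems[OF that(2)] that by (auto simp: Ck_on_Suc simp del: Ck_on.simps)
    moreover have "Ck_on k d W (partial_deriv i f)" if "i < d" for i
      by (rule Suc.IH) (metis Suc.prems Ck_on_Suc that)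
    ultimately show ?case unfolding Ck_on_Suc[OF W] by blast
  }
qed

text \<open>The functions vanishing on \<open>t \<le> 0\<close> and given by \<open>p(1/t) exp(-1/t)\<close> for a polynomial \<open>p\<close>
  on \<open>t > 0\<close> are closed under differentiation.\<close>

definition flat_exp :: "real poly \<Rightarrow> real \<Rightarrow> real" where
  "flat_exp p t = (if t \<le> 0 then 0 else poly p (inverse t) * exp (- inverse t))"

text \<open>Substituting x = 1/t, this is the flatness of \<open>flat_exp p\<close> at 0.\<close>

lemma poly_mult_exp_minus_tendsto_0: "((\<lambda>x. poly p x * exp (- x)) \<longlongrightarrow> 0) (at_top :: real filter)"
proof (induction p)
  case 0
  then show ?case by simp
next
  case (pCons a p)
  \<comment> \<open>Each step of the induction on q moves a factor x out of the polynomial, so a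
    power of x is carried along and generalised.\<close>
  have aux: "((\<lambda>x. poly q x * (x ^ k) * exp (- x)) \<longlongrightarrow> 0) (at_top :: real filter)" for q and k :: nat
  proof (induction q arbitrary: k)
    case 0
    then show ?case by simp
  next
    case (pCons a q)
    have "((\<lambda>x. a * (x ^ k / exp x) + poly q x * (x ^ Suc k) * exp (- x)) \<longlongrightarrow> a * 0 + 0) at_top"
      by (intro tendsto_intros tendsto_power_div_exp_0 pCons.IH)
    then show ?case by (simp add: algebra_simps exp_minus divide_inverse)
  qed
  show ?case using aux[of "pCons a p" 0] by simp
qed

text \<open>With s = 1/t one has ds/dt = -s^2, so p(s) exp(-s) has derivative s^2 (p(s) - p'(s))
  exp(-s); \<open>[:0, 0, 1:]\<close> is the square of the variable.\<close>

lemma flat_exp_has_derivative: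
  "(flat_exp p has_real_derivative flat_exp ([:0, 0, 1:] * (p - pderiv p)) t) (at t)"
proof -
  consider "t > 0" | "t < 0" | "t = 0" by linarith
  then show ?thesis
  proof cases
    case 1
    have "((\<lambda>t. poly p (inverse t) * exp (- inverse t)) has_real_derivative
        flat_exp ([:0, 0, 1:] * (p - pderiv p)) t) (at t)"
    proof -
      have inv: "(inverse has_real_derivative - (inverse t ^ 2)) (at t)"
        using DERIV_inverse[of t] 1 by (simp add: numeral_2_eq_2)
      have "((\<lambda>t. poly p (inverse t)) has_real_derivative poly (pderiv p) (inverse t) * - (inverse t ^ 2)) (at t)"
        by (rule DERIV_chain2[OF poly_DERIV inv])
      moreover have "((\<lambda>t. exp (- inverse t)) has_real_derivative exp (- inverse t) * - (- (inverse t ^ 2))) (at t)"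
        by (rule DERIV_chain2[OF DERIV_exp DERIV_minus[OF inv]])
      ultimately show ?thesis
        by (rule DERIV_mult[THEN DERIV_cong])
          (use 1 in \<open>simp add: flat_exp_def power2_eq_square algebra_simps\<close>)
    qed
    moreover have "eventually (\<lambda>s. flat_exp p s = poly p (inverse s) * exp (- inverse s)) (nhds t)"
      using 1 by (auto simp: flat_exp_def eventually_nhds intro!: exI[of _ "{0<..}"])
    ultimately show ?thesis by (simp only: DERIV_cong_ev[OF refl _ refl])
  next
    case 2
    have "((\<lambda>t. 0) has_real_derivative flat_exp ([:0, 0, 1:] * (p - pderiv p)) t) (at t)"
      using 2 by (simp add: flat_exp_def)
    moreover have "eventually (\<lambda>s. flat_exp p s = 0) (nhds t)"
      using 2 by (auto simp: flat_exp_def eventually_nhds intro!: exI[of _ "{..<0}"])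
    ultimately show ?thesis by (simp only: DERIV_cong_ev[OF refl _ refl])
  next
    case 3
    \<comment> \<open>At 0 the right-hand difference quotient is again of the form considered:
      dividing by h multiplies the polynomial by its variable.\<close>
    have "((\<lambda>h. poly ([:0, 1:] * p) (inverse h) * exp (- inverse h)) \<longlongrightarrow> 0) (at_right (0::real))"
      by (rule filterlim_compose[OF poly_mult_exp_minus_tendsto_0 filterlim_inverse_at_top_right])
    moreover have "eventually (\<lambda>h. poly ([:0, 1:] * p) (inverse h) * exp (- inverse h) = flat_exp p h / h) (at_right 0)"
      using eventually_at_right_less by eventually_elim (auto simp: flat_exp_def divide_inverse)
    ultimately have "((\<lambda>h. flat_exp p h / h) \<longlongrightarrow> 0) (at_right 0)"
      using tendsto_cong by force
    moreover have "((\<lambda>h. flat_exp p h / h) \<longlongrightarrow> 0) (at_left 0)"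
    proof (rule tendsto_eventually)
      show "eventually (\<lambda>h. flat_exp p h / h = 0) (at_left 0)"
        by (auto simp: flat_exp_def eventually_at_filter)
    qed
    ultimately have "((\<lambda>h. flat_exp p h / h) \<longlongrightarrow> 0) (at 0)"
      by (simp add: filterlim_split_at)
    then show ?thesis using 3 by (simp add: has_field_derivative_iff flat_exp_def)
  qed
qed

section \<open>Smooth functions on a manifold\<close>

lemma box_subset_open:
  assumes "openin (Euclidean_space d) W" "a \<in> W"
  shows "\<exists>r>0. {x \<in> topspace (Euclidean_space d). \<forall>i<d. \<bar>x i - a i\<bar> \<le> r} \<subseteq> W"
proof -
  obtain T where T: "open T" "W = topspace (Euclidean_space d) \<inter> T"
    using assms(1) by (subst (asm) Euclidean_space_eq_top_of_set) (auto simp: openin_open)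
  obtain X where X: "a \<in> (\<Pi>\<^sub>E i\<in>UNIV. X i)" "\<And>i. open (X i)" "(\<Pi>\<^sub>E i\<in>UNIV. X i) \<subseteq> T"
    using product_topology_open_contains_basis[of "\<lambda>i. euclidean" UNIV T a] T assms(2)
    by (auto simp: open_fun_def)
  have "\<exists>r>0. \<forall>y. \<bar>y - a i\<bar> \<le> r \<longrightarrow> y \<in> X i" for i
  proof -
    obtain e where "e > 0" "ball (a i) e \<subseteq> X i"
      using X(1) X(2)[of i] openE[of "X i" "a i"] by auto
    then show ?thesis
      by (intro exI[of _ "e / 2"]) (auto simp: dist_real_def subset_iff abs_minus_commute)
  qed
  then obtain \<rho> where \<rho>: "\<And>i. \<rho> i > 0" "\<And>i y. \<bar>y - a i\<bar> \<le> \<rho> i \<Longrightarrow> y \<in> X i" by metis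
  \<comment> \<open>The 1 keeps the minimum defined in dimension 0.\<close>
  define r where "r = Min (insert 1 (\<rho> ` {..<d}))"
  have r: "r > 0" "\<And>i. i < d \<Longrightarrow> r \<le> \<rho> i" using \<rho>(1) by (auto simp: r_def)
  have "x \<in> W" if x: "x \<in> topspace (Euclidean_space d)" "\<forall>i<d. \<bar>x i - a i\<bar> \<le> r" for x
  proof -
    have "x i \<in> X i" for i
    proof (cases "i < d")
      case True
      then show ?thesis using x(2) r(2) by (intro \<rho>(2)) force
    next
      case False
      then have "x i = a i" using x(1) assms T(2) by (auto simp: topspace_Euclidean_space)
      then show ?thesis using X(1) by auto
    qed
    then have "x \<in> T" using X(3) by auto
    then show ?thesis using x T by simp
  qed
  then show ?thesis using r(1) by auto
qed

text \<open>The box is a product of intervals and, in the coordinates from d on, of singletons {0},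
  so Tychonoff's theorem applies in the function space.\<close>

lemma compact_box:
  "compact {x \<in> topspace (Euclidean_space d). \<forall>i<d. \<bar>x i - a i\<bar> \<le> (r::real)}"
proof -
  have "compactin (product_topology (\<lambda>i. euclidean) UNIV)
      (\<Pi>\<^sub>E i\<in>UNIV. if i < d then {a i - r..a i + r} else {0})"
    by (subst compactin_PiE) (auto simp: compactin_euclidean_iff)
  moreover have "(\<Pi>\<^sub>E i\<in>UNIV. if i < d then {a i - r..a i + r} else {0}) =
      {x \<in> topspace (Euclidean_space d). \<forall>i<d. \<bar>x i - a i\<bar> \<le> r}"
    by (auto simp: topspace_Euclidean_space PiE_iff abs_le_iff extensional_def split: if_splits)
      (metis atLeastAtMost_iff singletonD linorder_not_less add.commute diff_le_eq le_diff_eq)+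
  ultimately show ?thesis
    by (simp add: euclidean_product_topology compactin_euclidean_iff)
qed

locale manifold =
  fixes M :: "('m::{t2_space,second_countable_topology}, 'z) smooth_atlas_scheme"
  assumes smooth_manifold: "smooth_manifold M"
begin

section \<open>Charts\<close>

lemma chart_cover: obtains U c where "(U, c) \<in> charts M" "p \<in> U"
proof -
  have "p \<in> (\<Union>(U, c)\<in>charts M. U)" using smooth_manifold by (simp add: smooth_manifold_def)
  then show ?thesis using that by blast
qed

lemma chart_domain_open: "(U, c) \<in> charts M \<Longrightarrow> open U"
  using smooth_manifold by (auto simp: smooth_manifold_def)

lemma chart_homeo: "(U, c) \<in> charts M \<Longrightarrow>
    homeomorphic_map (top_of_set U) (subtopology (Euclidean_space (mdim M)) (c ` U)) c"
  using smooth_manifold by (auto simp: smooth_manifold_def)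

lemma chart_range_open: "(U, c) \<in> charts M \<Longrightarrow> openin (Euclidean_space (mdim M)) (c ` U)"
  using smooth_manifold by (auto simp: smooth_manifold_def)

lemma chart_inj: "(U, c) \<in> charts M \<Longrightarrow> inj_on c U"
  using homeomorphic_imp_injective_map[OF chart_homeo] by fastforce

lemma chart_image_open:
  assumes "(U, c) \<in> charts M" "open S"
  shows "openin (Euclidean_space (mdim M)) (c ` (U \<inter> S))"
proof -
  have "openin (top_of_set U) (U \<inter> S)" using assms(2) by (simp add: openin_open_Int)
  then have "openin (subtopology (Euclidean_space (mdim M)) (c ` U)) (c ` (U \<inter> S))"
    using homeomorphic_map_openness[OF chart_homeo[OF assms(1)]] by (metis Int_lower1 topspace_euclidean_subtopology)
  then show ?thesis using chart_range_open[OF assms(1)] openin_trans_full by blast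
qed

lemma chart_range_subset: "(U, c) \<in> charts M \<Longrightarrow> c ` U \<subseteq> topspace (Euclidean_space (mdim M))"
  using chart_range_open openin_subset by blast

lemma chart_continuous: "(U, c) \<in> charts M \<Longrightarrow> continuous_on U c"
  using homeomorphic_imp_continuous_map[OF chart_homeo]
  by (metis Euclidean_space_eq_top_of_set chart_range_subset continuous_map_in_subtopology
      continuous_map_iff_continuous2 subtopology_subtopology inf.absorb2 continuous_map_iff_continuous)

lemma chart_component_continuous: "(U, c) \<in> charts M \<Longrightarrow> continuous_on U (\<lambda>q. c q i)"
  using chart_continuous by (rule continuous_on_product_then_coordinatewise)

lemma chart_inverse_continuous:
  assumes "(U, c) \<in> charts M"
  shows "continuous_on (c ` U) (inv_into U c)"
proof -
  have "continuous_map (subtopology (Euclidean_space (mdim M)) (c ` U)) (top_of_set U) (inv_into U c)"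
  proof -
    obtain g where g: "homeomorphic_maps (top_of_set U) (subtopology (Euclidean_space (mdim M)) (c ` U)) c g"
      using chart_homeo[OF assms] homeomorphic_map_maps by blast
    then have "g x = inv_into U c x" if "x \<in> topspace (subtopology (Euclidean_space (mdim M)) (c ` U))" for x
      using that chart_inj[OF assms] by (auto simp: homeomorphic_maps_def)
    then show ?thesis
      using g unfolding homeomorphic_maps_def by (blast intro: continuous_map_eq[of _ _ g "inv_into U c"])
  qed
  then show ?thesis
    using chart_range_subset[OF assms] continuous_map_Euclidean_subtopology continuous_map_in_subtopology by blast
qed

lemma chart_inverse [simp]: "(U, c) \<in> charts M \<Longrightarrow> q \<in> U \<Longrightarrow> inv_into U c (c q) = q"
  using chart_inj inv_into_f_f by metis

section \<open>Closure properties of smooth functions on open sets\<close>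

lemma smooth_fun_on_iff:
  "smooth_fun_on M S f \<longleftrightarrow>
    (\<forall>(U,c)\<in>charts M. \<forall>k. Ck_on k (mdim M) (c ` (U \<inter> S)) (\<lambda>x. f (inv_into U c x)))"
  by (simp add: smooth_fun_on_def Cinf_on_def)

lemma smooth_fun_on_cong:
  assumes "open S" "\<And>q. q \<in> S \<Longrightarrow> f q = g q"
  shows "smooth_fun_on M S f \<longleftrightarrow> smooth_fun_on M S g"
proof -
  have "Ck_on k (mdim M) (c ` (U \<inter> S)) (\<lambda>x. f (inv_into U c x)) \<longleftrightarrow>
      Ck_on k (mdim M) (c ` (U \<inter> S)) (\<lambda>x. g (inv_into U c x))" if "(U, c) \<in> charts M" for U c k
    by (rule Ck_on_cong[OF chart_image_open[OF that assms(1)]]) (use assms(2) that in auto)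
  then show ?thesis unfolding smooth_fun_on_iff by blast
qed

lemma smooth_fun_on_eqI:
  "open S \<Longrightarrow> smooth_fun_on M S g \<Longrightarrow> (\<And>q. q \<in> S \<Longrightarrow> f q = g q) \<Longrightarrow> smooth_fun_on M S f"
  using smooth_fun_on_cong[of S f g] by simp

lemma smooth_fun_on_const: "open S \<Longrightarrow> smooth_fun_on M S (\<lambda>q. a)"
  unfolding smooth_fun_on_iff by (auto intro: Ck_on_const chart_image_open)

lemma smooth_fun_on_add:
  "open S \<Longrightarrow> smooth_fun_on M S f \<Longrightarrow> smooth_fun_on M S g \<Longrightarrow> smooth_fun_on M S (\<lambda>q. f q + g q)"
  unfolding smooth_fun_on_iff by (auto intro!: Ck_on_add chart_image_open)

lemma smooth_fun_on_mult:
  "open S \<Longrightarrow> smooth_fun_on M S f \<Longrightarrow> smooth_fun_on M S g \<Longrightarrow> smooth_fun_on M S (\<lambda>q. f q * g q)"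
  unfolding smooth_fun_on_iff by (auto intro!: Ck_on_mult chart_image_open)

lemma smooth_fun_on_inverse:
  assumes "open S" "smooth_fun_on M S f" "\<And>q. q \<in> S \<Longrightarrow> f q \<noteq> 0"
  shows "smooth_fun_on M S (\<lambda>q. inverse (f q))"
proof -
  have "Ck_on k (mdim M) (c ` (U \<inter> S)) (\<lambda>x. inverse (f (inv_into U c x)))" if "(U, c) \<in> charts M" for U c k
    by (rule Ck_on_inverse[OF chart_image_open[OF that assms(1)]]) (use assms that in \<open>auto simp: smooth_fun_on_iff\<close>)
  then show ?thesis unfolding smooth_fun_on_iff by blast
qed

lemma smooth_fun_on_sum:
  "open S \<Longrightarrow> (\<And>i. i \<in> I \<Longrightarrow> smooth_fun_on M S (f i)) \<Longrightarrow> smooth_fun_on M S (\<lambda>q. \<Sum>i\<in>I. f i q)"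
  by (induction I rule: infinite_finite_induct) (auto intro: smooth_fun_on_const smooth_fun_on_add)

lemma smooth_fun_on_minus:
  "open S \<Longrightarrow> smooth_fun_on M S f \<Longrightarrow> smooth_fun_on M S (\<lambda>q. - f q)"
  using smooth_fun_on_mult[OF _ smooth_fun_on_const, of S f "-1"] by simp

lemma smooth_fun_on_diff:
  "open S \<Longrightarrow> smooth_fun_on M S f \<Longrightarrow> smooth_fun_on M S g \<Longrightarrow> smooth_fun_on M S (\<lambda>q. f q - g q)"
  using smooth_fun_on_add[OF _ _ smooth_fun_on_minus, of S f g] by simp

lemma smooth_fun_on_power:
  "open S \<Longrightarrow> smooth_fun_on M S f \<Longrightarrow> smooth_fun_on M S (\<lambda>q. f q ^ k)"
  by (induction k) (auto intro: smooth_fun_on_const smooth_fun_on_mult)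

lemma smooth_fun_on_compose:
  assumes "open S" "smooth_fun_on M S f" "h \<in> F"
    and "\<And>h. h \<in> F \<Longrightarrow> \<exists>h'\<in>F. \<forall>t. (h has_real_derivative h' t) (at t)"
  shows "smooth_fun_on M S (\<lambda>q. h (f q))"
proof -
  have "Ck_on k (mdim M) (c ` (U \<inter> S)) (\<lambda>x. h (f (inv_into U c x)))" if "(U, c) \<in> charts M" for U c k
    by (rule Ck_on_compose[OF chart_image_open[OF that assms(1)] assms(4) _ assms(3)])
      (use assms(2) that in \<open>auto simp: smooth_fun_on_iff\<close>)
  then show ?thesis unfolding smooth_fun_on_iff by blast
qed

lemma smooth_fun_on_subset:
  "open S \<Longrightarrow> open T \<Longrightarrow> T \<subseteq> S \<Longrightarrow> smooth_fun_on M S f \<Longrightarrow> smooth_fun_on M T f"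
  unfolding smooth_fun_on_iff by (auto intro!: Ck_on_subset[OF chart_image_open[of _ _ S] chart_image_open[of _ _ T]])

lemma smooth_fun_on_local:
  assumes "open S" "\<And>p. p \<in> S \<Longrightarrow> \<exists>T. open T \<and> p \<in> T \<and> smooth_fun_on M T f"
  shows "smooth_fun_on M S f"
  unfolding smooth_fun_on_iff
proof (safe)
  fix U c k assume Uc: "(U, c) \<in> charts M"
  show "Ck_on k (mdim M) (c ` (U \<inter> S)) (\<lambda>x. f (inv_into U c x))"
  proof (rule Ck_on_local[OF chart_image_open[OF Uc assms(1)]])
    fix x assume "x \<in> c ` (U \<inter> S)"
    then obtain q where q: "x = c q" "q \<in> U" "q \<in> S" by auto
    then obtain T where T: "open T" "q \<in> T" "smooth_fun_on M T f" using assms(2) by blast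
    then show "\<exists>V. openin (Euclidean_space (mdim M)) V \<and> x \<in> V \<and> Ck_on k (mdim M) V (\<lambda>x. f (inv_into U c x))"
      using q Uc chart_image_open[OF Uc T(1)]
      by (intro exI[of _ "c ` (U \<inter> T)"]) (auto simp: smooth_fun_on_iff)
  qed
qed

text \<open>Read in another chart, the component is a component of a transition map.\<close>

lemma chart_component_smooth:
  assumes "(U, c) \<in> charts M" "i < mdim M"
  shows "smooth_fun_on M U (\<lambda>q. c q i)"
  using smooth_manifold assms by (force simp: smooth_fun_on_def smooth_manifold_def)

text \<open>The bump is \<open>flat_exp 1\<close>, that is exp(-1/s) for s > 0, applied to s = r^2 -
  |c q - c p|^2 and normalised at p. It is positive on the ball s > 0, whose points all lie in the
  preimage C of a compact box.\<close>

lemma bump_function: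
  assumes "open S" "p \<in> S"
  obtains \<mu> T C where "smooth_fun_on M UNIV \<mu>" "\<mu> p = 1" "open T" "p \<in> T"
    "\<And>q. q \<in> T \<Longrightarrow> \<mu> q \<noteq> 0" "closed C" "C \<subseteq> S" "\<And>q. q \<notin> C \<Longrightarrow> \<mu> q = 0"
proof -
  obtain U c where Uc: "(U, c) \<in> charts M" "p \<in> U" using chart_cover by blast
  define d where "d = mdim M"
  obtain r where r: "r > 0"
    "{x \<in> topspace (Euclidean_space d). \<forall>i<d. \<bar>x i - c p i\<bar> \<le> r} \<subseteq> c ` (U \<inter> S)" (is "?B \<subseteq> _")
    using box_subset_open[OF chart_image_open[OF Uc(1) assms(1)], of "c p"] Uc assms d_def by blast
  define C where "C = inv_into U c ` ?B"
  \<comment> \<open>C has to be closed in the whole manifold, not only in U, for the extension by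
    zero to be smooth; compactness and the Hausdorff property give this. The open sets U and the
    complement of C then cover the manifold.\<close>
  have "compact C" unfolding C_def
    using r(2) by (intro compact_continuous_image compact_box continuous_on_subset[OF chart_inverse_continuous[OF Uc(1)]]) auto
  then have C: "closed C" by (rule compact_imp_closed)
  have CS: "C \<subseteq> U \<inter> S"
    using r(2) Uc(1) unfolding C_def by (auto dest!: subsetD[OF r(2)])
  define s where "s q = r\<^sup>2 - (\<Sum>i<d. (c q i - c p i)\<^sup>2)" for q
  have in_C: "q \<in> C" if "q \<in> U" "s q > 0" for q
  proof -
    have "\<bar>c q i - c p i\<bar> \<le> r" if "i < d" for i
    proof -
      have "(c q i - c p i)\<^sup>2 \<le> (\<Sum>i<d. (c q i - c p i)\<^sup>2)"
        by (rule member_le_sum) (use that in auto)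
      also have "\<dots> \<le> r\<^sup>2" using \<open>s q > 0\<close> by (simp add: s_def)
      finally show ?thesis using r(1) abs_le_square_iff[of "c q i - c p i" r] by simp
    qed
    then have "c q \<in> ?B" using chart_range_subset[OF Uc(1)] that(1) d_def by auto
    then show ?thesis unfolding C_def using that(1) Uc(1) by (intro image_eqI[of _ _ "c q"]) simp_all
  qed
  define \<mu> where "\<mu> q = (if q \<in> U then inverse (flat_exp 1 (r\<^sup>2)) * flat_exp 1 (s q) else 0)" for q
  have pos: "flat_exp 1 t > 0 \<longleftrightarrow> t > 0" for t by (simp add: flat_exp_def)
  have nz: "flat_exp 1 t = 0 \<longleftrightarrow> t \<le> 0" for t by (simp add: flat_exp_def)
  have sm_s: "smooth_fun_on M U s"
    unfolding s_def using chart_domain_open[OF Uc(1)] chart_component_smooth[OF Uc(1)] d_def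
    by (intro smooth_fun_on_diff smooth_fun_on_const smooth_fun_on_sum smooth_fun_on_power) auto
  have "smooth_fun_on M U (\<lambda>q. inverse (flat_exp 1 (r\<^sup>2)) * flat_exp 1 (s q))"
    by (intro smooth_fun_on_mult smooth_fun_on_const chart_domain_open[OF Uc(1)]
        smooth_fun_on_compose[OF _ sm_s, of _ "range flat_exp"])
      (auto intro: flat_exp_has_derivative)
  then have smU: "smooth_fun_on M U \<mu>"
    by (subst smooth_fun_on_cong[OF chart_domain_open[OF Uc(1)]]) (auto simp: \<mu>_def)
  have zero: "\<mu> q = 0" if "q \<notin> C" for q using in_C[of q] that by (force simp: \<mu>_def nz)
  have smC: "smooth_fun_on M (- C) \<mu>"
    using C by (subst smooth_fun_on_cong[of _ _ "\<lambda>q. 0"]) (auto simp: zero intro: smooth_fun_on_const)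
  show ?thesis
  proof (rule that)
    show "smooth_fun_on M UNIV \<mu>"
    proof (rule smooth_fun_on_local)
      fix q :: 'm
      show "\<exists>T. open T \<and> q \<in> T \<and> smooth_fun_on M T \<mu>"
        using smU smC C CS chart_domain_open[OF Uc(1)] by (cases "q \<in> C") blast+
    qed simp
    have sp: "s p = r\<^sup>2" by (simp add: s_def)
    show "\<mu> p = 1" using Uc r(1) by (simp add: \<mu>_def sp nz)
    have "continuous_on U s" unfolding s_def
      by (intro continuous_intros chart_component_continuous[OF Uc(1)])
    then show "open {q \<in> U. s q > 0}"
      using continuous_open_preimage[OF _ chart_domain_open[OF Uc(1)] open_greaterThan[of 0], of s]
      by (simp add: Int_def greaterThan_def)
    show "p \<in> {q \<in> U. s q > 0}" using Uc r(1) sp by simp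
    show "\<mu> q \<noteq> 0" if "q \<in> {q \<in> U. s q > 0}" for q using that r(1) by (simp add: \<mu>_def nz not_le)
  qed (use C CS zero in auto)
qed

end

section \<open>Vector bundles\<close>

definition smul :: "('m \<Rightarrow> real) \<Rightarrow> ('m \<Rightarrow> 'v::real_vector) \<Rightarrow> 'm \<Rightarrow> 'v" where
  "smul f x = (\<lambda>p. f p *\<^sub>R x p)"

definition dsmul :: "('m \<Rightarrow> real) \<Rightarrow> ('m \<Rightarrow> 'v \<Rightarrow> real) \<Rightarrow> 'm \<Rightarrow> 'v \<Rightarrow> real" where
  "dsmul f \<alpha> = (\<lambda>p v. f p * \<alpha> p v)"

lemma sum_fun_apply [simp]: "(\<Sum>i\<in>I. f i) x = (\<Sum>i\<in>I. f i x)"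
  by (induction I rule: infinite_finite_induct) auto

locale vbundle =
  fixes A :: "('m::{t2_space,second_countable_topology}, 'v::real_vector, 'z) vec_bundle_scheme"
  assumes vector_bundle: "vector_bundle A"
begin

abbreviation "sec \<equiv> sections A"
abbreviation "dsec \<equiv> dual_sections A"
abbreviation "dfib \<equiv> dual_fibre A"
abbreviation "smooth_on \<equiv> smooth_fun_on A"
abbreviation "rk \<equiv> vrank A"
abbreviation "homs \<equiv> hom_sections A"
abbreviation "smfuns \<equiv> smooth_funs A"
abbreviation "wedge \<equiv> wedge_tensor_sections A"

sublocale manifold A
  using vector_bundle by unfold_locales (simp add: vector_bundle_def)

lemma fibre_subspace: "subspace (fibre A p)"
  using vector_bundle by (simp add: vector_bundle_def)

lemma triv_cover: obtains U \<Phi> where "(U, \<Phi>) \<in> trivs A" "p \<in> U"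
proof -
  have "p \<in> (\<Union>(U, \<Phi>)\<in>trivs A. U)" using vector_bundle by (simp add: vector_bundle_def)
  then show ?thesis using that by blast
qed

lemma triv_facts:
  assumes "(U, \<Phi>) \<in> trivs A"
  shows triv_open: "open U"
    and triv_bij: "\<And>p. p \<in> U \<Longrightarrow> bij_betw (\<Phi> p) (fibre A p) (topspace (Euclidean_space (rk)))"
    and triv_linear: "\<And>p x y a b i. p \<in> U \<Longrightarrow> x \<in> fibre A p \<Longrightarrow> y \<in> fibre A p \<Longrightarrow>
        \<Phi> p (a *\<^sub>R x + b *\<^sub>R y) i = a * \<Phi> p x i + b * \<Phi> p y i"
proof -
  have "\<forall>(U,\<Phi>)\<in>trivs A. open U \<and>
        (\<forall>p\<in>U. bij_betw (\<Phi> p) (fibre A p) (topspace (Euclidean_space (rk))) \<and>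
           (\<forall>x\<in>fibre A p. \<forall>y\<in>fibre A p. \<forall>a b i.
              \<Phi> p (a *\<^sub>R x + b *\<^sub>R y) i = a * \<Phi> p x i + b * \<Phi> p y i))"
    using vector_bundle unfolding vector_bundle_def by (elim conjE)
  from bspec[OF this assms]
  show "open U"
    and "\<And>p. p \<in> U \<Longrightarrow> bij_betw (\<Phi> p) (fibre A p) (topspace (Euclidean_space (rk)))"
    and "\<And>p x y a b i. p \<in> U \<Longrightarrow> x \<in> fibre A p \<Longrightarrow> y \<in> fibre A p \<Longrightarrow>
        \<Phi> p (a *\<^sub>R x + b *\<^sub>R y) i = a * \<Phi> p x i + b * \<Phi> p y i" by auto
qed

lemma triv_transition:
  assumes "(U, \<Phi>) \<in> trivs A" "(V, \<Psi>) \<in> trivs A" "i < rk" "j < rk"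
  shows "smooth_on (U \<inter> V) (\<lambda>p. \<Psi> p (frame A \<Phi> j p) i)"
proof -
  have "\<forall>(U,\<Phi>)\<in>trivs A. \<forall>(V,\<Psi>)\<in>trivs A. \<forall>i<rk. \<forall>j<rk.
        smooth_on (U \<inter> V) (\<lambda>p. \<Psi> p (frame A \<Phi> j p) i)"
    using vector_bundle unfolding vector_bundle_def by (elim conjE)
  from bspec[OF this assms(1)] assms(2-) show ?thesis by auto
qed

section \<open>Linear algebra in a fibre\<close>

lemma fibre_zero [simp]: "0 \<in> fibre A p"
  and fibre_add: "x \<in> fibre A p \<Longrightarrow> y \<in> fibre A p \<Longrightarrow> x + y \<in> fibre A p"
  and fibre_scale: "x \<in> fibre A p \<Longrightarrow> a *\<^sub>R x \<in> fibre A p"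
  and fibre_sum: "(\<And>i. i \<in> I \<Longrightarrow> f i \<in> fibre A p) \<Longrightarrow> (\<Sum>i\<in>I. f i) \<in> fibre A p"
  using fibre_subspace[of p]
  by (auto intro: subspace_0 subspace_add subspace_scale subspace_sum)

context
  fixes U \<Phi> p
  assumes triv: "(U, \<Phi>) \<in> trivs A" and p: "p \<in> U"
begin

lemma triv_zero: "\<Phi> p 0 i = 0"
  using triv_linear[OF triv p, of 0 0 0 0] by simp

lemma triv_add: "x \<in> fibre A p \<Longrightarrow> y \<in> fibre A p \<Longrightarrow> \<Phi> p (x + y) i = \<Phi> p x i + \<Phi> p y i"
  using triv_linear[OF triv p, of x y 1 1] by simp

lemma triv_scale: "x \<in> fibre A p \<Longrightarrow> \<Phi> p (a *\<^sub>R x) i = a * \<Phi> p x i"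
  using triv_linear[OF triv p, of x x a 0] by simp

lemma triv_sum: "(\<And>j. j \<in> J \<Longrightarrow> x j \<in> fibre A p) \<Longrightarrow> \<Phi> p (\<Sum>j\<in>J. x j) i = (\<Sum>j\<in>J. \<Phi> p (x j) i)"
  by (induction J rule: infinite_finite_induct) (auto simp: triv_zero triv_add fibre_sum)

lemma frame_in_fibre: "j < rk \<Longrightarrow> frame A \<Phi> j p \<in> fibre A p"
  and triv_frame: "j < rk \<Longrightarrow> \<Phi> p (frame A \<Phi> j p) i = (if i = j then 1 else 0)"
proof -
  assume j: "j < rk"
  have "unit_vec j \<in> \<Phi> p ` fibre A p"
    using triv_bij[OF triv p] j by (auto simp: bij_betw_def topspace_Euclidean_space unit_vec_def)
  then show "frame A \<Phi> j p \<in> fibre A p" "\<Phi> p (frame A \<Phi> j p) i = (if i = j then 1 else 0)"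
    unfolding frame_def by (auto simp: inv_into_into f_inv_into_f unit_vec_def)
qed

lemma triv_eqI:
  assumes "x \<in> fibre A p" "y \<in> fibre A p" "\<And>i. i < rk \<Longrightarrow> \<Phi> p x i = \<Phi> p y i"
  shows "x = y"
proof -
  have "\<Phi> p x \<in> topspace (Euclidean_space (rk))" "\<Phi> p y \<in> topspace (Euclidean_space (rk))"
    using triv_bij[OF triv p] assms(1,2) by (auto simp: bij_betw_def)
  then have "\<Phi> p x i = \<Phi> p y i" for i
    using assms(3)[of i] by (cases "i < rk") (auto simp: topspace_Euclidean_space)
  then show ?thesis
    using triv_bij[OF triv p] assms(1,2) by (metis bij_betw_def inj_onD ext)
qed

lemma frame_expand:
  assumes "x \<in> fibre A p"
  shows "x = (\<Sum>j<rk. \<Phi> p x j *\<^sub>R frame A \<Phi> j p)"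
proof (rule triv_eqI)
  show "\<Phi> p x i = \<Phi> p (\<Sum>j<rk. \<Phi> p x j *\<^sub>R frame A \<Phi> j p) i" if "i < rk" for i
  proof -
    have "\<Phi> p (\<Sum>j<rk. \<Phi> p x j *\<^sub>R frame A \<Phi> j p) i = (\<Sum>j<rk. \<Phi> p (\<Phi> p x j *\<^sub>R frame A \<Phi> j p) i)"
      by (rule triv_sum) (auto intro: fibre_scale frame_in_fibre)
    also have "\<dots> = (\<Sum>j<rk. if j = i then \<Phi> p x j else 0)"
      by (rule sum.cong) (auto simp: triv_scale triv_frame frame_in_fibre)
    finally show ?thesis using that by simp
  qed
qed (use assms in \<open>auto intro!: fibre_sum fibre_scale frame_in_fibre\<close>)

end

section \<open>Linear algebra in a dual fibre\<close>

lemma dual_fibre_linear: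
  "\<xi> \<in> dfib p \<Longrightarrow> x \<in> fibre A p \<Longrightarrow> y \<in> fibre A p \<Longrightarrow> \<xi> (a *\<^sub>R x + b *\<^sub>R y) = a * \<xi> x + b * \<xi> y"
  by (simp add: dual_fibre_def)

lemma dual_fibre_outside: "\<xi> \<in> dfib p \<Longrightarrow> x \<notin> fibre A p \<Longrightarrow> \<xi> x = 0"
  by (simp add: dual_fibre_def)

lemma dual_fibre_at_zero: "\<xi> \<in> dfib p \<Longrightarrow> \<xi> 0 = 0"
  using dual_fibre_linear[of \<xi> p 0 0 0 0] by simp

lemma dual_fibre_at_add:
  "\<xi> \<in> dfib p \<Longrightarrow> x \<in> fibre A p \<Longrightarrow> y \<in> fibre A p \<Longrightarrow> \<xi> (x + y) = \<xi> x + \<xi> y"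
  using dual_fibre_linear[of \<xi> p x y 1 1] by simp

lemma dual_fibre_at_scale: "\<xi> \<in> dfib p \<Longrightarrow> x \<in> fibre A p \<Longrightarrow> \<xi> (a *\<^sub>R x) = a * \<xi> x"
  using dual_fibre_linear[of \<xi> p x x a 0] by simp

lemma dual_fibre_at_diff:
  "\<xi> \<in> dfib p \<Longrightarrow> x \<in> fibre A p \<Longrightarrow> y \<in> fibre A p \<Longrightarrow> \<xi> (x - y) = \<xi> x - \<xi> y"
  using dual_fibre_linear[of \<xi> p x y 1 "-1"] by simp

lemma dual_fibre_at_sum:
  "\<xi> \<in> dfib p \<Longrightarrow> (\<And>j. j \<in> J \<Longrightarrow> x j \<in> fibre A p) \<Longrightarrow> \<xi> (\<Sum>j\<in>J. x j) = (\<Sum>j\<in>J. \<xi> (x j))"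
  by (induction J rule: infinite_finite_induct) (auto simp: dual_fibre_at_zero dual_fibre_at_add fibre_sum)

lemma dual_fibre_combination:
  "\<xi> \<in> dfib p \<Longrightarrow> \<eta> \<in> dfib p \<Longrightarrow> (\<lambda>x. a * \<xi> x + b * \<eta> x) \<in> dfib p"
  by (simp add: dual_fibre_def algebra_simps)

lemma dual_fibre_zero [simp]: "(\<lambda>x. 0) \<in> dfib p" "0 \<in> dfib p"
  by (auto simp: dual_fibre_def)

lemma dual_fibre_add: "\<xi> \<in> dfib p \<Longrightarrow> \<eta> \<in> dfib p \<Longrightarrow> \<xi> + \<eta> \<in> dfib p"
  using dual_fibre_combination[of \<xi> p \<eta> 1 1] by (simp add: plus_fun_def)

lemma dual_fibre_scale: "\<xi> \<in> dfib p \<Longrightarrow> (\<lambda>x. a * \<xi> x) \<in> dfib p"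
  using dual_fibre_combination[of \<xi> p \<xi> a 0] by simp

lemma dual_fibre_sum: "(\<And>j. j \<in> J \<Longrightarrow> \<xi> j \<in> dfib p) \<Longrightarrow> (\<Sum>j\<in>J. \<xi> j) \<in> dfib p"
  by (induction J rule: infinite_finite_induct) (auto intro: dual_fibre_add)

lemma coframe_in_dual_fibre:
  assumes "(U, \<Phi>) \<in> trivs A" "p \<in> U"
  shows "coframe A \<Phi> j p \<in> dfib p"
  using triv_linear[OF assms] fibre_add fibre_scale by (simp add: dual_fibre_def coframe_def)

lemma dual_fibre_apply:
  assumes "(U, \<Phi>) \<in> trivs A" "p \<in> U" "\<xi> \<in> dfib p" "x \<in> fibre A p"
  shows "\<xi> x = (\<Sum>j<rk. \<Phi> p x j * \<xi> (frame A \<Phi> j p))"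
proof -
  have "\<xi> x = \<xi> (\<Sum>j<rk. \<Phi> p x j *\<^sub>R frame A \<Phi> j p)" using frame_expand[OF assms(1,2,4)] by simp
  also have "\<dots> = (\<Sum>j<rk. \<Phi> p x j * \<xi> (frame A \<Phi> j p))"
    using frame_in_fibre[OF assms(1,2)] assms(3)
    by (subst dual_fibre_at_sum) (auto intro: fibre_scale simp: dual_fibre_at_scale)
  finally show ?thesis .
qed

lemma coframe_expand:
  assumes "(U, \<Phi>) \<in> trivs A" "p \<in> U" "\<xi> \<in> dfib p"
  shows "\<xi> = (\<Sum>j<rk. (\<lambda>x. \<xi> (frame A \<Phi> j p) * coframe A \<Phi> j p x))"
proof
  fix x
  show "\<xi> x = (\<Sum>j<rk. (\<lambda>x. \<xi> (frame A \<Phi> j p) * coframe A \<Phi> j p x)) x"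
    using dual_fibre_apply[OF assms, of x] dual_fibre_outside[OF assms(3)]
    by (cases "x \<in> fibre A p") (auto simp: coframe_def mult.commute)
qed

section \<open>Sections and dual sections as modules over the smooth functions\<close>

lemma section_fibre: "x \<in> sec \<Longrightarrow> x p \<in> fibre A p"
  by (simp add: sections_def)

lemma dual_section_fibre: "\<alpha> \<in> dsec \<Longrightarrow> \<alpha> p \<in> dfib p"
  by (simp add: dual_sections_def)

lemma section_smooth:
  "x \<in> sec \<Longrightarrow> (U, \<Phi>) \<in> trivs A \<Longrightarrow> i < rk \<Longrightarrow> smooth_on U (\<lambda>p. \<Phi> p (x p) i)"
  by (auto simp: sections_def)

lemma dual_section_smooth:
  "\<alpha> \<in> dsec \<Longrightarrow> (U, \<Phi>) \<in> trivs A \<Longrightarrow> i < rk \<Longrightarrow>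
    smooth_on U (\<lambda>p. \<alpha> p (frame A \<Phi> i p))"
  by (auto simp: dual_sections_def)

lemma smooth_funs_restrict: "f \<in> smfuns \<Longrightarrow> open S \<Longrightarrow> smooth_on S f"
  using smooth_fun_on_subset[of UNIV S f] by simp

lemma section_zero: "0 \<in> sec"
  unfolding sections_def
proof (clarsimp)
  fix U \<Phi> i assume t: "(U, \<Phi>) \<in> trivs A"
  show "smooth_on U (\<lambda>p. \<Phi> p 0 i)"
    using triv_zero[OF t] by (subst smooth_fun_on_cong[OF triv_open[OF t], of _ "\<lambda>p. 0"])
      (auto intro: smooth_fun_on_const triv_open[OF t])
qed

lemma section_add:
  assumes "x \<in> sec" "y \<in> sec"
  shows "x + y \<in> sec"
  unfolding sections_def
proof (clarsimp simp: section_fibre[OF assms(1)] section_fibre[OF assms(2)] fibre_add)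
  fix U \<Phi> i assume t: "(U, \<Phi>) \<in> trivs A" and i: "i < rk"
  have "smooth_on U (\<lambda>p. \<Phi> p (x p) i + \<Phi> p (y p) i)"
    using assms t i by (intro smooth_fun_on_add triv_open[OF t] section_smooth)
  then show "smooth_on U (\<lambda>p. \<Phi> p (x p + y p) i)"
    using triv_add[OF t] section_fibre assms by (subst smooth_fun_on_cong[OF triv_open[OF t]]) auto
qed

lemma section_smul:
  assumes "f \<in> smfuns" "x \<in> sec"
  shows "smul f x \<in> sec"
  unfolding sections_def
proof (clarsimp simp: smul_def section_fibre[OF assms(2)] fibre_scale)
  fix U \<Phi> i assume t: "(U, \<Phi>) \<in> trivs A" and i: "i < rk"
  have "smooth_on U (\<lambda>p. f p * \<Phi> p (x p) i)"
    by (rule smooth_fun_on_mult[OF triv_open[OF t] smooth_funs_restrict[OF assms(1) triv_open[OF t]] section_smooth[OF assms(2) t i]])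
  then show "smooth_on U (\<lambda>p. \<Phi> p (f p *\<^sub>R x p) i)"
    using triv_scale[OF t] section_fibre assms by (subst smooth_fun_on_cong[OF triv_open[OF t]]) auto
qed

lemma section_minus: "x \<in> sec \<Longrightarrow> - x \<in> sec"
  using section_smul[of "\<lambda>p. -1" x] by (simp add: smul_def fun_Compl_def smooth_fun_on_const)

lemma section_diff: "x \<in> sec \<Longrightarrow> y \<in> sec \<Longrightarrow> x - y \<in> sec"
  using section_add[OF _ section_minus, of x y] by simp

lemma section_sum: "(\<And>i. i \<in> I \<Longrightarrow> x i \<in> sec) \<Longrightarrow> (\<Sum>i\<in>I. x i) \<in> sec"
  by (induction I rule: infinite_finite_induct) (auto intro: section_zero section_add)

lemma dual_section_zero: "0 \<in> dsec"
  by (auto simp: dual_sections_def intro: smooth_fun_on_const dest: triv_open)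

lemma dual_section_add:
  "\<alpha> \<in> dsec \<Longrightarrow> \<beta> \<in> dsec \<Longrightarrow> \<alpha> + \<beta> \<in> dsec"
  unfolding dual_sections_def
  by (clarsimp simp: dual_fibre_add) (rule smooth_fun_on_add, auto dest: triv_open)

lemma dual_section_smul:
  assumes "f \<in> smfuns" "\<alpha> \<in> dsec"
  shows "dsmul f \<alpha> \<in> dsec"
  unfolding dual_sections_def
proof (clarsimp simp: dsmul_def dual_section_fibre[OF assms(2)] dual_fibre_scale)
  fix U \<Phi> i assume t: "(U, \<Phi>) \<in> trivs A" and i: "i < rk"
  show "smooth_on U (\<lambda>p. f p * \<alpha> p (frame A \<Phi> i p))"
    by (rule smooth_fun_on_mult[OF triv_open[OF t] smooth_funs_restrict[OF assms(1) triv_open[OF t]] dual_section_smooth[OF assms(2) t i]])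
qed

lemma dual_section_minus: "\<alpha> \<in> dsec \<Longrightarrow> - \<alpha> \<in> dsec"
  using dual_section_smul[of "\<lambda>p. -1" \<alpha>] by (simp add: dsmul_def fun_Compl_def smooth_fun_on_const)

lemma dual_section_diff:
  "\<alpha> \<in> dsec \<Longrightarrow> \<beta> \<in> dsec \<Longrightarrow> \<alpha> - \<beta> \<in> dsec"
  using dual_section_add[OF _ dual_section_minus, of \<alpha> \<beta>] by simp

lemma dual_section_sum:
  "(\<And>i. i \<in> I \<Longrightarrow> \<alpha> i \<in> dsec) \<Longrightarrow> (\<Sum>i\<in>I. \<alpha> i) \<in> dsec"
  by (induction I rule: infinite_finite_induct) (auto intro: dual_section_zero dual_section_add)

lemma pairing_smooth:
  assumes "\<alpha> \<in> dsec" "x \<in> sec"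
  shows "pairing \<alpha> x \<in> smfuns"
proof -
  have "\<exists>T. open T \<and> p \<in> T \<and> smooth_on T (pairing \<alpha> x)" for p
  proof -
    obtain U \<Phi> where t: "(U, \<Phi>) \<in> trivs A" "p \<in> U" using triv_cover by blast
    have "smooth_on U (\<lambda>q. \<Sum>j<rk. \<Phi> q (x q) j * \<alpha> q (frame A \<Phi> j q))"
      using assms t triv_open
      by (intro smooth_fun_on_sum smooth_fun_on_mult section_smooth dual_section_smooth) auto
    then have "smooth_on U (pairing \<alpha> x)"
      using dual_fibre_apply[OF t(1)] dual_section_fibre[OF assms(1)] section_fibre[OF assms(2)] triv_open[OF t(1)]
      by (subst smooth_fun_on_cong) (auto simp: pairing_def)
    then show ?thesis using t triv_open by blast
  qed
  then show ?thesis using smooth_fun_on_local[of UNIV "pairing \<alpha> x"] by auto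
qed

end

section \<open>Localisation\<close>

context vbundle
begin

lemma smooth_funs_power: "f \<in> smfuns \<Longrightarrow> (\<lambda>q. f q ^ k) \<in> smfuns"
  by (simp add: smooth_fun_on_power)

text \<open>A frame over \<open>U\<close> and its dual, multiplied by a bump function \<open>\<mu>\<close>, extend by zero to global
  sections.  As \<open>\<mu>\<^sup>2\<close> times a section is a combination of these with smooth coefficients, they
  replace partitions of unity in localisation arguments.\<close>

lemma local_frame:
  assumes t: "(U, \<Phi>) \<in> trivs A" and p: "p \<in> U"
  obtains \<mu> T E F where
    "\<mu> \<in> smfuns" "\<mu> p = 1" "open T" "p \<in> T" "T \<subseteq> U" "\<And>q. q \<in> T \<Longrightarrow> \<mu> q \<noteq> 0"
    "\<And>j. j < rk \<Longrightarrow> E j \<in> sec" "\<And>j. j < rk \<Longrightarrow> F j \<in> dsec"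
    "\<And>j q. q \<in> U \<Longrightarrow> E j q = \<mu> q *\<^sub>R frame A \<Phi> j q"
    "\<And>j q. q \<in> U \<Longrightarrow> F j q = (\<lambda>v. \<mu> q * coframe A \<Phi> j q v)"
    "\<And>x. x \<in> sec \<Longrightarrow> smul (\<lambda>q. \<mu> q ^ 2) x = (\<Sum>j<rk. smul (pairing (F j) x) (E j))"
    "\<And>\<alpha>. \<alpha> \<in> dsec \<Longrightarrow> dsmul (\<lambda>q. \<mu> q ^ 2) \<alpha> = (\<Sum>j<rk. dsmul (pairing \<alpha> (E j)) (F j))"
proof -
  obtain \<mu> T C where b: "smooth_on UNIV \<mu>" "\<mu> p = 1" "open T" "p \<in> T"
    "\<And>q. q \<in> T \<Longrightarrow> \<mu> q \<noteq> 0" "closed C" "C \<subseteq> U" "\<And>q. q \<notin> C \<Longrightarrow> \<mu> q = 0"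
    using bump_function[OF triv_open[OF t] p] by metis
  have TU: "T \<subseteq> U" using b(5,7,8) by blast
  have \<mu>U: "\<mu> q = 0" if "q \<notin> U" for q using b(7,8) that by blast
  define E where "E j q = (if q \<in> U then \<mu> q *\<^sub>R frame A \<Phi> j q else 0)" for j q
  define F where "F j q = (if q \<in> U then \<lambda>v. \<mu> q * coframe A \<Phi> j q v else 0)" for j q
  \<comment> \<open>Smoothness of an extension by zero, tested on any open V: near C the function is
    \<mu> times a smooth function on the intersection with U, and off the closed set C it is
    zero.\<close>
  have glue: "smooth_on V f"
    if "open V" "smooth_on (U \<inter> V) g" "\<And>q. q \<in> U \<inter> V \<Longrightarrow> f q = \<mu> q * g q" "\<And>q. q \<in> V - C \<Longrightarrow> f q = 0"
    for V and f g :: "'m \<Rightarrow> real"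
  proof (rule smooth_fun_on_local[OF that(1)])
    fix q assume q: "q \<in> V"
    show "\<exists>T. open T \<and> q \<in> T \<and> smooth_on T f"
    proof (cases "q \<in> C")
      case True
      have o: "open (U \<inter> V)" using triv_open[OF t] that(1) by auto
      have "smooth_on (U \<inter> V) (\<lambda>q. \<mu> q * g q)"
        using smooth_funs_restrict[of \<mu>, OF _ o] b(1) that(2) o by (intro smooth_fun_on_mult) auto
      then have "smooth_on (U \<inter> V) f" 
        using smooth_fun_on_cong[OF o, of f "\<lambda>q. \<mu> q * g q"] that(3) by simp
      then show ?thesis using True b(7) q o by (intro exI[of _ "U \<inter> V"]) auto
    next
      case False
      have o: "open (V - C)" using that(1) b(6) by auto
      have "smooth_on (V - C) f"
        using smooth_fun_on_cong[OF o, of f "\<lambda>q. 0"] that(4) smooth_fun_on_const[OF o] by simp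
      then show ?thesis using False q o by blast
    qed
  qed
  have E: "E j \<in> sec" if j: "j < rk" for j
    unfolding sections_def
  proof (clarsimp, intro conjI allI ballI impI)
    show "E j q \<in> fibre A q" for q
      using frame_in_fibre[OF t _ j] fibre_scale by (auto simp: E_def)
  next
    fix x assume x: "x \<in> trivs A"
    obtain V \<Psi> where V: "x = (V, \<Psi>)" by (cases x)
    have t': "(V, \<Psi>) \<in> trivs A" using x V by simp
    have "smooth_on V (\<lambda>p. \<Psi> p (E j p) i)" if i: "i < rk" for i
    proof (rule glue[OF triv_open[OF t'] triv_transition[OF t t' i j]])
      show "\<Psi> q (E j q) i = \<mu> q * \<Psi> q (frame A \<Phi> j q) i" if "q \<in> U \<inter> V" for q
        using that triv_scale[OF t'] frame_in_fibre[OF t _ j] by (simp add: E_def)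
      show "\<Psi> q (E j q) i = 0" if "q \<in> V - C" for q
        using that triv_zero[OF t'] b(8) by (simp add: E_def)
    qed
    then show "case x of (V, \<Psi>) \<Rightarrow> \<forall>i<rk. smooth_on V (\<lambda>p. \<Psi> p (E j p) i)" using V by simp
  qed
  have F: "F j \<in> dsec" if j: "j < rk" for j
    unfolding dual_sections_def
  proof (clarsimp, intro conjI allI ballI impI)
    show "F j q \<in> dfib q" for q
      using coframe_in_dual_fibre[OF t] dual_fibre_scale by (auto simp: F_def)
  next
    fix x assume x: "x \<in> trivs A"
    obtain V \<Psi> where V: "x = (V, \<Psi>)" by (cases x)
    have t': "(V, \<Psi>) \<in> trivs A" using x V by simp
    have "smooth_on V (\<lambda>p. F j p (frame A \<Psi> i p))" if i: "i < rk" for i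
    proof (rule glue[OF triv_open[OF t']])
      show "smooth_on (U \<inter> V) (\<lambda>q. \<Phi> q (frame A \<Psi> i q) j)"
        using triv_transition[OF t' t j i] by (simp add: Int_commute)
      show "F j q (frame A \<Psi> i q) = \<mu> q * \<Phi> q (frame A \<Psi> i q) j" if "q \<in> U \<inter> V" for q
        using that frame_in_fibre[OF t' _ i] by (simp add: F_def coframe_def)
      show "F j q (frame A \<Psi> i q) = 0" if "q \<in> V - C" for q
        using that b(8) by (simp add: F_def)
    qed
    then show "case x of (V, \<Psi>) \<Rightarrow> \<forall>i<rk. smooth_on V (\<lambda>p. F j p (frame A \<Psi> i p))" using V by simp
  qed
  show ?thesis
  proof (rule that[of \<mu> T E F])
    fix x assume x: "x \<in> sec"
    show "smul (\<lambda>q. \<mu> q ^ 2) x = (\<Sum>j<rk. smul (pairing (F j) x) (E j))"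
    proof
      fix q
      show "smul (\<lambda>q. \<mu> q ^ 2) x q = (\<Sum>j<rk. smul (pairing (F j) x) (E j)) q"
      proof (cases "q \<in> U")
        case True
        have "smul (\<lambda>q. \<mu> q ^ 2) x q = \<mu> q ^ 2 *\<^sub>R (\<Sum>j<rk. \<Phi> q (x q) j *\<^sub>R frame A \<Phi> j q)"
          using frame_expand[OF t True section_fibre[OF x]] by (simp add: smul_def)
        then show ?thesis using True section_fibre[OF x]
          by (simp add: smul_def pairing_def E_def F_def coframe_def scaleR_sum_right power2_eq_square mult_ac)
      qed (simp add: smul_def E_def \<mu>U)
    qed
  next
    fix \<alpha> assume a: "\<alpha> \<in> dsec"
    show "dsmul (\<lambda>q. \<mu> q ^ 2) \<alpha> = (\<Sum>j<rk. dsmul (pairing \<alpha> (E j)) (F j))"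
    proof
      fix q
      show "dsmul (\<lambda>q. \<mu> q ^ 2) \<alpha> q = (\<Sum>j<rk. dsmul (pairing \<alpha> (E j)) (F j)) q"
      proof (cases "q \<in> U")
        case True
        have "\<alpha> q v = (\<Sum>j<rk. \<alpha> q (frame A \<Phi> j q) * coframe A \<Phi> j q v)" for v
          by (rule trans[OF fun_cong[OF coframe_expand[OF t True dual_section_fibre[OF a]]] sum_fun_apply])
        moreover have "\<alpha> q (\<mu> q *\<^sub>R frame A \<Phi> j q) = \<mu> q * \<alpha> q (frame A \<Phi> j q)" if "j < rk" for j
          by (rule dual_fibre_at_scale[OF dual_section_fibre[OF a] frame_in_fibre[OF t True that]])
        then have "(\<Sum>j<rk. \<alpha> q (\<mu> q *\<^sub>R frame A \<Phi> j q) * (\<mu> q * coframe A \<Phi> j q v)) =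
            \<mu> q ^ 2 * (\<Sum>j<rk. \<alpha> q (frame A \<Phi> j q) * coframe A \<Phi> j q v)" for v
          by (simp add: sum_distrib_left power2_eq_square mult_ac)
        ultimately have "\<mu> q ^ 2 * \<alpha> q v = (\<Sum>j<rk. \<alpha> q (\<mu> q *\<^sub>R frame A \<Phi> j q) * (\<mu> q * coframe A \<Phi> j q v))" for v
          by metis
        then show ?thesis using True
          by (simp only: fun_eq_iff dsmul_def pairing_def E_def F_def if_True sum_fun_apply) simp
      qed (simp add: dsmul_def F_def \<mu>U fun_eq_iff)
    qed
  qed (use b TU E F in \<open>auto simp: E_def F_def\<close>)
qed

text \<open>Constant coefficients in the cut-off frame suffice, because the bump function is 1 at p.
  This lets equalities of tensors be tested on global sections.\<close>

lemma section_extension: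
  assumes "v \<in> fibre A p"
  obtains x where "x \<in> sec" "x p = v"
proof -
  obtain U \<Phi> where t: "(U, \<Phi>) \<in> trivs A" "p \<in> U" using triv_cover by blast
  obtain \<mu> T E F where f: "\<mu> p = 1" "\<And>j. j < rk \<Longrightarrow> E j \<in> sec"
    "\<And>j q. q \<in> U \<Longrightarrow> E j q = \<mu> q *\<^sub>R frame A \<Phi> j q"
    by (rule local_frame[OF t]) blast
  show ?thesis
  proof (rule that[of "\<Sum>j<rk. smul (\<lambda>q. \<Phi> p v j) (E j)"])
    show "(\<Sum>j<rk. smul (\<lambda>q. \<Phi> p v j) (E j)) \<in> sec"
      using f(2) by (auto intro!: section_sum section_smul smooth_fun_on_const)
    show "(\<Sum>j<rk. smul (\<lambda>q. \<Phi> p v j) (E j)) p = v"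
      using frame_expand[OF t assms] f(1) f(3)[OF t(2)] by (simp add: smul_def)
  qed
qed

lemma dual_section_extension:
  assumes "\<xi> \<in> dfib p"
  obtains \<alpha> where "\<alpha> \<in> dsec" "\<alpha> p = \<xi>"
proof -
  obtain U \<Phi> where t: "(U, \<Phi>) \<in> trivs A" "p \<in> U" using triv_cover by blast
  obtain \<mu> T E F where f: "\<mu> p = 1" "\<And>j. j < rk \<Longrightarrow> F j \<in> dsec"
    "\<And>j q. q \<in> U \<Longrightarrow> F j q = (\<lambda>v. \<mu> q * coframe A \<Phi> j q v)"
    by (rule local_frame[OF t]) blast
  show ?thesis
  proof (rule that[of "\<Sum>j<rk. dsmul (\<lambda>q. \<xi> (frame A \<Phi> j p)) (F j)"])
    show "(\<Sum>j<rk. dsmul (\<lambda>q. \<xi> (frame A \<Phi> j p)) (F j)) \<in> dsec"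
      using f(2) by (auto intro!: dual_section_sum dual_section_smul smooth_fun_on_const)
    show "(\<Sum>j<rk. dsmul (\<lambda>q. \<xi> (frame A \<Phi> j p)) (F j)) p = \<xi>"
      using coframe_expand[OF t assms] f(1) f(3)[OF t(2)] by (simp add: dsmul_def)
  qed
qed

section \<open>Separation by pairings\<close>

lemma dual_fibre_separates:
  assumes "v \<in> fibre A p" "w \<in> fibre A p" "\<And>\<eta>. \<eta> \<in> dfib p \<Longrightarrow> \<eta> v = \<eta> w"
  shows "v = w"
proof -
  obtain U \<Phi> where t: "(U, \<Phi>) \<in> trivs A" "p \<in> U" using triv_cover by blast
  show ?thesis
    by (rule triv_eqI[OF t assms(1,2)])
      (use assms(1,2) assms(3)[OF coframe_in_dual_fibre[OF t]] in \<open>simp add: coframe_def\<close>)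
qed

lemma section_eqI:
  assumes "x \<in> sec" "y \<in> sec" "\<And>\<alpha>. \<alpha> \<in> dsec \<Longrightarrow> pairing \<alpha> x = pairing \<alpha> y"
  shows "x = y"
proof
  fix p
  show "x p = y p"
  proof (rule dual_fibre_separates[OF section_fibre[OF assms(1)] section_fibre[OF assms(2)]])
    fix \<eta> assume "\<eta> \<in> dfib p"
    then obtain \<alpha> where "\<alpha> \<in> dsec" "\<alpha> p = \<eta>" using dual_section_extension by blast
    then show "\<eta> (x p) = \<eta> (y p)" using fun_cong[OF assms(3)[of \<alpha>], of p] by (simp add: pairing_def)
  qed
qed

lemma dual_section_eqI:
  assumes "\<alpha> \<in> dsec" "\<beta> \<in> dsec" "\<And>x. x \<in> sec \<Longrightarrow> pairing \<alpha> x = pairing \<beta> x"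
  shows "\<alpha> = \<beta>"
proof (intro ext)
  fix p v
  show "\<alpha> p v = \<beta> p v"
  proof (cases "v \<in> fibre A p")
    case True
    then obtain x where "x \<in> sec" "x p = v" using section_extension by blast
    then show ?thesis using fun_cong[OF assms(3)[of x], of p] by (simp add: pairing_def)
  next
    case False
    then show ?thesis using dual_fibre_outside dual_section_fibre assms(1,2) by metis
  qed
qed

text \<open>Since \<mu> is 1 at p, D x = D (\<mu>^2 x), and \<mu>^2 x is the combination of the
  \<open>E j\<close> with coefficients the pairings of x with \<open>F j\<close>. Thus D x is a
  combination of the D (\<open>E j\<close>) whose coefficients see only x p.\<close>

lemma tensorial_sections:
  assumes "x \<in> sec" "y \<in> sec" "x p = y p"
    and add: "\<And>x y. x \<in> sec \<Longrightarrow> y \<in> sec \<Longrightarrow> D (x + y) = D x + (D y :: 'w::real_vector)"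
    and smul: "\<And>f x. f \<in> smfuns \<Longrightarrow> x \<in> sec \<Longrightarrow> D (smul f x) = f p *\<^sub>R D x"
  shows "D x = D y"
proof -
  obtain U \<Phi> where t: "(U, \<Phi>) \<in> trivs A" "p \<in> U" using triv_cover by blast
  obtain \<mu> T E F where f: "\<mu> \<in> smfuns" "\<mu> p = 1"
    "\<And>j. j < rk \<Longrightarrow> E j \<in> sec" "\<And>j. j < rk \<Longrightarrow> F j \<in> dsec"
    "\<And>x. x \<in> sec \<Longrightarrow> smul (\<lambda>q. \<mu> q ^ 2) x = (\<Sum>j<rk. smul (pairing (F j) x) (E j))"
    by (rule local_frame[OF t]) blast
  have zero: "D 0 = 0" using add[OF section_zero section_zero] by simp
  have sum: "D (\<Sum>j\<in>J. z j) = (\<Sum>j\<in>J. D (z j))" if "\<And>j. j \<in> J \<Longrightarrow> z j \<in> sec" for z and J :: "nat set"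
    using that by (induction J rule: infinite_finite_induct) (auto simp: zero add section_sum)
  have "D z = (\<Sum>j<rk. F j p (z p) *\<^sub>R D (E j))" if z: "z \<in> sec" for z
  proof -
    have "D z = D (smul (\<lambda>q. \<mu> q ^ 2) z)"
      using smul[OF smooth_funs_power[OF f(1)] z, of 2] f(2) by simp
    also have "\<dots> = (\<Sum>j<rk. D (smul (pairing (F j) z) (E j)))"
      unfolding f(5)[OF z] by (rule sum) (use f z pairing_smooth in \<open>auto intro!: section_smul\<close>)
    also have "\<dots> = (\<Sum>j<rk. F j p (z p) *\<^sub>R D (E j))"
      by (rule sum.cong) (use f z smul pairing_smooth in \<open>auto simp: pairing_def\<close>)
    finally show ?thesis .
  qed
  then show ?thesis using assms(1-3) by simp
qed

lemma tensorial_dual_sections: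
  assumes "\<alpha> \<in> dsec" "\<beta> \<in> dsec" "\<alpha> p = \<beta> p"
    and add: "\<And>\<alpha> \<beta>. \<alpha> \<in> dsec \<Longrightarrow> \<beta> \<in> dsec \<Longrightarrow> D (\<alpha> + \<beta>) = D \<alpha> + (D \<beta> :: 'w::real_vector)"
    and smul: "\<And>f \<alpha>. f \<in> smfuns \<Longrightarrow> \<alpha> \<in> dsec \<Longrightarrow> D (dsmul f \<alpha>) = f p *\<^sub>R D \<alpha>"
  shows "D \<alpha> = D \<beta>"
proof -
  obtain U \<Phi> where t: "(U, \<Phi>) \<in> trivs A" "p \<in> U" using triv_cover by blast
  obtain \<mu> T E F where f: "\<mu> \<in> smfuns" "\<mu> p = 1"
    "\<And>j. j < rk \<Longrightarrow> E j \<in> sec" "\<And>j. j < rk \<Longrightarrow> F j \<in> dsec"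
    "\<And>\<alpha>. \<alpha> \<in> dsec \<Longrightarrow> dsmul (\<lambda>q. \<mu> q ^ 2) \<alpha> = (\<Sum>j<rk. dsmul (pairing \<alpha> (E j)) (F j))"
    by (rule local_frame[OF t]) blast
  have zero: "D 0 = 0" using add[OF dual_section_zero dual_section_zero] by simp
  have sum: "D (\<Sum>j\<in>J. z j) = (\<Sum>j\<in>J. D (z j))" if "\<And>j. j \<in> J \<Longrightarrow> z j \<in> dsec" for z and J :: "nat set"
    using that by (induction J rule: infinite_finite_induct) (auto simp: zero add dual_section_sum)
  have "D z = (\<Sum>j<rk. z p (E j p) *\<^sub>R D (F j))" if z: "z \<in> dsec" for z
  proof -
    have "D z = D (dsmul (\<lambda>q. \<mu> q ^ 2) z)"
      using smul[OF smooth_funs_power[OF f(1)] z, of 2] f(2) by simp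
    also have "\<dots> = (\<Sum>j<rk. D (dsmul (pairing z (E j)) (F j)))"
      unfolding f(5)[OF z] by (rule sum) (use f z pairing_smooth in \<open>auto intro!: dual_section_smul\<close>)
    also have "\<dots> = (\<Sum>j<rk. z p (E j p) *\<^sub>R D (F j))"
      by (rule sum.cong) (use f z smul pairing_smooth in \<open>auto simp: pairing_def\<close>)
    finally show ?thesis .
  qed
  then show ?thesis using assms(1-3) by simp
qed

text \<open>Recovers smoothness of a frame coefficient g from a global function h in which cut-off
  frames and coframes were inserted; k counts them, each contributing one factor \<mu>.\<close>

lemma smooth_fun_on_divide:
  assumes "open T" "\<mu> \<in> smfuns" "\<And>q. q \<in> T \<Longrightarrow> \<mu> q \<noteq> 0"
    and "h \<in> smfuns" "\<And>q. q \<in> T \<Longrightarrow> h q = \<mu> q ^ k * g q"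
  shows "smooth_on T g"
proof -
  have "smooth_on T (\<lambda>q. inverse (\<mu> q ^ k) * h q)"
    using assms(3) smooth_funs_restrict[OF assms(2,1)] smooth_funs_restrict[OF assms(4,1)]
    by (intro smooth_fun_on_mult[OF assms(1)] smooth_fun_on_inverse[OF assms(1)] smooth_fun_on_power[OF assms(1)]) auto
  then show ?thesis
    using assms(3,5) by (subst smooth_fun_on_cong[OF assms(1), of _ "\<lambda>q. inverse (\<mu> q ^ k) * h q"]) auto
qed

text \<open>Converse of \<open>pairing_smooth\<close>: the coefficients in a frame are obtained from
  pairings with the cut-off frame.\<close>

lemma dual_sectionI:
  assumes "\<And>p. \<alpha> p \<in> dfib p" "\<And>x. x \<in> sec \<Longrightarrow> pairing \<alpha> x \<in> smfuns"
  shows "\<alpha> \<in> dsec"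
proof -
  have "smooth_on U (\<lambda>p. \<alpha> p (frame A \<Phi> i p))" if t: "(U, \<Phi>) \<in> trivs A" and i: "i < rk" for U \<Phi> i
  proof (rule smooth_fun_on_local[OF triv_open[OF t]])
    fix p assume p: "p \<in> U"
    obtain \<mu> T E F where f: "\<mu> \<in> smfuns" "\<mu> p = 1" "open T" "p \<in> T" "T \<subseteq> U" "\<And>q. q \<in> T \<Longrightarrow> \<mu> q \<noteq> 0"
      "\<And>j. j < rk \<Longrightarrow> E j \<in> sec"
      "\<And>j q. q \<in> U \<Longrightarrow> E j q = \<mu> q *\<^sub>R frame A \<Phi> j q"
      by (rule local_frame[OF t p]) blast
    have "smooth_on T (\<lambda>p. \<alpha> p (frame A \<Phi> i p))"
    proof (rule smooth_fun_on_divide[OF f(3,1,6)])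
      show "pairing \<alpha> (E i) \<in> smfuns" using assms(2) f(7) i by blast
      show "pairing \<alpha> (E i) q = \<mu> q ^ 1 * \<alpha> q (frame A \<Phi> i q)" if "q \<in> T" for q
        using that f(5) f(8)[of q i] dual_fibre_at_scale[OF assms(1) frame_in_fibre[OF t _ i]]
        by (auto simp: pairing_def)
    qed
    then show "\<exists>T. open T \<and> p \<in> T \<and> smooth_on T (\<lambda>p. \<alpha> p (frame A \<Phi> i p))" using f by blast
  qed
  then show ?thesis using assms(1) by (auto simp: dual_sections_def)
qed

text \<open>Supplies the dual section that the definite description in \<open>Lop\<close> asks for.
  The value at a fibre vector is computed on an arbitrary global extension, and
  \<open>tensorial_sections\<close> makes the choice irrelevant.\<close>

lemma dual_section_of_functional:
  assumes smooth: "\<And>x. x \<in> sec \<Longrightarrow> D x \<in> smfuns"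
    and add: "\<And>x y. x \<in> sec \<Longrightarrow> y \<in> sec \<Longrightarrow> D (x + y) = D x + D y"
    and smul: "\<And>f x. f \<in> smfuns \<Longrightarrow> x \<in> sec \<Longrightarrow> D (smul f x) = f * D x"
  shows "\<exists>\<eta>\<in>dsec. \<forall>x\<in>sec. pairing \<eta> x = D x"
proof -
  define ex where "ex p v = (SOME x. x \<in> sec \<and> x p = v)" for p v
  have ex: "ex p v \<in> sec" "ex p v p = v" if "v \<in> fibre A p" for p v
    using someI_ex[of "\<lambda>x. x \<in> sec \<and> x p = v"] section_extension[OF that] unfolding ex_def by blast+
  define \<eta> where "\<eta> p v = (if v \<in> fibre A p then D (ex p v) p else 0)" for p v
  have D_eq: "D x p = D y p" if "x \<in> sec" "y \<in> sec" "x p = y p" for x y p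
    by (rule tensorial_sections[OF that, of "\<lambda>x. D x p"]) (simp_all add: add smul)
  have \<eta>: "\<eta> p (x p) = D x p" if "x \<in> sec" for x p
    using D_eq[OF ex(1)[OF section_fibre[OF that]] that ex(2)[OF section_fibre[OF that]]] section_fibre[OF that]
    by (simp add: \<eta>_def)
  have pair: "pairing \<eta> x = D x" if "x \<in> sec" for x
    using \<eta>[OF that] by (simp add: pairing_def)
  have "\<eta> \<in> dsec"
  proof (rule dual_sectionI)
    fix p
    have "\<eta> p (a *\<^sub>R x + b *\<^sub>R y) = a * \<eta> p x + b * \<eta> p y" if xy: "x \<in> fibre A p" "y \<in> fibre A p" for x y a b
    proof -
      have c: "(\<lambda>q. c) \<in> smfuns" for c by (simp add: smooth_fun_on_const)
      have s: "smul (\<lambda>q. a) (ex p x) \<in> sec" "smul (\<lambda>q. b) (ex p y) \<in> sec"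
        using section_smul[OF c] ex(1) xy by blast+
      have "\<eta> p ((smul (\<lambda>q. a) (ex p x) + smul (\<lambda>q. b) (ex p y)) p)
          = D (smul (\<lambda>q. a) (ex p x) + smul (\<lambda>q. b) (ex p y)) p"
        by (rule \<eta>) (intro section_add s)
      also have "\<dots> = a * \<eta> p x + b * \<eta> p y"
        using xy by (simp add: add[OF s] smul[OF c ex(1)] \<eta>_def)
      finally show ?thesis using xy by (simp add: smul_def ex(2))
    qed
    then show "\<eta> p \<in> dfib p" by (simp add: dual_fibre_def) (simp add: \<eta>_def)
  qed (simp add: pair smooth[simplified])
  then show ?thesis using pair by blast
qed

end

section \<open>Tensor fields and homomorphism fields\<close>

context vbundle
begin

lemma multilinear_zero_outside:
  "multilinear D k F \<Longrightarrow> \<not> (length cs = k \<and> set cs \<subseteq> D) \<Longrightarrow> F cs = 0"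
  unfolding multilinear_def by blast

lemma multilinear_update:
  "multilinear D k F \<Longrightarrow> length cs = k \<Longrightarrow> set cs \<subseteq> D \<Longrightarrow> \<xi> \<in> D \<Longrightarrow> \<eta> \<in> D \<Longrightarrow> i < k \<Longrightarrow>
    F (cs[i := (\<lambda>x. a * \<xi> x + b * \<eta> x)]) = a *\<^sub>R F (cs[i := \<xi>]) + b *\<^sub>R F (cs[i := \<eta>])"
  unfolding multilinear_def by blast

text \<open>Reflexivity of the finite-dimensional fibres: the solution has the values of l on the
  coframe as its frame coefficients. It makes the definite descriptions in \<open>Psi\<close> and
  \<open>sharp\<close> denote.\<close>

lemma double_dual:
  assumes lin: "\<And>\<xi> \<eta> a b. \<xi> \<in> dfib p \<Longrightarrow> \<eta> \<in> dfib p \<Longrightarrow>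
      l (\<lambda>x. a * \<xi> x + b * \<eta> x) = a * l \<xi> + b * (l \<eta> :: real)"
  shows "\<exists>!x. x \<in> fibre A p \<and> (\<forall>\<eta>\<in>dfib p. \<eta> x = l \<eta>)"
proof -
  obtain U \<Phi> where t: "(U, \<Phi>) \<in> trivs A" "p \<in> U" using triv_cover by blast
  let ?x = "\<Sum>j<rk. l (coframe A \<Phi> j p) *\<^sub>R frame A \<Phi> j p"
  have zero: "l (\<lambda>x. 0) = 0" using lin[of "\<lambda>x. 0" "\<lambda>x. 0" 0 0] by simp
  have scale: "l (\<lambda>x. a * \<xi> x) = a * l \<xi>" if "\<xi> \<in> dfib p" for a \<xi>
    using lin[OF that that, of a 0] by simp
  have add: "l (\<xi> + \<eta>) = l \<xi> + l \<eta>" if "\<xi> \<in> dfib p" "\<eta> \<in> dfib p" for \<xi> \<eta>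
    using lin[OF that, of 1 1] by (simp add: plus_fun_def)
  have sum: "l (\<Sum>j\<in>J. \<xi> j) = (\<Sum>j\<in>J. l (\<xi> j))" if "\<And>j. j \<in> J \<Longrightarrow> \<xi> j \<in> dfib p" for \<xi> and J :: "nat set"
    using that by (induction J rule: infinite_finite_induct)
      (auto simp: zero[folded zero_fun_def] add dual_fibre_sum)
  have "\<eta> ?x = l \<eta>" if \<eta>: "\<eta> \<in> dfib p" for \<eta>
  proof -
    have "l \<eta> = l (\<Sum>j<rk. (\<lambda>x. \<eta> (frame A \<Phi> j p) * coframe A \<Phi> j p x))"
      using coframe_expand[OF t \<eta>] by simp
    also have "\<dots> = (\<Sum>j<rk. \<eta> (frame A \<Phi> j p) * l (coframe A \<Phi> j p))"
      using coframe_in_dual_fibre[OF t] by (subst sum) (auto intro: dual_fibre_scale simp: scale)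
    also have "\<dots> = \<eta> ?x"
      using frame_in_fibre[OF t] \<eta>
      by (subst dual_fibre_at_sum[OF \<eta>]) (auto intro: fibre_scale simp: dual_fibre_at_scale mult.commute)
    finally show ?thesis ..
  qed
  moreover have "?x \<in> fibre A p" using frame_in_fibre[OF t] by (auto intro!: fibre_sum fibre_scale)
  ultimately show ?thesis using dual_fibre_separates[of _ p] by (intro ex1I[of _ ?x]) auto
qed

section \<open>The bijection between tensor fields and homomorphism fields\<close>

lemma wedge_multilinear: "\<phi> \<in> wedge k \<Longrightarrow> multilinear (dfib p) (k + 1) (\<phi> p)"
  and wedge_alternating: "\<phi> \<in> wedge k \<Longrightarrow> alternating_in_first k (\<phi> p)"
  and wedge_smooth: "\<phi> \<in> wedge k \<Longrightarrow> (U, \<Phi>) \<in> trivs A \<Longrightarrow> length js = k + 1 \<Longrightarrow>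
    set js \<subseteq> {..<rk} \<Longrightarrow> smooth_on U (\<lambda>p. \<phi> p (map (\<lambda>j. coframe A \<Phi> j p) js))"
  unfolding wedge_tensor_sections_def by auto

lemma hom_multilinear: "P \<in> homs k \<Longrightarrow> multilinear (dfib p) k (P p)"
  and hom_alternating: "P \<in> homs k \<Longrightarrow> alternating_in_first k (P p)"
  and hom_fibre: "P \<in> homs k \<Longrightarrow> P p cs \<in> fibre A p"
  and hom_smooth: "P \<in> homs k \<Longrightarrow> (U, \<Phi>) \<in> trivs A \<Longrightarrow> length js = k \<Longrightarrow>
    set js \<subseteq> {..<rk} \<Longrightarrow> i < rk \<Longrightarrow>
    smooth_on U (\<lambda>p. \<Phi> p (P p (map (\<lambda>j. coframe A \<Phi> j p) js)) i)"
  unfolding hom_sections_def by auto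

lemma Psi_facts:
  assumes "\<phi> \<in> wedge k" "length cs = k" "set cs \<subseteq> dfib p"
  shows Psi_in_fibre: "Psi A k \<phi> p cs \<in> fibre A p"
    and Psi_apply: "\<eta> \<in> dfib p \<Longrightarrow> \<eta> (Psi A k \<phi> p cs) = \<phi> p (cs @ [\<eta>])"
proof -
  let ?P = "\<lambda>x. x \<in> fibre A p \<and> (\<forall>\<eta>\<in>dfib p. \<eta> x = \<phi> p (cs @ [\<eta>]))"
  have "\<exists>!x. ?P x"
  proof (rule double_dual)
    fix \<xi> \<eta> a b assume d: "\<xi> \<in> dfib p" "\<eta> \<in> dfib p"
    have "\<phi> p ((cs @ [\<xi>])[k := (\<lambda>x. a * \<xi> x + b * \<eta> x)]) =
        a *\<^sub>R \<phi> p ((cs @ [\<xi>])[k := \<xi>]) + b *\<^sub>R \<phi> p ((cs @ [\<xi>])[k := \<eta>])"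
      by (rule multilinear_update[OF wedge_multilinear[OF assms(1)]]) (use assms d in auto)
    then show "\<phi> p (cs @ [\<lambda>x. a * \<xi> x + b * \<eta> x]) = a * \<phi> p (cs @ [\<xi>]) + b * \<phi> p (cs @ [\<eta>])"
      using assms(2)[symmetric] by simp
  qed
  then have the: "?P (THE x. ?P x)" by (rule theI')
  have eq: "Psi A k \<phi> p cs = (THE x. ?P x)" unfolding Psi_def using assms(2,3) by (intro if_P conjI)
  have "?P (Psi A k \<phi> p cs)" unfolding eq by (rule the)
  then show "Psi A k \<phi> p cs \<in> fibre A p"
    and "\<eta> \<in> dfib p \<Longrightarrow> \<eta> (Psi A k \<phi> p cs) = \<phi> p (cs @ [\<eta>])" by auto
qed

lemma Psi_outside: "\<not> (length cs = k \<and> set cs \<subseteq> dfib p) \<Longrightarrow> Psi A k \<phi> p cs = 0"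
  by (auto simp: Psi_def)

lemma Psi_hom_section:
  assumes \<phi>: "\<phi> \<in> wedge k"
  shows "Psi A k \<phi> \<in> homs k"
proof -
  let ?D = "dfib"
  have fib: "Psi A k \<phi> p cs \<in> fibre A p" for p cs
    using Psi_in_fibre[OF \<phi>, of cs p] Psi_outside[of cs k p \<phi>] by (metis fibre_zero)
  have "multilinear (?D p) k (Psi A k \<phi> p)" for p
    unfolding multilinear_def
  proof (intro conjI allI impI)
    fix cs \<xi> \<eta> a b i assume h: "length cs = k \<and> set cs \<subseteq> ?D p \<and> \<xi> \<in> ?D p \<and> \<eta> \<in> ?D p \<and> i < k"
    have upd: "set (cs[i := \<zeta>]) \<subseteq> ?D p" if "\<zeta> \<in> ?D p" for \<zeta>
      using h that by (meson insert_subset order_trans set_update_subset_insert)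
    have c: "(\<lambda>x. a * \<xi> x + b * \<eta> x) \<in> ?D p" using h by (intro dual_fibre_combination) auto
    show "Psi A k \<phi> p (cs[i := \<lambda>x. a * \<xi> x + b * \<eta> x]) =
        a *\<^sub>R Psi A k \<phi> p (cs[i := \<xi>]) + b *\<^sub>R Psi A k \<phi> p (cs[i := \<eta>])"
    proof (rule dual_fibre_separates[OF fib fibre_add[OF fibre_scale[OF fib] fibre_scale[OF fib]]])
      fix \<zeta> assume z: "\<zeta> \<in> ?D p"
      have "\<phi> p ((cs @ [\<zeta>])[i := (\<lambda>x. a * \<xi> x + b * \<eta> x)]) =
          a *\<^sub>R \<phi> p ((cs @ [\<zeta>])[i := \<xi>]) + b *\<^sub>R \<phi> p ((cs @ [\<zeta>])[i := \<eta>])"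
        by (rule multilinear_update[OF wedge_multilinear[OF \<phi>]]) (use h z in auto)
      then show "\<zeta> (Psi A k \<phi> p (cs[i := \<lambda>x. a * \<xi> x + b * \<eta> x])) =
          \<zeta> (a *\<^sub>R Psi A k \<phi> p (cs[i := \<xi>]) + b *\<^sub>R Psi A k \<phi> p (cs[i := \<eta>]))"
        using h z upd c by (simp add: Psi_apply[OF \<phi>] dual_fibre_linear[where p = p] fib list_update_append1)
    qed
  qed (auto simp: Psi_outside)
  moreover have "alternating_in_first k (Psi A k \<phi> p)" for p
    unfolding alternating_in_first_def
  proof (intro allI impI)
    fix cs :: "('v \<Rightarrow> real) list" and i j assume h: "i < j \<and> j < k \<and> k \<le> length cs \<and> cs ! i = cs ! j"
    show "Psi A k \<phi> p cs = 0"
    proof (cases "length cs = k \<and> set cs \<subseteq> ?D p")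
      case True
      show ?thesis
      proof (rule dual_fibre_separates[OF fib fibre_zero])
        fix \<zeta> assume z: "\<zeta> \<in> ?D p"
        have "\<phi> p (cs @ [\<zeta>]) = 0"
        proof -
          have "i < j \<and> j < k \<and> k \<le> length (cs @ [\<zeta>]) \<and> (cs @ [\<zeta>]) ! i = (cs @ [\<zeta>]) ! j"
            using h by (auto simp: nth_append)
          then show ?thesis
            using wedge_alternating[OF \<phi>, of p] unfolding alternating_in_first_def by blast
        qed
        then show "\<zeta> (Psi A k \<phi> p cs) = \<zeta> 0" using True z by (simp add: Psi_apply[OF \<phi>] dual_fibre_at_zero)
      qed
    qed (rule Psi_outside)
  qed
  moreover have "smooth_on U (\<lambda>p. \<Phi> p (Psi A k \<phi> p (map (\<lambda>j. coframe A \<Phi> j p) js)) i)"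
    if t: "(U, \<Phi>) \<in> trivs A" and i: "i < rk" and js: "length js = k" "set js \<subseteq> {..<rk}" for U \<Phi> js i
  proof -
    have "smooth_on U (\<lambda>p. \<phi> p (map (\<lambda>j. coframe A \<Phi> j p) (js @ [i])))"
      by (rule wedge_smooth[OF \<phi> t]) (use i js in auto)
    moreover have "\<Phi> p (Psi A k \<phi> p (map (\<lambda>j. coframe A \<Phi> j p) js)) i = \<phi> p (map (\<lambda>j. coframe A \<Phi> j p) (js @ [i]))"
      if "p \<in> U" for p
    proof -
      have "set (map (\<lambda>j. coframe A \<Phi> j p) js) \<subseteq> ?D p" using coframe_in_dual_fibre[OF t that] by auto
      then have "coframe A \<Phi> i p (Psi A k \<phi> p (map (\<lambda>j. coframe A \<Phi> j p) js)) = \<phi> p (map (\<lambda>j. coframe A \<Phi> j p) (js @ [i]))"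
        using Psi_apply[OF \<phi>, of "map (\<lambda>j. coframe A \<Phi> j p) js" p "coframe A \<Phi> i p"]
          coframe_in_dual_fibre[OF t that] js(1) by simp
      moreover have "coframe A \<Phi> i p v = \<Phi> p v i" if "v \<in> fibre A p" for v using that by (simp add: coframe_def)
      ultimately show ?thesis using fib by simp
    qed
    ultimately show ?thesis by (rule smooth_fun_on_eqI[OF triv_open[OF t]])
  qed
  ultimately show ?thesis using fib unfolding hom_sections_def by blast
qed

text \<open>Together with \<open>Psi_surj\<close> this makes \<open>the_inv_into\<close> in
  \<open>KV_bracket\<close> a genuine inverse. Lists outside the domain cause no ambiguity because
  tensors are zero there.\<close>

lemma Psi_inj: "inj_on (Psi A k) (wedge k)"
proof (rule inj_onI, intro ext)
  fix \<phi> \<psi> p and ds :: "('v \<Rightarrow> real) list"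
  assume \<phi>: "\<phi> \<in> wedge k" and \<psi>: "\<psi> \<in> wedge k"
    and eq: "Psi A k \<phi> = Psi A k \<psi>"
  show "\<phi> p ds = \<psi> p ds"
  proof (cases "length ds = k + 1 \<and> set ds \<subseteq> dfib p")
    case True
    then obtain cs \<eta> where "ds = cs @ [\<eta>]" by (metis Suc_eq_plus1 length_Suc_conv_rev)
    with True show ?thesis
      using Psi_apply[OF \<phi>, of cs p \<eta>] Psi_apply[OF \<psi>, of cs p \<eta>] eq by simp
  next
    case False
    then show ?thesis
      using multilinear_zero_outside[OF wedge_multilinear[OF \<phi>]] multilinear_zero_outside[OF wedge_multilinear[OF \<psi>]]
      by simp
  qed
qed

lemma Psi_surj:
  assumes R: "R \<in> homs k"
  shows "\<exists>\<phi>\<in>wedge k. Psi A k \<phi> = R"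
proof -
  let ?D = "dfib"
  define \<phi> where "\<phi> p ds = (if length ds = k + 1 \<and> set ds \<subseteq> ?D p then last ds (R p (butlast ds)) else 0)"
    for p and ds :: "('v \<Rightarrow> real) list"
  have \<phi>_snoc: "\<phi> p (cs @ [\<eta>]) = \<eta> (R p cs)" if "length cs = k" "set cs \<subseteq> ?D p" "\<eta> \<in> ?D p" for p cs \<eta>
    using that by (simp add: \<phi>_def)
  have ml: "multilinear (?D p) (k + 1) (\<phi> p)" for p
    unfolding multilinear_def
  proof (intro conjI allI impI)
    fix ds \<xi> \<eta> a b i assume h: "length ds = k + 1 \<and> set ds \<subseteq> ?D p \<and> \<xi> \<in> ?D p \<and> \<eta> \<in> ?D p \<and> i < k + 1"
    then obtain cs \<theta> where z: "ds = cs @ [\<theta>]" by (metis Suc_eq_plus1 length_Suc_conv_rev)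
    have upd: "set (cs[i := \<zeta>]) \<subseteq> ?D p" if "\<zeta> \<in> ?D p" for \<zeta>
      using h z that by (metis insert_subset le_sup_iff order_trans set_append set_update_subset_insert)
    have c: "(\<lambda>x. a * \<xi> x + b * \<eta> x) \<in> ?D p" using h by (intro dual_fibre_combination) auto
    show "\<phi> p (ds[i := \<lambda>x. a * \<xi> x + b * \<eta> x]) = a *\<^sub>R \<phi> p (ds[i := \<xi>]) + b *\<^sub>R \<phi> p (ds[i := \<eta>])"
    proof (cases "i < k")
      case True
      have "R p (cs[i := \<lambda>x. a * \<xi> x + b * \<eta> x]) = a *\<^sub>R R p (cs[i := \<xi>]) + b *\<^sub>R R p (cs[i := \<eta>])"
        by (rule multilinear_update[OF hom_multilinear[OF R]]) (use h z True in auto)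
      then show ?thesis using h z True upd c
        by (simp add: list_update_append1 \<phi>_snoc dual_fibre_linear[where p = p] hom_fibre[OF R])
    next
      case False
      then have "ds[i := \<zeta>] = cs @ [\<zeta>]" for \<zeta> using h z by (simp add: list_update_append)
      then show ?thesis using h z c by (simp add: \<phi>_snoc)
    qed
  next
    fix ds :: "('v \<Rightarrow> real) list" assume "\<not> (length ds = k + 1 \<and> set ds \<subseteq> ?D p)"
    then show "\<phi> p ds = 0" by (auto simp: \<phi>_def)
  qed
  have "alternating_in_first k (\<phi> p)" for p
    unfolding alternating_in_first_def
  proof (intro allI impI)
    fix ds :: "('v \<Rightarrow> real) list" and i j assume h: "i < j \<and> j < k \<and> k \<le> length ds \<and> ds ! i = ds ! j"
    show "\<phi> p ds = 0"
    proof (cases "length ds = k + 1 \<and> set ds \<subseteq> ?D p")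
      case True
      then obtain cs \<theta> where z: "ds = cs @ [\<theta>]" by (metis Suc_eq_plus1 length_Suc_conv_rev)
      then have "length cs = k" "cs ! i = cs ! j" using True h by (auto simp: nth_append)
      then have "R p cs = 0"
        using hom_alternating[OF R, of p] h unfolding alternating_in_first_def by blast
      then show ?thesis using True z \<open>length cs = k\<close> by (simp add: \<phi>_snoc dual_fibre_at_zero[where p = p])
    qed (auto simp: \<phi>_def)
  qed
  moreover have "smooth_on U (\<lambda>p. \<phi> p (map (\<lambda>j. coframe A \<Phi> j p) js))"
    if t: "(U, \<Phi>) \<in> trivs A" and js: "length js = k + 1" "set js \<subseteq> {..<rk}" for U \<Phi> js
  proof -
    obtain ls i where l: "js = ls @ [i]" using js(1) by (metis Suc_eq_plus1 length_Suc_conv_rev)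
    have "smooth_on U (\<lambda>p. \<Phi> p (R p (map (\<lambda>j. coframe A \<Phi> j p) ls)) i)"
      by (rule hom_smooth[OF R t]) (use js l in auto)
    moreover have "\<phi> p (map (\<lambda>j. coframe A \<Phi> j p) js) = \<Phi> p (R p (map (\<lambda>j. coframe A \<Phi> j p) ls)) i"
      if "p \<in> U" for p
    proof -
      have "\<phi> p (map (\<lambda>j. coframe A \<Phi> j p) js) = coframe A \<Phi> i p (R p (map (\<lambda>j. coframe A \<Phi> j p) ls))"
        using \<phi>_snoc[of "map (\<lambda>j. coframe A \<Phi> j p) ls" p "coframe A \<Phi> i p"] coframe_in_dual_fibre[OF t that] js l
        by (auto simp: image_subset_iff)
      then show ?thesis using hom_fibre[OF R] by (simp add: coframe_def[of _ _ i])
    qed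
    ultimately show ?thesis by (rule smooth_fun_on_eqI[OF triv_open[OF t]])
  qed
  ultimately have \<phi>: "\<phi> \<in> wedge k"
    using ml unfolding wedge_tensor_sections_def by blast
  have "Psi A k \<phi> = R"
  proof (intro ext)
    fix p cs
    show "Psi A k \<phi> p cs = R p cs"
    proof (cases "length cs = k \<and> set cs \<subseteq> ?D p")
      case True
      show ?thesis
        by (rule dual_fibre_separates[OF hom_fibre[OF Psi_hom_section[OF \<phi>]] hom_fibre[OF R]])
          (use True in \<open>simp add: Psi_apply[OF \<phi>] \<phi>_snoc\<close>)
    next
      case False
      then show ?thesis using multilinear_zero_outside[OF hom_multilinear[OF R]] by (simp add: Psi_outside)
    qed
  qed
  then show ?thesis using \<phi> by blast
qed

text \<open>The uniqueness half of the definite description in \<open>hom_bracket\<close>: each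
  covector in a list is the value of a global dual section.\<close>

lemma hom_section_eqI:
  assumes R: "R \<in> homs k" and S: "S \<in> homs k"
    and eq: "\<And>\<alpha>s. length \<alpha>s = k \<Longrightarrow> set \<alpha>s \<subseteq> dsec \<Longrightarrow> field_apply R \<alpha>s = field_apply S \<alpha>s"
  shows "R = S"
proof (intro ext)
  fix p cs
  show "R p cs = S p cs"
  proof (cases "length cs = k \<and> set cs \<subseteq> dfib p")
    case True
    have "\<exists>\<alpha>. \<alpha> \<in> dsec \<and> \<alpha> p = \<xi>" if "\<xi> \<in> set cs" for \<xi>
      using dual_section_extension[of \<xi> p] True that by blast
    then obtain e where e: "\<And>\<xi>. \<xi> \<in> set cs \<Longrightarrow> e \<xi> \<in> dsec \<and> e \<xi> p = \<xi>" by metis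
    have "map (\<lambda>\<alpha>. \<alpha> p) (map e cs) = cs" using e by (simp add: map_idI)
    moreover have "set (map e cs) \<subseteq> dsec" using e by auto
    then have "field_apply R (map e cs) p = field_apply S (map e cs) p"
      using eq[of "map e cs"] True by simp
    ultimately show ?thesis by (simp add: field_apply_def)
  next
    case False
    then show ?thesis
      using multilinear_zero_outside[OF hom_multilinear[OF R]] multilinear_zero_outside[OF hom_multilinear[OF S]]
      by simp
  qed
qed

lemma wedge_eqI:
  assumes "\<phi> \<in> wedge k" "\<psi> \<in> wedge k"
    and eq: "\<And>\<alpha>s. length \<alpha>s = k + 1 \<Longrightarrow> set \<alpha>s \<subseteq> dsec \<Longrightarrow> field_apply \<phi> \<alpha>s = field_apply \<psi> \<alpha>s"
  shows "\<phi> = \<psi>"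
proof (intro ext)
  fix p cs
  show "\<phi> p cs = \<psi> p cs"
  proof (cases "length cs = k + 1 \<and> set cs \<subseteq> dfib p")
    case True
    have "\<exists>\<alpha>. \<alpha> \<in> dsec \<and> \<alpha> p = \<xi>" if "\<xi> \<in> set cs" for \<xi>
      using dual_section_extension[of \<xi> p] True that by blast
    then obtain e where e: "\<And>\<xi>. \<xi> \<in> set cs \<Longrightarrow> e \<xi> \<in> dsec \<and> e \<xi> p = \<xi>" by metis
    have "map (\<lambda>\<alpha>. \<alpha> p) (map e cs) = cs" using e by (simp add: map_idI)
    moreover have "set (map e cs) \<subseteq> dsec" using e by auto
    then have "field_apply \<phi> (map e cs) p = field_apply \<psi> (map e cs) p"
      using eq[of "map e cs"] True by simp
    ultimately show ?thesis by (simp add: field_apply_def)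
  next
    case False
    then show ?thesis
      using multilinear_zero_outside[OF wedge_multilinear[OF assms(1)]]
        multilinear_zero_outside[OF wedge_multilinear[OF assms(2)]]
      by simp
  qed
qed

section \<open>Homomorphism fields as operators on sections\<close>

lemma hom_apply_section:
  assumes P: "P \<in> homs 1" and \<alpha>: "\<alpha> \<in> dsec"
  shows "field_apply P [\<alpha>] \<in> sec"
proof -
  have add: "P p [\<xi> + \<eta>] = P p [\<xi>] + P p [\<eta>]" if "\<xi> \<in> dfib p" "\<eta> \<in> dfib p" for p \<xi> \<eta>
    using multilinear_update[OF hom_multilinear[OF P], of "[\<xi>]" p \<xi> \<eta> 0 1 1] that by (simp add: plus_fun_def)
  have scale: "P p [\<lambda>x. a * \<xi> x] = a *\<^sub>R P p [\<xi>]" if "\<xi> \<in> dfib p" for p \<xi> a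
    using multilinear_update[OF hom_multilinear[OF P], of "[\<xi>]" p \<xi> \<xi> 0 a 0] that by simp
  have zero: "P p [0] = 0" for p using add[of 0 p 0] by simp
  have sum: "P p [\<Sum>j\<in>J. \<xi> j] = (\<Sum>j\<in>J. P p [\<xi> j])" if "\<And>j. j \<in> J \<Longrightarrow> \<xi> j \<in> dfib p" for p \<xi> and J :: "nat set"
    using that by (induction J rule: infinite_finite_induct) (auto simp: zero add dual_fibre_sum)
  have "smooth_on U (\<lambda>p. \<Phi> p (P p [\<alpha> p]) i)" if t: "(U, \<Phi>) \<in> trivs A" and i: "i < rk" for U \<Phi> i
  proof -
    have "smooth_on U (\<lambda>p. \<Sum>j<rk. \<alpha> p (frame A \<Phi> j p) * \<Phi> p (P p [coframe A \<Phi> j p]) i)"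
      using hom_smooth[OF P t, of "[_]" i] i
      by (intro smooth_fun_on_sum smooth_fun_on_mult triv_open[OF t] dual_section_smooth[OF \<alpha> t]) auto
    moreover have "\<Phi> p (P p [\<alpha> p]) i = (\<Sum>j<rk. \<alpha> p (frame A \<Phi> j p) * \<Phi> p (P p [coframe A \<Phi> j p]) i)"
      if p: "p \<in> U" for p
    proof -
      have "P p [\<alpha> p] = P p [\<Sum>j<rk. (\<lambda>x. \<alpha> p (frame A \<Phi> j p) * coframe A \<Phi> j p x)]"
        using coframe_expand[OF t p dual_section_fibre[OF \<alpha>]] by simp
      also have "\<dots> = (\<Sum>j<rk. \<alpha> p (frame A \<Phi> j p) *\<^sub>R P p [coframe A \<Phi> j p])"
        using coframe_in_dual_fibre[OF t p] by (subst sum) (auto intro: dual_fibre_scale simp: scale)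
      finally show ?thesis
        using hom_fibre[OF P] by (simp add: triv_sum[OF t p] fibre_scale triv_scale[OF t p])
    qed
    ultimately show ?thesis by (rule smooth_fun_on_eqI[OF triv_open[OF t]])
  qed
  then show ?thesis using hom_fibre[OF P] by (auto simp: sections_def field_apply_def)
qed

lemma hom_apply_add:
  assumes "P \<in> homs 1" "\<alpha> \<in> dsec" "\<beta> \<in> dsec"
  shows "field_apply P [\<alpha> + \<beta>] = field_apply P [\<alpha>] + field_apply P [\<beta>]"
proof
  fix p
  show "field_apply P [\<alpha> + \<beta>] p = (field_apply P [\<alpha>] + field_apply P [\<beta>]) p"
    using multilinear_update[OF hom_multilinear[OF assms(1)], of "[\<alpha> p]" p "\<alpha> p" "\<beta> p" 0 1 1]
      dual_section_fibre[OF assms(2)] dual_section_fibre[OF assms(3)]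
    by (simp add: field_apply_def plus_fun_def)
qed

lemma hom_apply_smul:
  assumes "P \<in> homs 1" "\<alpha> \<in> dsec"
  shows "field_apply P [dsmul f \<alpha>] = smul f (field_apply P [\<alpha>])"
proof
  fix p
  show "field_apply P [dsmul f \<alpha>] p = smul f (field_apply P [\<alpha>]) p"
    using multilinear_update[OF hom_multilinear[OF assms(1)], of "[\<alpha> p]" p "\<alpha> p" "\<alpha> p" 0 "f p" 0]
      dual_section_fibre[OF assms(2)]
    by (simp add: field_apply_def smul_def dsmul_def)
qed

text \<open>The existence half for brackets of arity two: a skew map that is C-infinity-linear in
  its first argument is induced by a field. Skewness transfers linearity and locality to the second
  argument.\<close>

lemma hom_section_of_map2:
  assumes closed: "\<And>\<alpha> \<beta>. \<alpha> \<in> dsec \<Longrightarrow> \<beta> \<in> dsec \<Longrightarrow> E \<alpha> \<beta> \<in> sec"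
    and add: "\<And>\<alpha> \<beta> \<gamma>. \<alpha> \<in> dsec \<Longrightarrow> \<beta> \<in> dsec \<Longrightarrow> \<gamma> \<in> dsec \<Longrightarrow>
      E (\<alpha> + \<beta>) \<gamma> = E \<alpha> \<gamma> + E \<beta> \<gamma>"
    and smul: "\<And>f \<alpha> \<beta>. f \<in> smfuns \<Longrightarrow> \<alpha> \<in> dsec \<Longrightarrow> \<beta> \<in> dsec \<Longrightarrow>
      E (dsmul f \<alpha>) \<beta> = smul f (E \<alpha> \<beta>)"
    and skew: "\<And>\<alpha> \<beta>. \<alpha> \<in> dsec \<Longrightarrow> \<beta> \<in> dsec \<Longrightarrow> E \<beta> \<alpha> = - E \<alpha> \<beta>"
  shows "\<exists>R\<in>homs 2. \<forall>\<alpha>\<in>dsec. \<forall>\<beta>\<in>dsec. field_apply R [\<alpha>, \<beta>] = E \<alpha> \<beta>"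
proof -
  let ?D = "dfib"
  define ex where "ex p \<xi> = (SOME \<alpha>. \<alpha> \<in> dsec \<and> \<alpha> p = \<xi>)" for p \<xi>
  have ex: "ex p \<xi> \<in> dsec" "ex p \<xi> p = \<xi>" if "\<xi> \<in> ?D p" for p \<xi>
    using someI_ex[of "\<lambda>\<alpha>. \<alpha> \<in> dsec \<and> \<alpha> p = \<xi>"] dual_section_extension[OF that]
    unfolding ex_def by blast+
  have loc1: "E \<alpha> \<gamma> p = E \<beta> \<gamma> p"
    if "\<alpha> \<in> dsec" "\<beta> \<in> dsec" "\<alpha> p = \<beta> p" "\<gamma> \<in> dsec" for \<alpha> \<beta> \<gamma> p
    by (rule tensorial_dual_sections[OF that(1-3), of "\<lambda>\<alpha>. E \<alpha> \<gamma> p"])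
      (use that(4) in \<open>auto simp: add smul smul_def\<close>)
  have loc: "E \<alpha> \<beta> p = E \<alpha>' \<beta>' p"
    if "\<alpha> \<in> dsec" "\<alpha>' \<in> dsec" "\<alpha> p = \<alpha>' p"
      "\<beta> \<in> dsec" "\<beta>' \<in> dsec" "\<beta> p = \<beta>' p" for \<alpha> \<beta> \<alpha>' \<beta>' p
  proof -
    \<comment> \<open>The first argument is changed directly; for the second one the arguments are
      swapped, changed and swapped back.\<close>
    have "E \<alpha> \<beta> p = E \<alpha>' \<beta> p" using that by (intro loc1)
    also have "\<dots> = - E \<beta> \<alpha>' p" using that skew by (metis fun_Compl_def)
    also have "\<dots> = - E \<beta>' \<alpha>' p" using that loc1 by metis
    also have "\<dots> = E \<alpha>' \<beta>' p" using that skew by (metis fun_Compl_def)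
    finally show ?thesis .
  qed
  define B where "B p \<xi> \<eta> = E (ex p \<xi>) (ex p \<eta>) p" for p \<xi> \<eta>
  define R where "R p cs = (if length cs = 2 \<and> set cs \<subseteq> ?D p then B p (cs ! 0) (cs ! 1) else 0)" for p cs
  have B: "B p (\<alpha> p) (\<beta> p) = E \<alpha> \<beta> p" if "\<alpha> \<in> dsec" "\<beta> \<in> dsec" for p \<alpha> \<beta>
    unfolding B_def using that ex dual_section_fibre by (intro loc) auto
  have B_skew: "B p \<eta> \<xi> = - B p \<xi> \<eta>" if "\<xi> \<in> ?D p" "\<eta> \<in> ?D p" for p \<xi> \<eta>
    unfolding B_def using skew[OF ex(1)[OF that(1)] ex(1)[OF that(2)]] by (simp add: fun_Compl_def)
  have B_lin: "B p (\<lambda>x. a * \<xi> x + b * \<eta> x) \<zeta> = a *\<^sub>R B p \<xi> \<zeta> + b *\<^sub>R B p \<eta> \<zeta>"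
    if d: "\<xi> \<in> ?D p" "\<eta> \<in> ?D p" "\<zeta> \<in> ?D p" for p \<xi> \<eta> \<zeta> a b
  proof -
    have c: "(\<lambda>q. c) \<in> smfuns" for c by (simp add: smooth_fun_on_const)
    let ?a = "dsmul (\<lambda>q. a) (ex p \<xi>)" and ?b = "dsmul (\<lambda>q. b) (ex p \<eta>)"
    have s: "?a \<in> dsec" "?b \<in> dsec"
      using dual_section_smul[OF c] ex(1) d by blast+
    have "B p ((?a + ?b) p) (ex p \<zeta> p) = E (?a + ?b) (ex p \<zeta>) p"
      by (intro B dual_section_add s ex(1) d)
    also have "\<dots> = a *\<^sub>R B p \<xi> \<zeta> + b *\<^sub>R B p \<eta> \<zeta>"
      using d by (simp add: add[OF s] smul[OF c] ex(1) B_def) (simp add: smul_def)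
    finally show ?thesis using d by (simp add: ex(2) dsmul_def plus_fun_def)
  qed
  have B_lin2: "B p \<zeta> (\<lambda>x. a * \<xi> x + b * \<eta> x) = a *\<^sub>R B p \<zeta> \<xi> + b *\<^sub>R B p \<zeta> \<eta>"
    if d: "\<xi> \<in> ?D p" "\<eta> \<in> ?D p" "\<zeta> \<in> ?D p" for p \<xi> \<eta> \<zeta> a b
    using B_lin[OF d] B_skew[OF d(3) dual_fibre_combination[OF d(1,2)]] B_skew[OF d(3,1)] B_skew[OF d(3,2)]
    by (metis (no_types, lifting) add_uminus_conv_diff minus_add_distrib minus_minus scaleR_minus_right)
  have fib: "R p cs \<in> fibre A p" for p cs
    using section_fibre[OF closed] ex(1) by (auto simp: R_def B_def subset_iff)
  have app: "field_apply R [\<alpha>, \<beta>] = E \<alpha> \<beta>" if "\<alpha> \<in> dsec" "\<beta> \<in> dsec" for \<alpha> \<beta>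
    using B[OF that] dual_section_fibre[OF that(1)] dual_section_fibre[OF that(2)]
    by (auto simp: field_apply_def R_def fun_eq_iff)
  have "multilinear (?D p) 2 (R p)" for p
    unfolding multilinear_def
  proof (intro conjI allI impI)
    fix cs \<xi> \<eta> a b and i :: nat assume h: "length cs = 2 \<and> set cs \<subseteq> ?D p \<and> \<xi> \<in> ?D p \<and> \<eta> \<in> ?D p \<and> i < 2"
    then obtain \<alpha> \<beta> where l: "cs = [\<alpha>, \<beta>]" by (auto simp: length_Suc_conv numeral_2_eq_2)
    have "i = 0 \<or> i = 1" using h by auto
    then show "R p (cs[i := \<lambda>x. a * \<xi> x + b * \<eta> x]) = a *\<^sub>R R p (cs[i := \<xi>]) + b *\<^sub>R R p (cs[i := \<eta>])"
      using h l dual_fibre_combination[of \<xi> p \<eta> a b] by (auto simp: R_def B_lin B_lin2)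
  next
    fix ds :: "('v \<Rightarrow> real) list" assume "\<not> (length ds = 2 \<and> set ds \<subseteq> ?D p)"
    then show "R p ds = 0" by (auto simp: R_def)
  qed
  moreover have "alternating_in_first 2 (R p)" for p
    unfolding alternating_in_first_def
  proof (intro allI impI)
    fix cs :: "('v \<Rightarrow> real) list" and i j :: nat assume "i < j \<and> j < 2 \<and> 2 \<le> length cs \<and> cs ! i = cs ! j"
    then have h: "cs ! 0 = cs ! 1" by (auto simp: less_2_cases_iff)
    show "R p cs = 0"
    proof (cases "length cs = 2 \<and> set cs \<subseteq> ?D p")
      case True
      then have m: "cs ! 1 \<in> ?D p" by (metis nth_mem one_less_numeral_iff semiring_norm(76) subsetD)
      \<comment> \<open>On equal arguments skewness gives B = -B, and 2 is invertible.\<close>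
      have "2 *\<^sub>R B p (cs ! 1) (cs ! 1) = 0"
        unfolding scaleR_2 by (subst (1) B_skew[OF m m]) simp
      then show ?thesis using h by (simp add: R_def)
    qed (auto simp: R_def)
  qed
  moreover have "smooth_on U (\<lambda>p. \<Phi> p (R p (map (\<lambda>j. coframe A \<Phi> j p) js)) i)"
    if t: "(U, \<Phi>) \<in> trivs A" and i: "i < rk" and js: "length js = 2" "set js \<subseteq> {..<rk}" for U \<Phi> js i
  proof (rule smooth_fun_on_local[OF triv_open[OF t]])
    fix p assume p: "p \<in> U"
    obtain k l where kl: "js = [k, l]" "k < rk" "l < rk"
      using js by (auto simp: length_Suc_conv numeral_2_eq_2)
    obtain \<mu> T F where f: "\<mu> \<in> smfuns" "\<mu> p = 1" "open T" "p \<in> T" "T \<subseteq> U" "\<And>q. q \<in> T \<Longrightarrow> \<mu> q \<noteq> 0"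
      "\<And>j. j < rk \<Longrightarrow> F j \<in> dsec"
      "\<And>j q. q \<in> U \<Longrightarrow> F j q = (\<lambda>v. \<mu> q * coframe A \<Phi> j q v)"
      by (rule local_frame[OF t p]) blast
    have "smooth_on T (\<lambda>p. \<Phi> p (R p (map (\<lambda>j. coframe A \<Phi> j p) js)) i)"
    proof (rule smooth_fun_on_divide[OF f(3,1,6)])
      show "pairing (F i) (E (F k) (F l)) \<in> smfuns"
        using f(7) i kl by (intro pairing_smooth closed) auto
      fix q assume "q \<in> T"
      then have q: "q \<in> U" using f(5) by blast
      note cf = coframe_in_dual_fibre[OF t q]
      have "E (F k) (F l) q = B q (F k q) (F l q)" using B f(7) kl by simp
      also have "\<dots> = (\<mu> q * \<mu> q) *\<^sub>R B q (coframe A \<Phi> k q) (coframe A \<Phi> l q)"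
        using B_lin[OF cf[of k] cf[of k] dual_fibre_scale[OF cf[of l]], of "\<mu> q" 0 "\<mu> q"]
          B_lin2[OF cf[of l] cf[of l] cf[of k], of "\<mu> q" 0]
        by (simp add: f(8)[OF q])
      \<comment> \<open>Two of the three factors \<mu> come from the arguments \<open>F k\<close>
        and \<open>F l\<close>, the third from the covector \<open>F i\<close> that reads off the
        coefficient.\<close>
      finally show "pairing (F i) (E (F k) (F l)) q = \<mu> q ^ 3 * \<Phi> q (R q (map (\<lambda>j. coframe A \<Phi> j q) js)) i"
        using fib[of q "map (\<lambda>j. coframe A \<Phi> j q) js"] cf
        by (simp add: pairing_def f(8)[OF q] kl R_def coframe_def[of _ _ i] fibre_scale triv_scale[OF t q]
            power3_eq_cube mult_ac)
    qed
    then show "\<exists>T. open T \<and> p \<in> T \<and> smooth_on T (\<lambda>p. \<Phi> p (R p (map (\<lambda>j. coframe A \<Phi> j p) js)) i)"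
      using f by blast
  qed
  ultimately have "R \<in> homs 2" using fib unfolding hom_sections_def by blast
  then show ?thesis using app by blast
qed

end

section \<open>Left-symmetric algebroids\<close>

locale lsa =
  fixes A :: "('m::{t2_space,second_countable_topology}, 'v::real_vector, 'z) algebroid_scheme"
  assumes lsa: "left_symmetric_algebroid A"
begin

sublocale vbundle A
  using lsa by unfold_locales (simp add: left_symmetric_algebroid_def)

lemma pairing_add [simp]:
  "\<alpha> \<in> dsec \<Longrightarrow> x \<in> sec \<Longrightarrow> y \<in> sec \<Longrightarrow> pairing \<alpha> (x + y) = pairing \<alpha> x + pairing \<alpha> y"
  and pairing_diff [simp]:
  "\<alpha> \<in> dsec \<Longrightarrow> x \<in> sec \<Longrightarrow> y \<in> sec \<Longrightarrow> pairing \<alpha> (x - y) = pairing \<alpha> x - pairing \<alpha> y"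
  and pairing_zero [simp]: "\<alpha> \<in> dsec \<Longrightarrow> pairing \<alpha> 0 = 0"
  and pairing_smul [simp]:
  "\<alpha> \<in> dsec \<Longrightarrow> x \<in> sec \<Longrightarrow> pairing \<alpha> (smul f x) = f * pairing \<alpha> x"
  by (simp_all add: fun_eq_iff pairing_def smul_def dual_fibre_at_add[OF dual_section_fibre section_fibre section_fibre]
      dual_fibre_at_diff[OF dual_section_fibre section_fibre section_fibre]
      dual_fibre_at_zero[OF dual_section_fibre] dual_fibre_at_scale[OF dual_section_fibre section_fibre])

lemma pairing_left_simps [simp]:
  "pairing (\<alpha> + \<beta>) x = pairing \<alpha> x + pairing \<beta> x"
  "pairing (\<alpha> - \<beta>) x = pairing \<alpha> x - pairing \<beta> x"
  "pairing (dsmul f \<alpha>) x = f * pairing \<alpha> x"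
  "pairing 0 x = 0"
  by (simp_all add: fun_eq_iff pairing_def dsmul_def)

lemma smooth_funs_simps [simp]:
  "f \<in> smfuns \<Longrightarrow> g \<in> smfuns \<Longrightarrow> f + g \<in> smfuns"
  "f \<in> smfuns \<Longrightarrow> g \<in> smfuns \<Longrightarrow> f - g \<in> smfuns"
  "f \<in> smfuns \<Longrightarrow> g \<in> smfuns \<Longrightarrow> f * g \<in> smfuns"
  "0 \<in> smfuns"
  by (simp_all add: plus_fun_def fun_diff_def times_fun_def zero_fun_def smooth_fun_on_add smooth_fun_on_diff
      smooth_fun_on_mult smooth_fun_on_const)

declare section_zero [simp] section_add [simp] section_diff [simp] section_minus [simp] section_smul [simp]
  dual_section_zero [simp] dual_section_add [simp] dual_section_diff [simp] dual_section_minus [simp]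
  dual_section_smul [simp] pairing_smooth [simp]

text \<open>\<open>smfuns\<close> abbreviates a set comprehension; membership has to stay folded for
  the closure rules to act as rewrite rules.\<close>

declare mem_Collect_eq [simp del]

section \<open>The product of sections\<close>

lemma star_closed [simp]: "x \<in> sec \<Longrightarrow> y \<in> sec \<Longrightarrow> star A x y \<in> sec"
  using lsa unfolding left_symmetric_algebroid_def by blast

lemma star_combination:
  assumes "x \<in> sec" "y \<in> sec" "z \<in> sec"
  shows "star A (\<lambda>p. a *\<^sub>R x p + b *\<^sub>R y p) z = (\<lambda>p. a *\<^sub>R star A x z p + b *\<^sub>R star A y z p)"
    and "star A z (\<lambda>p. a *\<^sub>R x p + b *\<^sub>R y p) = (\<lambda>p. a *\<^sub>R star A z x p + b *\<^sub>R star A z y p)"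
  using lsa assms unfolding left_symmetric_algebroid_def by blast+

lemma star_add_left [simp]:
  "x \<in> sec \<Longrightarrow> y \<in> sec \<Longrightarrow> z \<in> sec \<Longrightarrow> star A (x + y) z = star A x z + star A y z"
  and star_add_right [simp]:
  "x \<in> sec \<Longrightarrow> y \<in> sec \<Longrightarrow> z \<in> sec \<Longrightarrow> star A z (x + y) = star A z x + star A z y"
  and star_diff_left [simp]:
  "x \<in> sec \<Longrightarrow> y \<in> sec \<Longrightarrow> z \<in> sec \<Longrightarrow> star A (x - y) z = star A x z - star A y z"
  using star_combination[of x y z 1 1] star_combination[of x y z 1 "-1"]
  by (simp_all add: plus_fun_def fun_diff_def)

lemma left_symmetric:
  assumes "x \<in> sec" "y \<in> sec" "z \<in> sec"
  shows "star A x (star A y z) - star A (star A x y) z = star A y (star A x z) - star A (star A y x) z"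
proof
  fix p
  have "\<forall>x\<in>sec. \<forall>y\<in>sec. \<forall>z\<in>sec. \<forall>p.
        star A x (star A y z) p - star A (star A x y) z p = star A y (star A x z) p - star A (star A y x) z p"
    using lsa unfolding left_symmetric_algebroid_def by (elim conjE)
  then show "(star A x (star A y z) - star A (star A x y) z) p = (star A y (star A x z) - star A (star A y x) z) p"
    using assms by simp
qed

lemma star_smul_right [simp]:
  assumes "x \<in> sec" "y \<in> sec" "f \<in> smfuns"
  shows "star A x (smul f y) = smul f (star A x y) + smul (anchor_deriv A x f) y"
    and star_smul_left: "star A (smul f x) y = smul f (star A x y)"
proof -
  have "\<forall>x\<in>sec. \<forall>y\<in>sec. \<forall>f\<in>smfuns. \<forall>p.
        star A x (\<lambda>q. f q *\<^sub>R y q) p = f p *\<^sub>R star A x y p + anchor_deriv A x f p *\<^sub>R y p \<and>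
        star A (\<lambda>q. f q *\<^sub>R x q) y p = f p *\<^sub>R star A x y p"
    using lsa unfolding left_symmetric_algebroid_def by (elim conjE)
  from bspec[OF bspec[OF bspec[OF this assms(1)] assms(2)] assms(3)]
  show "star A x (smul f y) = smul f (star A x y) + smul (anchor_deriv A x f) y"
    "star A (smul f x) y = smul f (star A x y)"
    by (simp_all add: smul_def fun_eq_iff)
qed

declare star_smul_left [simp]

section \<open>The anchor as derivation of functions\<close>

lemma anchor_facts:
  shows anchor_tangent: "v \<in> fibre A p \<Longrightarrow> anchor A p v \<in> tangent_space A p"
    and anchor_linear: "v \<in> fibre A p \<Longrightarrow> w \<in> fibre A p \<Longrightarrow> f \<in> smfuns \<Longrightarrow>
      anchor A p (a *\<^sub>R v + b *\<^sub>R w) f = a * anchor A p v f + b * anchor A p w f"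
    and anchor_frame_smooth: "(U, \<Phi>) \<in> trivs A \<Longrightarrow> i < rk \<Longrightarrow> f \<in> smfuns \<Longrightarrow>
      smooth_on U (\<lambda>p. anchor A p (frame A \<Phi> i p) f)"
proof -
  have b: "bundle_map_to_tangent A (anchor A)"
    using lsa unfolding left_symmetric_algebroid_def by blast
  show "v \<in> fibre A p \<Longrightarrow> anchor A p v \<in> tangent_space A p"
    using b unfolding bundle_map_to_tangent_def by blast
  show "v \<in> fibre A p \<Longrightarrow> w \<in> fibre A p \<Longrightarrow> f \<in> smfuns \<Longrightarrow>
      anchor A p (a *\<^sub>R v + b *\<^sub>R w) f = a * anchor A p v f + b * anchor A p w f"
    using b unfolding bundle_map_to_tangent_def by blast
  show "(U, \<Phi>) \<in> trivs A \<Longrightarrow> i < rk \<Longrightarrow> f \<in> smfuns \<Longrightarrow>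
      smooth_on U (\<lambda>p. anchor A p (frame A \<Phi> i p) f)"
    using b unfolding bundle_map_to_tangent_def by blast
qed

lemma anchor_zero: "f \<in> smfuns \<Longrightarrow> anchor A p 0 f = 0"
  using anchor_linear[of 0 p 0 f 0 0] by simp

lemma anchor_add: "v \<in> fibre A p \<Longrightarrow> w \<in> fibre A p \<Longrightarrow> f \<in> smfuns \<Longrightarrow>
    anchor A p (v + w) f = anchor A p v f + anchor A p w f"
  using anchor_linear[of v p w f 1 1] by simp

lemma anchor_scale: "v \<in> fibre A p \<Longrightarrow> f \<in> smfuns \<Longrightarrow> anchor A p (a *\<^sub>R v) f = a * anchor A p v f"
  using anchor_linear[of v p v f a 0] by simp

lemma anchor_sum: "(\<And>j. j \<in> J \<Longrightarrow> v j \<in> fibre A p) \<Longrightarrow> f \<in> smfuns \<Longrightarrow>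
    anchor A p (\<Sum>j\<in>J. v j) f = (\<Sum>j\<in>J. anchor A p (v j) f)"
  by (induction J rule: infinite_finite_induct) (auto simp: anchor_zero anchor_add fibre_sum)

lemma anchor_deriv_smooth [simp]:
  assumes "x \<in> sec" "f \<in> smfuns"
  shows "anchor_deriv A x f \<in> smfuns"
proof -
  have "\<exists>T. open T \<and> p \<in> T \<and> smooth_on T (anchor_deriv A x f)" for p
  proof -
    obtain U \<Phi> where t: "(U, \<Phi>) \<in> trivs A" "p \<in> U" using triv_cover by blast
    have "smooth_on U (\<lambda>q. \<Sum>j<rk. \<Phi> q (x q) j * anchor A q (frame A \<Phi> j q) f)"
      using assms t
      by (intro smooth_fun_on_sum smooth_fun_on_mult section_smooth anchor_frame_smooth triv_open[OF t(1)]) auto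
    moreover have "anchor_deriv A x f q = (\<Sum>j<rk. \<Phi> q (x q) j * anchor A q (frame A \<Phi> j q) f)"
      if q: "q \<in> U" for q
    proof -
      have "anchor_deriv A x f q = anchor A q (\<Sum>j<rk. \<Phi> q (x q) j *\<^sub>R frame A \<Phi> j q) f"
        using frame_expand[OF t(1) q section_fibre[OF assms(1)]] by (simp add: anchor_deriv_def)
      also have "\<dots> = (\<Sum>j<rk. \<Phi> q (x q) j * anchor A q (frame A \<Phi> j q) f)"
        using frame_in_fibre[OF t(1) q] assms(2)
        by (subst anchor_sum) (auto intro: fibre_scale simp: anchor_scale)
      finally show ?thesis .
    qed
    ultimately have "smooth_on U (anchor_deriv A x f)" by (rule smooth_fun_on_eqI[OF triv_open[OF t(1)]])
    then show ?thesis using t triv_open by blast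
  qed
  then show ?thesis using smooth_fun_on_local[of UNIV "anchor_deriv A x f"] by (auto simp: mem_Collect_eq)
qed

lemma anchor_deriv_add_left [simp]:
  assumes "x \<in> sec" "y \<in> sec" "f \<in> smfuns"
  shows "anchor_deriv A (x + y) f = anchor_deriv A x f + anchor_deriv A y f"
  using assms anchor_add section_fibre by (simp add: fun_eq_iff anchor_deriv_def)

lemma anchor_deriv_smul_left [simp]:
  assumes "x \<in> sec" "f \<in> smfuns"
  shows "anchor_deriv A (smul g x) f = g * anchor_deriv A x f"
  using assms anchor_scale section_fibre by (simp add: fun_eq_iff anchor_deriv_def smul_def)

lemma anchor_deriv_combination:
  assumes "x \<in> sec" "f \<in> smfuns" "g \<in> smfuns"
  shows "anchor_deriv A x (\<lambda>q. a * f q + b * g q) = (\<lambda>q. a * anchor_deriv A x f q + b * anchor_deriv A x g q)"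
    and anchor_deriv_mult: "anchor_deriv A x (f * g) = f * anchor_deriv A x g + g * anchor_deriv A x f"
  using anchor_tangent[OF section_fibre[OF assms(1)]] assms(2,3)
  unfolding tangent_space_def by (auto simp: fun_eq_iff anchor_deriv_def times_fun_def mem_Collect_eq)

lemma anchor_deriv_add [simp]:
  "x \<in> sec \<Longrightarrow> f \<in> smfuns \<Longrightarrow> g \<in> smfuns \<Longrightarrow>
    anchor_deriv A x (f + g) = anchor_deriv A x f + anchor_deriv A x g"
  and anchor_deriv_diff [simp]:
  "x \<in> sec \<Longrightarrow> f \<in> smfuns \<Longrightarrow> g \<in> smfuns \<Longrightarrow>
    anchor_deriv A x (f - g) = anchor_deriv A x f - anchor_deriv A x g"
  using anchor_deriv_combination(1)[of x f g 1 1] anchor_deriv_combination(1)[of x f g 1 "-1"]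
  by (simp_all add: plus_fun_def fun_diff_def)

lemma lie_bracket_eq: "lie_bracket A x y = star A x y - star A y x"
  by (simp add: lie_bracket_def fun_diff_def)

lemma smul_add_right: "smul f (x + y) = smul f x + smul f y"
  and smul_diff_right: "smul f (x - y) = smul f x - smul f y"
  and smul_diff_left: "smul (f - g) x = smul f x - smul g x"
  by (simp_all add: smul_def fun_eq_iff algebra_simps)

text \<open>Bracket compatibility of the anchor, multiplied by z: it is what remains of left
  symmetry for x, y and f z after left symmetry for x, y and z, times f, is subtracted.\<close>

lemma anchor_deriv_lie_bracket_smul:
  assumes s: "x \<in> sec" "y \<in> sec" "z \<in> sec" and f: "f \<in> smfuns"
  shows "smul (anchor_deriv A x (anchor_deriv A y f) - anchor_deriv A (star A x y) f) z =
    smul (anchor_deriv A y (anchor_deriv A x f) - anchor_deriv A (star A y x) f) z"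
proof -
  \<comment> \<open>The two terms with a single derivative of f are exchanged when x and y are, so
    they disappear from the difference.\<close>
  have "star A x (star A y (smul f z)) - star A (star A x y) (smul f z) =
      smul f (star A x (star A y z) - star A (star A x y) z) +
      smul (anchor_deriv A x f) (star A y z) + smul (anchor_deriv A y f) (star A x z) +
      smul (anchor_deriv A x (anchor_deriv A y f) - anchor_deriv A (star A x y) f) z"
    if "x \<in> sec" "y \<in> sec" for x y
    using that s(3) f by (simp add: smul_add_right smul_diff_right smul_diff_left algebra_simps)
  from this[OF s(1,2)] this[OF s(2,1)] show ?thesis
    using left_symmetric[OF s(1,2) section_smul[OF f s(3)]] left_symmetric[OF s] by (simp add: algebra_simps)
qed

text \<open>To cancel the section factor of \<open>anchor_deriv_lie_bracket_smul\<close> at p, a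
  section not vanishing at p is taken, extending a frame vector. In rank zero there is none, but
  then the pairing is zero.\<close>

lemma anchor_deriv_lie_bracket_pairing:
  assumes s: "x \<in> sec" "y \<in> sec" "z \<in> sec" and \<xi>: "\<xi> \<in> dsec"
  shows "anchor_deriv A x (anchor_deriv A y (pairing \<xi> z)) - anchor_deriv A (star A x y) (pairing \<xi> z) =
    anchor_deriv A y (anchor_deriv A x (pairing \<xi> z)) - anchor_deriv A (star A y x) (pairing \<xi> z)"
    (is "?l = ?r")
proof
  fix p
  show "?l p = ?r p"
  proof (cases "rk = 0")
    case True
    have z: "w = 0" if "w \<in> fibre A q" for w q
    proof -
      obtain U \<Phi> where "(U, \<Phi>) \<in> trivs A" "q \<in> U" using triv_cover by blast
      from frame_expand[OF this that] show ?thesis using True by simp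
    qed
    have "pairing \<xi> z = 0"
      using z[OF section_fibre[OF s(3)]] dual_fibre_at_zero[OF dual_section_fibre[OF \<xi>]]
      by (simp add: fun_eq_iff pairing_def)
    moreover have "anchor_deriv A w 0 = 0" if "w \<in> sec" for w
      using anchor_deriv_diff[OF that, of 0 0] by simp
    ultimately show ?thesis using s by simp
  next
    case False
    obtain U \<Phi> where t: "(U, \<Phi>) \<in> trivs A" "p \<in> U" using triv_cover by blast
    have fr: "frame A \<Phi> 0 p \<in> fibre A p" using frame_in_fibre[OF t] False by simp
    have "frame A \<Phi> 0 p \<noteq> 0" using triv_frame[OF t, of 0 0] triv_zero[OF t] False by auto
    moreover obtain w where w: "w \<in> sec" "w p = frame A \<Phi> 0 p" using section_extension[OF fr] by blast
    ultimately show ?thesis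
      using fun_cong[OF anchor_deriv_lie_bracket_smul[OF s(1,2) w(1) pairing_smooth[OF \<xi> s(3)]], of p]
      by (simp add: smul_def)
  qed
qed

text \<open>The right-hand side is C-infinity-linear in y: replacing y by f y produces the
  derivative of f along x times the pairing of \<xi> and y once from the anchor and once from the
  product, with opposite signs.\<close>

lemma Lop_facts:
  assumes "x \<in> sec" "\<xi> \<in> dsec"
  shows Lop_closed [simp]: "Lop A x \<xi> \<in> dsec"
    and Lop_pairing [simp]: "y \<in> sec \<Longrightarrow>
      pairing (Lop A x \<xi>) y = anchor_deriv A x (pairing \<xi> y) - pairing \<xi> (star A x y)"
proof -
  define D where "D y = anchor_deriv A x (pairing \<xi> y) - pairing \<xi> (star A x y)" for y
  have "\<exists>\<eta>\<in>dsec. \<forall>y\<in>sec. pairing \<eta> y = D y"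
  proof (rule dual_section_of_functional)
    fix f y assume f: "f \<in> smfuns" and y: "y \<in> sec"
    show "D (smul f y) = f * D y"
      using assms f y by (simp add: D_def anchor_deriv_mult algebra_simps)
  qed (use assms in \<open>simp_all add: D_def\<close>)
  then obtain \<eta> where \<eta>: "\<eta> \<in> dsec" "\<And>y. y \<in> sec \<Longrightarrow> pairing \<eta> y = D y" by blast
  have "Lop A x \<xi> = \<eta>"
    unfolding Lop_def
  proof (rule the_equality)
    show "\<eta> \<in> dsec \<and> (\<forall>y\<in>sec. \<forall>p.
        pairing \<eta> y p = anchor_deriv A x (pairing \<xi> y) p - pairing \<xi> (star A x y) p)"
      using \<eta> by (simp add: D_def)
    fix \<theta> assume \<theta>: "\<theta> \<in> dsec \<and> (\<forall>y\<in>sec. \<forall>p.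
        pairing \<theta> y p = anchor_deriv A x (pairing \<xi> y) p - pairing \<xi> (star A x y) p)"
    show "\<theta> = \<eta>"
      by (rule dual_section_eqI) (use \<theta> \<eta> in \<open>auto simp: D_def fun_eq_iff\<close>)
  qed
  then show "Lop A x \<xi> \<in> dsec"
    "y \<in> sec \<Longrightarrow> pairing (Lop A x \<xi>) y = anchor_deriv A x (pairing \<xi> y) - pairing \<xi> (star A x y)"
    using \<eta> by (simp_all add: D_def)
qed

lemma Lop_add_left:
  "x \<in> sec \<Longrightarrow> y \<in> sec \<Longrightarrow> \<xi> \<in> dsec \<Longrightarrow> Lop A (x + y) \<xi> = Lop A x \<xi> + Lop A y \<xi>"
  by (rule dual_section_eqI) simp_all

lemma Lop_add_right:
  "x \<in> sec \<Longrightarrow> \<xi> \<in> dsec \<Longrightarrow> \<eta> \<in> dsec \<Longrightarrow> Lop A x (\<xi> + \<eta>) = Lop A x \<xi> + Lop A x \<eta>"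
  by (rule dual_section_eqI) simp_all

lemma Lop_smul_left:
  "x \<in> sec \<Longrightarrow> f \<in> smfuns \<Longrightarrow> \<xi> \<in> dsec \<Longrightarrow> Lop A (smul f x) \<xi> = dsmul f (Lop A x \<xi>)"
  by (rule dual_section_eqI) (simp_all add: algebra_simps)

lemma Lop_smul_right:
  "x \<in> sec \<Longrightarrow> f \<in> smfuns \<Longrightarrow> \<xi> \<in> dsec \<Longrightarrow>
    Lop A x (dsmul f \<xi>) = dsmul f (Lop A x \<xi>) + dsmul (anchor_deriv A x f) \<xi>"
  by (rule dual_section_eqI) (simp_all add: anchor_deriv_mult algebra_simps)

text \<open>Paired with z, the identity splits into bracket compatibility of the anchor on the
  function pairing \<xi> with z, and left symmetry paired with \<xi>; the mixed terms
  cancel.\<close>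

lemma Lop_lie_bracket:
  assumes "x \<in> sec" "y \<in> sec" "\<xi> \<in> dsec"
  shows "Lop A (star A x y - star A y x) \<xi> = Lop A x (Lop A y \<xi>) - Lop A y (Lop A x \<xi>)"
proof (rule dual_section_eqI)
  have anchor_diff: "anchor_deriv A (u - v) f = anchor_deriv A u f - anchor_deriv A v f"
    if "u \<in> sec" "v \<in> sec" "f \<in> smfuns" for u v f
    using anchor_deriv_add_left[of "u - v" v f] that by simp
  fix z assume z: "z \<in> sec"
  show "pairing (Lop A (star A x y - star A y x) \<xi>) z = pairing (Lop A x (Lop A y \<xi>) - Lop A y (Lop A x \<xi>)) z"
    using assms z anchor_deriv_lie_bracket_pairing[OF assms(1,2) z assms(3)]
      arg_cong[where f = "pairing \<xi>", OF left_symmetric[OF assms(1,2) z]]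
    by (simp add: anchor_diff algebra_simps)
qed (use assms in simp_all)

end

section \<open>The Jacobi identity\<close>

text \<open>X and Y are carrier sets because sections form only a subset of a function type.
  Restricting to additive structure keeps smooth functions and derivations out of the Jacobi
  identity; division by 2 and 3 is left to the application.\<close>

locale left_symmetric_rep =
  fixes X :: "'x::ab_group_add set" and Y :: "'y::ab_group_add set"
    and st :: "'x \<Rightarrow> 'x \<Rightarrow> 'x" and L :: "'x \<Rightarrow> 'y \<Rightarrow> 'y"
  assumes X_closed [simp]: "0 \<in> X" "x \<in> X \<Longrightarrow> x' \<in> X \<Longrightarrow> x + x' \<in> X" "x \<in> X \<Longrightarrow> x' \<in> X \<Longrightarrow> x - x' \<in> X"
    and Y_closed [simp]: "0 \<in> Y" "y \<in> Y \<Longrightarrow> y' \<in> Y \<Longrightarrow> y + y' \<in> Y" "y \<in> Y \<Longrightarrow> y' \<in> Y \<Longrightarrow> y - y' \<in> Y"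
    and st_closed [simp]: "x \<in> X \<Longrightarrow> x' \<in> X \<Longrightarrow> st x x' \<in> X"
    and L_closed [simp]: "x \<in> X \<Longrightarrow> y \<in> Y \<Longrightarrow> L x y \<in> Y"
    and st_add_left [simp]: "x \<in> X \<Longrightarrow> x' \<in> X \<Longrightarrow> z \<in> X \<Longrightarrow> st (x + x') z = st x z + st x' z"
    and st_add_right [simp]: "x \<in> X \<Longrightarrow> x' \<in> X \<Longrightarrow> z \<in> X \<Longrightarrow> st z (x + x') = st z x + st z x'"
    and L_add_left [simp]: "x \<in> X \<Longrightarrow> x' \<in> X \<Longrightarrow> y \<in> Y \<Longrightarrow> L (x + x') y = L x y + L x' y"
    and L_add_right [simp]: "x \<in> X \<Longrightarrow> y \<in> Y \<Longrightarrow> y' \<in> Y \<Longrightarrow> L x (y + y') = L x y + L x y'"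
    and left_symmetric: "x \<in> X \<Longrightarrow> x' \<in> X \<Longrightarrow> z \<in> X \<Longrightarrow>
      st x (st x' z) - st (st x x') z = st x' (st x z) - st (st x' x) z"
    and L_bracket: "x \<in> X \<Longrightarrow> x' \<in> X \<Longrightarrow> y \<in> Y \<Longrightarrow> L (st x x' - st x' x) y = L x (L x' y) - L x' (L x y)"
begin

lemma st_diff_left [simp]: "x \<in> X \<Longrightarrow> x' \<in> X \<Longrightarrow> z \<in> X \<Longrightarrow> st (x - x') z = st x z - st x' z"
  using st_add_left[of "x - x'" x' z] by (simp add: eq_diff_eq del: st_add_left)

lemma st_diff_right [simp]: "x \<in> X \<Longrightarrow> x' \<in> X \<Longrightarrow> z \<in> X \<Longrightarrow> st z (x - x') = st z x - st z x'"
  using st_add_right[of "x - x'" x' z] by (simp add: eq_diff_eq del: st_add_right)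

lemma L_diff_left [simp]: "x \<in> X \<Longrightarrow> x' \<in> X \<Longrightarrow> y \<in> Y \<Longrightarrow> L (x - x') y = L x y - L x' y"
  using L_add_left[of "x - x'" x' y] by (simp add: eq_diff_eq del: L_add_left)

lemma L_diff_right [simp]: "x \<in> X \<Longrightarrow> y \<in> Y \<Longrightarrow> y' \<in> Y \<Longrightarrow> L x (y - y') = L x y - L x y'"
  using L_add_right[of x "y - y'" y'] by (simp add: eq_diff_eq del: L_add_right)

definition lie :: "'x \<Rightarrow> 'x \<Rightarrow> 'x" where "lie x y = st x y - st y x"

lemma lie_closed [simp]: "x \<in> X \<Longrightarrow> y \<in> X \<Longrightarrow> lie x y \<in> X"
  by (simp add: lie_def)

lemma lie_simps [simp]:
  assumes "x \<in> X" "y \<in> X" "z \<in> X"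
  shows "lie (x + y) z = lie x z + lie y z" "lie (x - y) z = lie x z - lie y z"
    "lie z (x + y) = lie z x + lie z y" "lie z (x - y) = lie z x - lie z y"
  using assms by (simp_all add: lie_def)

text \<open>Left symmetry trades each (x y) z for (y x) z plus products nested to the right, and
  these cancel in the cyclic sum.\<close>

lemma lie_Jacobi:
  assumes "x \<in> X" "y \<in> X" "z \<in> X"
  shows "lie (lie x y) z + lie (lie y z) x + lie (lie z x) y = 0"
proof -
  have *: "st (st x y) z = st x (st y z) - st y (st x z) + st (st y x) z" if "x \<in> X" "y \<in> X" "z \<in> X" for x y z
    using left_symmetric[OF that] by (simp add: algebra_simps)
  \<comment> \<open>The trade is instantiated for the three cyclic orderings only; as a general
    rewrite rule it would loop.\<close>
  show ?thesis
    using assms by (simp add: lie_def *[of x y z] *[of y z x] *[of z x y] algebra_simps)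
qed

definition additive_ops :: "('y \<Rightarrow> 'x) set" where
  "additive_ops = {P. (\<forall>y\<in>Y. P y \<in> X) \<and> (\<forall>y\<in>Y. \<forall>y'\<in>Y. P (y + y') = P y + P y')}"

lemma additive_ops_simps [simp]:
  assumes "P \<in> additive_ops" "y \<in> Y"
  shows "P y \<in> X"
    and "y' \<in> Y \<Longrightarrow> P (y + y') = P y + P y'"
    and "y' \<in> Y \<Longrightarrow> P (y - y') = P y - P y'"
proof -
  have add: "\<And>y y'. y \<in> Y \<Longrightarrow> y' \<in> Y \<Longrightarrow> P (y + y') = P y + P y'"
    using assms(1) unfolding additive_ops_def by blast
  show "P y \<in> X" "y' \<in> Y \<Longrightarrow> P (y + y') = P y + P y'"
    using assms unfolding additive_ops_def by blast+
  show "y' \<in> Y \<Longrightarrow> P (y - y') = P y - P y'"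
    using add[of "y - y'" y'] assms(2) by (metis Y_closed(3) add_diff_cancel diff_add_cancel)
qed

lemma additive_ops_add [simp]: "P \<in> additive_ops \<Longrightarrow> Q \<in> additive_ops \<Longrightarrow> P + Q \<in> additive_ops"
  by (subst additive_ops_def) (simp add: add_ac)

text \<open>\<open>br11\<close> and \<open>br12\<close> are the brackets of cochains of arities \<open>(1,1)\<close> and \<open>(1,2)\<close>, with the
  unshuffles written out.\<close>

definition br11 :: "('y \<Rightarrow> 'x) \<Rightarrow> ('y \<Rightarrow> 'x) \<Rightarrow> 'y \<Rightarrow> 'y \<Rightarrow> 'x" where
  "br11 P Q a b = P (L (Q a) b - L (Q b) a) + Q (L (P a) b - L (P b) a) - lie (P a) (Q b) + lie (P b) (Q a)"

text \<open>A cyclic third of the twelve summands of the bracket (3 + 6 + 3); the signs of the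
  unshuffles are accounted for by the order of the arguments, for skew S.\<close>

definition br12_term :: "('y \<Rightarrow> 'x) \<Rightarrow> ('y \<Rightarrow> 'y \<Rightarrow> 'x) \<Rightarrow> 'y \<Rightarrow> 'y \<Rightarrow> 'y \<Rightarrow> 'x" where
  "br12_term P S a b c = P (L (S a b) c) - (S (L (P a) b) c - S (L (P b) a) c) + lie (P c) (S a b)"

definition br12 :: "('y \<Rightarrow> 'x) \<Rightarrow> ('y \<Rightarrow> 'y \<Rightarrow> 'x) \<Rightarrow> 'y \<Rightarrow> 'y \<Rightarrow> 'y \<Rightarrow> 'x" where
  "br12 P S a b c = br12_term P S a b c + br12_term P S b c a + br12_term P S c a b"

lemma br11_closed [simp]:
  "P \<in> additive_ops \<Longrightarrow> Q \<in> additive_ops \<Longrightarrow> a \<in> Y \<Longrightarrow> b \<in> Y \<Longrightarrow> br11 P Q a b \<in> X"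
  unfolding br11_def by simp

lemma br11_commute: "br11 P Q a b = br11 Q P a b"
  by (simp add: br11_def lie_def algebra_simps)

lemma br11_skew:
  "P \<in> additive_ops \<Longrightarrow> Q \<in> additive_ops \<Longrightarrow> a \<in> Y \<Longrightarrow> b \<in> Y \<Longrightarrow> br11 P Q b a = - br11 P Q a b"
  by (simp add: br11_def lie_def algebra_simps)

lemma br11_add_arg:
  assumes "P \<in> additive_ops" "Q \<in> additive_ops" "a \<in> Y" "a' \<in> Y" "b \<in> Y"
  shows "br11 P Q (a + a') b = br11 P Q a b + br11 P Q a' b"
    and "br11 P Q b (a + a') = br11 P Q b a + br11 P Q b a'"
  using assms by (simp_all add: br11_def algebra_simps)

lemma br11_add_left:
  "P \<in> additive_ops \<Longrightarrow> P' \<in> additive_ops \<Longrightarrow> Q \<in> additive_ops \<Longrightarrow> a \<in> Y \<Longrightarrow> b \<in> Y \<Longrightarrow>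
    br11 (P + P') Q a b = br11 P Q a b + br11 P' Q a b"
  by (simp add: br11_def algebra_simps)

text \<open>S is half the self-bracket of P and measures the failure of P to be a morphism of
  brackets. Both occurrences of S itself cancel, leaving double brackets and double actions.\<close>

lemma br12_term_self:
  assumes P: "P \<in> additive_ops" and Y: "a \<in> Y" "b \<in> Y" "c \<in> Y"
    and S: "\<And>a b. a \<in> Y \<Longrightarrow> b \<in> Y \<Longrightarrow> S a b = P (L (P a) b - L (P b) a) - lie (P a) (P b)"
  shows "br12_term P S a b c =
    lie (lie (P a) (P b)) (P c) + P (L (P c) (L (P a) b)) - P (L (P c) (L (P b) a))
      - (P (L (P a) (L (P b) c)) - P (L (P b) (L (P a) c)))"
proof -
  have S_closed: "S a b \<in> X" using P Y by (simp add: S)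
  \<comment> \<open>Read backwards, the definition of S says how P acts on the derived bracket of a
    and b; this re-expresses the nested P below.\<close>
  have br: "P (L (P a) b - L (P b) a) = S a b + lie (P a) (P b)" using Y by (simp add: S)
  have "S (L (P a) b) c - S (L (P b) a) c =
      P (L (P (L (P a) b - L (P b) a)) c) - P (L (P c) (L (P a) b - L (P b) a))
        - lie (P (L (P a) b - L (P b) a)) (P c)"
    using P Y by (simp add: S algebra_simps)
  also have "\<dots> = P (L (S a b) c) + P (L (lie (P a) (P b)) c) - P (L (P c) (L (P a) b - L (P b) a))
        - lie (S a b) (P c) - lie (lie (P a) (P b)) (P c)"
    unfolding br using P Y S_closed by (simp add: algebra_simps)
  \<comment> \<open>Here the representation property of L enters.\<close>
  also have "L (lie (P a) (P b)) c = L (P a) (L (P b) c) - L (P b) (L (P a) c)"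
    unfolding lie_def by (rule L_bracket) (use P Y in simp_all)
  finally have S_diff: "S (L (P a) b) c - S (L (P b) a) c =
      P (L (S a b) c) + P (L (P a) (L (P b) c) - L (P b) (L (P a) c)) - P (L (P c) (L (P a) b - L (P b) a))
        - lie (S a b) (P c) - lie (lie (P a) (P b)) (P c)" .
  have "lie (P c) (S a b) = - lie (S a b) (P c)" by (simp add: lie_def)
  then show ?thesis unfolding br12_term_def S_diff using P Y by (simp add: algebra_simps)
qed

text \<open>In the cyclic sum of \<open>br12_term_self\<close> the double brackets vanish by the
  Jacobi identity of \<open>lie\<close>, and each double action cancels against a cyclic shift of
  another. The self-bracket is S + S, so this holds twice.\<close>

lemma br12_self:
  assumes P: "P \<in> additive_ops" and Y: "a \<in> Y" "b \<in> Y" "c \<in> Y"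
  shows "br12 P (br11 P P) a b c = 0"
proof -
  define S where "S a b = P (L (P a) b - L (P b) a) - lie (P a) (P b)" for a b
  have S: "S a b \<in> X" if "a \<in> Y" "b \<in> Y" for a b using P that by (simp add: S_def)
  have br11_S: "br11 P P a b = S a b + S a b" if "a \<in> Y" "b \<in> Y" for a b
    by (simp add: br11_def S_def lie_def)
  have "br12_term P (br11 P P) a b c = br12_term P S a b c + br12_term P S a b c" if "a \<in> Y" "b \<in> Y" "c \<in> Y" for a b c
    using P that S by (simp add: br12_term_def br11_S algebra_simps)
  then have "br12 P (br11 P P) a b c = br12 P S a b c + br12 P S a b c"
    using Y by (simp add: br12_def algebra_simps)
  also have "br12 P S a b c = 0"
    using lie_Jacobi[of "P a" "P b" "P c"] P Y
    by (simp add: br12_def br12_term_self[OF P _ _ _ S_def] algebra_simps)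
  finally show ?thesis by simp
qed

lemma br12_add_left:
  assumes "P \<in> additive_ops" "P' \<in> additive_ops" "a \<in> Y" "b \<in> Y" "c \<in> Y"
    and S: "\<And>a b. a \<in> Y \<Longrightarrow> b \<in> Y \<Longrightarrow> S a b \<in> X"
      "\<And>a a' b. a \<in> Y \<Longrightarrow> a' \<in> Y \<Longrightarrow> b \<in> Y \<Longrightarrow> S (a + a') b = S a b + S a' b"
  shows "br12 (P + P') S a b c = br12 P S a b c + br12 P' S a b c"
  using assms by (simp add: br12_def br12_term_def algebra_simps)

lemma br12_add_right:
  assumes "P \<in> additive_ops" "a \<in> Y" "b \<in> Y" "c \<in> Y"
    and "\<And>a b. a \<in> Y \<Longrightarrow> b \<in> Y \<Longrightarrow> S a b \<in> X" "\<And>a b. a \<in> Y \<Longrightarrow> b \<in> Y \<Longrightarrow> S' a b \<in> X"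
    and "\<And>a b. a \<in> Y \<Longrightarrow> b \<in> Y \<Longrightarrow> T a b = S a b + S' a b"
  shows "br12 P T a b c = br12 P S a b c + br12 P S' a b c"
  using assms by (simp add: br12_def br12_term_def algebra_simps)

lemma br12_cong:
  assumes "P \<in> additive_ops" "a \<in> Y" "b \<in> Y" "c \<in> Y" "\<And>a b. a \<in> Y \<Longrightarrow> b \<in> Y \<Longrightarrow> T a b = S a b"
  shows "br12 P T a b c = br12 P S a b c"
  using assms by (simp add: br12_def br12_term_def)

text \<open>The Jacobi identity for three arity-one cochains is the polarisation of \<open>br12_self\<close>, whence
  the factor two.\<close>

lemma br12_Jacobi:
  assumes ops: "P \<in> additive_ops" "Q \<in> additive_ops" "R \<in> additive_ops" and Y: "a \<in> Y" "b \<in> Y" "c \<in> Y"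
  defines "T \<equiv> \<lambda>P Q R. br12 P (br11 Q R) a b c"
  shows "(T P Q R + T Q R P + T R P Q) + (T P Q R + T Q R P + T R P Q) = 0"
proof -
  have add1: "T (P + P') Q R = T P Q R + T P' Q R"
    if "P \<in> additive_ops" "P' \<in> additive_ops" "Q \<in> additive_ops" "R \<in> additive_ops" for P P' Q R
    unfolding T_def using that Y by (intro br12_add_left) (simp_all add: br11_add_arg)
  have add2: "T P (Q + Q') R = T P Q R + T P Q' R"
    if "P \<in> additive_ops" "Q \<in> additive_ops" "Q' \<in> additive_ops" "R \<in> additive_ops" for P Q Q' R
    unfolding T_def using that Y by (intro br12_add_right) (simp_all add: br11_add_left)
  have comm: "T P Q R = T P R Q" for P Q R
    unfolding T_def by (metis br11_commute ext)
  have add3: "T P R (Q + Q') = T P R Q + T P R Q'"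
    if "P \<in> additive_ops" "Q \<in> additive_ops" "Q' \<in> additive_ops" "R \<in> additive_ops" for P Q Q' R
    using add2[OF that] comm by metis
  have self: "T P P P = 0" if "P \<in> additive_ops" for P
    unfolding T_def using that Y by (rule br12_self)
  \<comment> \<open>First polarisation: expanding the vanishing cube of P + Q leaves the six terms
    in which both operators occur.\<close>
  have PQ: "T P P Q + T P Q P + T P Q Q + (T Q P P + T Q P Q + T Q Q P) = 0"
    if "P \<in> additive_ops" "Q \<in> additive_ops" for P Q
    using self[of "P + Q"] that by (simp add: add1 add2 add3 self[OF that(1)] self[OF that(2)] algebra_simps)
  define d where "d P Q = T P P Q + T P Q P + T P Q Q + (T Q P P + T Q P Q + T Q Q P)" for P Q
  have "T (P + Q + R) (P + Q + R) (P + Q + R) = 0" using ops by (intro self) simp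
  \<comment> \<open>Of the 27 terms 3 are diagonal, 18 involve exactly two operators and form the
    three sums \<open>d\<close>, and the remaining 6 coincide in pairs by symmetry in the last two
    arguments: hence the cyclic sum twice.\<close>
  moreover have "T (P + Q + R) (P + Q + R) (P + Q + R) = d P Q + d Q R + d P R +
      ((T P Q R + T Q R P + T R P Q) + (T P Q R + T Q R P + T R P Q))"
    using ops by (simp add: d_def add1 add2 add3 self[OF ops(1)] self[OF ops(2)] self[OF ops(3)] comm[of P R Q] comm[of Q P R] comm[of R Q P] algebra_simps)
  moreover have "d P Q = 0" "d Q R = 0" "d P R = 0"
    unfolding d_def using ops by (simp_all only: PQ)
  ultimately show ?thesis by simp
qed

end

section \<open>Brackets of low arity\<close>

definition perms2 :: "(nat \<Rightarrow> nat) list" where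
  "perms2 = [id, Transposition.transpose 0 1]"

definition perms3 :: "(nat \<Rightarrow> nat) list" where
  "perms3 = [id, Transposition.transpose 0 1, Transposition.transpose 1 2, Transposition.transpose 0 2,
     Transposition.transpose 0 1 \<circ> Transposition.transpose 1 2, Transposition.transpose 1 2 \<circ> Transposition.transpose 0 1]"

lemma permutes_less_2: "\<sigma> permutes {..<2} \<longleftrightarrow> \<sigma> \<in> set perms2"
proof
  assume s: "\<sigma> permutes {..<2::nat}"
  have v: "\<sigma> 0 < 2" "\<sigma> 1 < 2" "\<sigma> 0 \<noteq> \<sigma> 1"
    using permutes_in_image[OF s, of 0] permutes_in_image[OF s, of 1] inj_eq[OF permutes_inj[OF s], of 0 1] by auto
  have rest: "\<sigma> i = i" if "i \<ge> 2" for i using permutes_not_in[OF s, of i] that by simp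
  have "\<sigma> = \<tau>" if "\<sigma> 0 = \<tau> 0" "\<sigma> 1 = \<tau> 1" "\<And>i. i \<ge> 2 \<Longrightarrow> \<tau> i = i" for \<tau>
  proof
    fix i :: nat
    consider "i = 0" | "i = 1" | "i \<ge> 2" by linarith
    then show "\<sigma> i = \<tau> i" using that rest by cases auto
  qed
  moreover have "\<sigma> 0 = 0 \<and> \<sigma> 1 = 1 \<or> \<sigma> 0 = 1 \<and> \<sigma> 1 = 0" using v by arith
  ultimately show "\<sigma> \<in> set perms2"
    by (auto simp: perms2_def Transposition.transpose_def)
next
  assume "\<sigma> \<in> set perms2"
  then show "\<sigma> permutes {..<2}"
    by (auto simp: perms2_def intro: permutes_id permutes_swap_id)
qed

lemma permutes_less_3: "\<sigma> permutes {..<3} \<longleftrightarrow> \<sigma> \<in> set perms3"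
proof
  assume s: "\<sigma> permutes {..<3::nat}"
  have v: "\<sigma> 0 < 3" "\<sigma> 1 < 3" "\<sigma> 2 < 3" "\<sigma> 0 \<noteq> \<sigma> 1" "\<sigma> 0 \<noteq> \<sigma> 2" "\<sigma> 1 \<noteq> \<sigma> 2"
    using permutes_in_image[OF s, of 0] permutes_in_image[OF s, of 1] permutes_in_image[OF s, of 2]
      inj_eq[OF permutes_inj[OF s], of 0 1] inj_eq[OF permutes_inj[OF s], of 0 2]
      inj_eq[OF permutes_inj[OF s], of 1 2] by auto
  have rest: "\<sigma> i = i" if "i \<ge> 3" for i using permutes_not_in[OF s, of i] that by simp
  have eqI: "\<sigma> = \<tau>" if "\<sigma> 0 = \<tau> 0 \<and> \<sigma> 1 = \<tau> 1 \<and> \<sigma> 2 = \<tau> 2" "\<And>i. i \<ge> 3 \<Longrightarrow> \<tau> i = i" for \<tau>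
  proof
    fix i :: nat
    consider "i = 0" | "i = 1" | "i = 2" | "i \<ge> 3" by linarith
    then show "\<sigma> i = \<tau> i" using that rest by cases auto
  qed
  have fix3: "\<tau> i = i" if "\<tau> \<in> set perms3" "i \<ge> 3" for \<tau> i
    using that by (auto simp: perms3_def Transposition.transpose_def)
  have "\<sigma> 0 = 0 \<and> \<sigma> 1 = 1 \<and> \<sigma> 2 = 2 \<or> \<sigma> 0 = 1 \<and> \<sigma> 1 = 0 \<and> \<sigma> 2 = 2 \<or>
      \<sigma> 0 = 0 \<and> \<sigma> 1 = 2 \<and> \<sigma> 2 = 1 \<or> \<sigma> 0 = 2 \<and> \<sigma> 1 = 1 \<and> \<sigma> 2 = 0 \<or>
      \<sigma> 0 = 1 \<and> \<sigma> 1 = 2 \<and> \<sigma> 2 = 0 \<or> \<sigma> 0 = 2 \<and> \<sigma> 1 = 0 \<and> \<sigma> 2 = 1"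
  proof -
    have "\<sigma> 0 = 0 \<or> \<sigma> 0 = 1 \<or> \<sigma> 0 = 2" "\<sigma> 1 = 0 \<or> \<sigma> 1 = 1 \<or> \<sigma> 1 = 2" "\<sigma> 2 = 0 \<or> \<sigma> 2 = 1 \<or> \<sigma> 2 = 2"
      using v(1-3) by arith+
    then show ?thesis using v(4-6) by (elim disjE) simp_all
  qed
  then have "\<exists>\<tau>\<in>set perms3. \<sigma> 0 = \<tau> 0 \<and> \<sigma> 1 = \<tau> 1 \<and> \<sigma> 2 = \<tau> 2"
    by (elim disjE) (simp_all add: perms3_def Transposition.transpose_def)
  then show "\<sigma> \<in> set perms3" using eqI fix3 by blast
next
  assume "\<sigma> \<in> set perms3"
  then show "\<sigma> permutes {..<3}"
    by (auto simp: perms3_def intro!: permutes_id permutes_swap_id permutes_compose)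
qed

lemma distinct_perms2: "distinct perms2"
proof -
  have "distinct (map (\<lambda>\<sigma>. \<sigma> 0) perms2)" by (simp add: perms2_def)
  then show ?thesis by (simp add: distinct_map)
qed

lemma distinct_perms3: "distinct perms3"
proof -
  have "distinct (map (\<lambda>\<sigma>. (\<sigma> 0, \<sigma> 1)) perms3)" by (simp add: perms3_def Transposition.transpose_def)
  then show ?thesis by (simp add: distinct_map)
qed

lemma sign_perms:
  "sign (id :: nat \<Rightarrow> nat) = 1" "sign (Transposition.transpose 0 (1::nat)) = -1" "sign (Transposition.transpose 1 (2::nat)) = -1"
  "sign (Transposition.transpose 0 (2::nat)) = -1"
  "sign (Transposition.transpose 0 (1::nat) \<circ> Transposition.transpose 1 2) = 1" "sign (Transposition.transpose 1 (2::nat) \<circ> Transposition.transpose 0 1) = 1"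
  by (simp_all add: sign_id sign_swap_id sign_compose permutation_swap_id)

text \<open>Blocks of length at most one impose no condition, and a block of length two imposes one
  inequality. The final 0 in a list is the block of length n - 1 or m - 1 for arity one.\<close>

lemma unshuffles_sets:
  "unshuffles [1, 1, 0] = set perms2" "unshuffles [1, 1] = set perms2"
  "unshuffles [2, 1, 0] = set (filter (\<lambda>\<sigma>. \<sigma> 0 < \<sigma> 1) perms3)"
  "unshuffles [1, 1, 1] = set perms3"
  "unshuffles [1, 2] = set (filter (\<lambda>\<sigma>. \<sigma> 1 < \<sigma> 2) perms3)"
proof -
  have single: "strict_mono_on {k..<Suc k} \<sigma>" for k and \<sigma> :: "nat \<Rightarrow> nat"
    by (auto simp: strict_mono_on_def)
  have single': "strict_mono_on {k} \<sigma>" for k and \<sigma> :: "nat \<Rightarrow> nat"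
    by (auto simp: strict_mono_on_def)
  have empty: "strict_mono_on {} \<sigma>" for \<sigma> :: "nat \<Rightarrow> nat"
    by (auto simp: strict_mono_on_def)
  have two: "strict_mono_on {k..<Suc (Suc k)} \<sigma> \<longleftrightarrow> \<sigma> k < \<sigma> (Suc k)" for k and \<sigma> :: "nat \<Rightarrow> nat"
    by (auto simp: strict_mono_on_def less_Suc_eq le_less)
  note simps = unshuffles_def All_less_Suc single single' empty two numeral_2_eq_2 numeral_3_eq_3
  show "unshuffles [1, 1, 0] = set perms2" "unshuffles [1, 1] = set perms2"
    using permutes_less_2 by (auto simp: simps)
  show "unshuffles [2, 1, 0] = set (filter (\<lambda>\<sigma>. \<sigma> 0 < \<sigma> 1) perms3)"
    "unshuffles [1, 1, 1] = set perms3"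
    "unshuffles [1, 2] = set (filter (\<lambda>\<sigma>. \<sigma> 1 < \<sigma> 2) perms3)"
    using permutes_less_3 by (auto simp: simps)
qed

lemma sum_unshuffles:
  fixes f :: "(nat \<Rightarrow> nat) \<Rightarrow> 'a::ab_group_add"
  shows "(\<Sum>\<sigma>\<in>unshuffles [1, 1, 0]. f \<sigma>) = f id + f (Transposition.transpose 0 1)"
    and "(\<Sum>\<sigma>\<in>unshuffles [1, 1]. f \<sigma>) = f id + f (Transposition.transpose 0 1)"
    and "(\<Sum>\<sigma>\<in>unshuffles [2, 1, 0]. f \<sigma>) = f id + f (Transposition.transpose 1 2) + f (Transposition.transpose 0 1 \<circ> Transposition.transpose 1 2)"
    and "(\<Sum>\<sigma>\<in>unshuffles [1, 1, 1]. f \<sigma>) = f id + f (Transposition.transpose 0 1) + f (Transposition.transpose 1 2) + f (Transposition.transpose 0 2)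
      + f (Transposition.transpose 0 1 \<circ> Transposition.transpose 1 2) + f (Transposition.transpose 1 2 \<circ> Transposition.transpose 0 1)"
    and "(\<Sum>\<sigma>\<in>unshuffles [1, 2]. f \<sigma>) = f id + f (Transposition.transpose 0 1) + f (Transposition.transpose 1 2 \<circ> Transposition.transpose 0 1)"
  unfolding unshuffles_sets
  by (subst sum_list_distinct_conv_sum_set[symmetric],
      simp add: distinct_perms2 distinct_perms3 distinct_filter,
      simp add: perms2_def perms3_def Transposition.transpose_def add_ac)+

section \<open>Evaluation of the brackets of arities (1,1) and (1,2)\<close>

context lsa
begin

sublocale rep: left_symmetric_rep "sec" "dsec" "star A" "Lop A"
  by unfold_locales (simp_all add: Lop_add_left Lop_add_right left_symmetric Lop_lie_bracket)

lemma lie_bracket_rep: "lie_bracket A x y = rep.lie x y"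
  by (simp add: lie_bracket_eq rep.lie_def)

abbreviation op1 :: "('m, 'v) hom_field \<Rightarrow> ('m \<Rightarrow> 'v \<Rightarrow> real) \<Rightarrow> 'm \<Rightarrow> 'v" where
  "op1 P \<equiv> \<lambda>\<alpha>. field_apply P [\<alpha>]"

lemma op1_additive [simp]: "P \<in> homs 1 \<Longrightarrow> op1 P \<in> rep.additive_ops"
  unfolding rep.additive_ops_def using hom_apply_section hom_apply_add by (auto simp: mem_Collect_eq)

lemma hom_bracket_eval_11:
  assumes P: "P \<in> homs 1" and Q: "Q \<in> homs 1"
    and s: "\<alpha> \<in> dsec" "\<beta> \<in> dsec"
  shows "hom_bracket_eval A 1 P 1 Q [\<alpha>, \<beta>] = rep.br11 (op1 P) (op1 Q) \<alpha> \<beta>"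
proof -
  note additive = op1_additive[OF P] op1_additive[OF Q]
  have "hom_bracket_eval A 1 P 1 Q [\<alpha>, \<beta>] =
      (op1 P (Lop A (op1 Q \<alpha>) \<beta>) - op1 P (Lop A (op1 Q \<beta>) \<alpha>))
      + (op1 Q (Lop A (op1 P \<alpha>) \<beta>) - op1 Q (Lop A (op1 P \<beta>) \<alpha>))
      - (lie_bracket A (op1 P \<alpha>) (op1 Q \<beta>) - lie_bracket A (op1 P \<beta>) (op1 Q \<alpha>))"
    by (simp add: hom_bracket_eval_def sum_unshuffles[unfolded One_nat_def numeral_2_eq_2] sign_perms[unfolded One_nat_def numeral_2_eq_2]
        fun_eq_iff numeral_2_eq_2)
  then show ?thesis
    using s by (simp add: rep.br11_def lie_bracket_rep rep.additive_ops_simps[OF additive(1)]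
        rep.additive_ops_simps[OF additive(2)] algebra_simps)
qed

text \<open>The values of Z are given by a separate map S because the argument later is a bracket
  known only through its values on sections. Skewness of S brings the signed sum into cyclic
  form.\<close>

lemma hom_bracket_eval_12:
  assumes P: "P \<in> homs 1"
    and Z: "\<And>\<alpha> \<beta>. \<alpha> \<in> dsec \<Longrightarrow> \<beta> \<in> dsec \<Longrightarrow> field_apply Z [\<alpha>, \<beta>] = S \<alpha> \<beta>"
    and S: "\<And>\<alpha> \<beta>. \<alpha> \<in> dsec \<Longrightarrow> \<beta> \<in> dsec \<Longrightarrow> S \<alpha> \<beta> \<in> sec"
      "\<And>\<alpha> \<beta>. \<alpha> \<in> dsec \<Longrightarrow> \<beta> \<in> dsec \<Longrightarrow> S \<beta> \<alpha> = - S \<alpha> \<beta>"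
    and s: "a \<in> dsec" "b \<in> dsec" "c \<in> dsec"
  shows "hom_bracket_eval A 1 P 2 Z [a, b, c] = rep.br12 (op1 P) S a b c"
proof -
  note additive = op1_additive[OF P]
  note Pc = rep.additive_ops_simps(1)[OF additive]
  have "hom_bracket_eval A 1 P 2 Z [a, b, c] =
      (op1 P (Lop A (field_apply Z [a, b]) c) - op1 P (Lop A (field_apply Z [a, c]) b)
        + op1 P (Lop A (field_apply Z [b, c]) a))
      - (field_apply Z [Lop A (op1 P a) b, c] - field_apply Z [Lop A (op1 P b) a, c]
        - field_apply Z [Lop A (op1 P a) c, b] - field_apply Z [Lop A (op1 P c) b, a]
        + field_apply Z [Lop A (op1 P b) c, a] + field_apply Z [Lop A (op1 P c) a, b])
      + (lie_bracket A (op1 P a) (field_apply Z [b, c]) - lie_bracket A (op1 P b) (field_apply Z [a, c])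
        + lie_bracket A (op1 P c) (field_apply Z [a, b]))"
    by (simp add: hom_bracket_eval_def sum_unshuffles[unfolded One_nat_def numeral_2_eq_2] sign_perms[unfolded One_nat_def numeral_2_eq_2]
        fun_eq_iff Transposition.transpose_def upt_rec numeral_2_eq_2)
  also have "\<dots> = rep.br12 (op1 P) S a b c"
  proof -
    \<comment> \<open>The only value occurring against the cyclic order is S a c. It is written as a
      difference because the operators are known to respect differences.\<close>
    have ac: "S a c = 0 - S c a" using S(2)[of c a] s by simp
    have "op1 P (Lop A (0 - S c a) b) = 0 - op1 P (Lop A (S c a) b)"
    proof -
      have z1: "Lop A 0 b = 0" using rep.L_diff_left[of 0 0 b] s by simp
      have z2: "op1 P 0 = 0" using rep.additive_ops_simps(3)[OF additive, of 0 0] by simp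
      have "Lop A (0 - S c a) b = 0 - Lop A (S c a) b"
        using rep.L_diff_left[of 0 "S c a" b] S(1) s z1 by simp
      then show ?thesis
        using rep.additive_ops_simps(3)[OF additive, of 0 "Lop A (S c a) b"] S(1) s z2 by simp
    qed
    moreover have "lie_bracket A (op1 P b) (0 - S c a) = 0 - lie_bracket A (op1 P b) (S c a)"
    proof -
      have "rep.lie (op1 P b) 0 = 0" using rep.lie_simps(4)[of "op1 P b" "op1 P b" 0] 
        by (metis Pc rep.lie_simps(4) s(2) section_zero diff_self)
      then show ?thesis using Pc s S(1) rep.lie_simps(4)[of 0 "S c a" "op1 P b"] by (simp add: lie_bracket_rep)
    qed
    ultimately show ?thesis
      using s Pc by (simp add: Z ac rep.br12_def rep.br12_term_def lie_bracket_rep algebra_simps)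
  qed
  finally show ?thesis .
qed

end

context vbundle
begin

section \<open>Linear operations on tensor fields and their images under \<open>Psi\<close>\<close>

lemma wedge_combination:
  assumes "\<phi> \<in> wedge k" "\<psi> \<in> wedge k"
  shows "(\<lambda>p cs. a * \<phi> p cs + b * \<psi> p cs) \<in> wedge k"
proof -
  let ?\<chi> = "\<lambda>p cs. a * \<phi> p cs + b * \<psi> p cs"
  have "multilinear (dfib p) (k + 1) (?\<chi> p)" for p
    using wedge_multilinear[OF assms(1), of p] wedge_multilinear[OF assms(2), of p]
    unfolding multilinear_def by (simp add: algebra_simps)
  moreover have "alternating_in_first k (?\<chi> p)" for p
    using wedge_alternating[OF assms(1), of p] wedge_alternating[OF assms(2), of p]
    unfolding alternating_in_first_def by auto
  moreover have "smooth_on U (\<lambda>p. ?\<chi> p (map (\<lambda>j. coframe A \<Phi> j p) js))"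
    if t: "(U, \<Phi>) \<in> trivs A" and js: "length js = k + 1" "set js \<subseteq> {..<rk}" for U \<Phi> js
    by (intro smooth_fun_on_add smooth_fun_on_mult smooth_fun_on_const triv_open[OF t]
        wedge_smooth[OF assms(1) t js] wedge_smooth[OF assms(2) t js])
  ultimately show ?thesis unfolding wedge_tensor_sections_def by blast
qed

lemma wedge_zero: "(\<lambda>p cs. 0) \<in> wedge k"
  unfolding wedge_tensor_sections_def multilinear_def alternating_in_first_def
  by (auto intro: smooth_fun_on_const dest: triv_open)

lemma wedge_scale: "\<phi> \<in> wedge k \<Longrightarrow> (\<lambda>p cs. a * \<phi> p cs) \<in> wedge k"
  using wedge_combination[of \<phi> k \<phi> a 0] by simp

lemma wedge_diff:
  "\<phi> \<in> wedge k \<Longrightarrow> \<psi> \<in> wedge k \<Longrightarrow>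
    (\<lambda>p cs. \<phi> p cs - \<psi> p cs) \<in> wedge k"
  using wedge_combination[of \<phi> k \<psi> 1 "-1"] by simp

lemma wedge_sum:
  "(\<And>i. i \<in> I \<Longrightarrow> \<phi> i \<in> wedge k) \<Longrightarrow>
    (\<lambda>p cs. \<Sum>i\<in>I. \<phi> i p cs) \<in> wedge k"
proof (induction I rule: infinite_finite_induct)
  case (insert i I)
  then show ?case
    using wedge_combination[of "\<phi> i" k "\<lambda>p cs. \<Sum>i\<in>I. \<phi> i p cs" 1 1] by simp
qed (simp_all add: wedge_zero)

lemma Psi_zero: "Psi A k (\<lambda>p cs. 0) = (\<lambda>p cs. 0)"
proof (intro ext)
  fix p cs
  show "Psi A k (\<lambda>p cs. 0) p cs = 0"
  proof (cases "length cs = k \<and> set cs \<subseteq> dfib p")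
    case True
    show ?thesis
      by (rule dual_fibre_separates[OF hom_fibre[OF Psi_hom_section[OF wedge_zero]] fibre_zero])
        (use True in \<open>simp add: Psi_apply[OF wedge_zero] dual_fibre_at_zero\<close>)
  qed (rule Psi_outside)
qed

lemma pairing_Psi:
  assumes "\<phi> \<in> wedge k" "length \<alpha>s = k" "set \<alpha>s \<subseteq> dsec" "\<beta> \<in> dsec"
  shows "pairing \<beta> (field_apply (Psi A k \<phi>) \<alpha>s) = field_apply \<phi> (\<alpha>s @ [\<beta>])"
proof
  fix p
  have "set (map (\<lambda>\<alpha>. \<alpha> p) \<alpha>s) \<subseteq> dfib p" using assms(3) dual_section_fibre by auto
  then show "pairing \<beta> (field_apply (Psi A k \<phi>) \<alpha>s) p = field_apply \<phi> (\<alpha>s @ [\<beta>]) p"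
    using Psi_apply[OF assms(1), of "map (\<lambda>\<alpha>. \<alpha> p) \<alpha>s" p "\<beta> p"] assms(2) dual_section_fibre[OF assms(4)]
    by (simp add: pairing_def field_apply_def)
qed

lemma field_apply_Psi_eqI:
  assumes \<phi>: "\<phi> \<in> wedge k" and \<alpha>s: "length \<alpha>s = k" "set \<alpha>s \<subseteq> dsec"
    and x: "x \<in> sec" "\<And>\<beta>. \<beta> \<in> dsec \<Longrightarrow> pairing \<beta> x = field_apply \<phi> (\<alpha>s @ [\<beta>])"
  shows "field_apply (Psi A k \<phi>) \<alpha>s = x"
proof
  fix p
  show "field_apply (Psi A k \<phi>) \<alpha>s p = x p"
  proof (rule dual_fibre_separates)
    show "field_apply (Psi A k \<phi>) \<alpha>s p \<in> fibre A p"
      using hom_fibre[OF Psi_hom_section[OF \<phi>]] by (simp add: field_apply_def)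
    show "x p \<in> fibre A p" by (rule section_fibre[OF x(1)])
    fix \<eta> assume "\<eta> \<in> dfib p"
    then obtain \<beta> where \<beta>: "\<beta> \<in> dsec" "\<beta> p = \<eta>" using dual_section_extension by blast
    have "pairing \<beta> (field_apply (Psi A k \<phi>) \<alpha>s) = pairing \<beta> x"
      using pairing_Psi[OF \<phi> \<alpha>s \<beta>(1)] x(2)[OF \<beta>(1)] by simp
    from fun_cong[OF this, of p] show "\<eta> (field_apply (Psi A k \<phi>) \<alpha>s p) = \<eta> (x p)"
      using \<beta>(2) by (simp add: pairing_def)
  qed
qed

text \<open>Identifies the operator in the definition of [H, H] with the arity-one cochain that
  enters the graded bracket.\<close>

lemma sharp_eq:
  assumes "\<alpha> \<in> dsec"
  shows "sharp A H \<alpha> = field_apply (Psi A 1 H) [\<alpha>]"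
  using dual_section_fibre[OF assms] by (simp add: sharp_def field_apply_def Psi_def)

end

context lsa
begin

text \<open>Every evaluation of \<open>hom_bracket\<close> goes through this rule: a field with the
  required values has to be exhibited, and uniqueness is \<open>hom_section_eqI\<close>.\<close>

lemma hom_bracket_eqI:
  assumes R: "R \<in> homs (m + n)"
    and eq: "\<And>\<alpha>s. length \<alpha>s = m + n \<Longrightarrow> set \<alpha>s \<subseteq> dsec \<Longrightarrow>
      field_apply R \<alpha>s = hom_bracket_eval A n P m Q \<alpha>s"
  shows "hom_bracket A n P m Q = R"
  unfolding hom_bracket_def
proof (rule the_equality)
  fix S assume "S \<in> homs (m + n) \<and> (\<forall>\<alpha>s. length \<alpha>s = m + n \<and> set \<alpha>s \<subseteq> dsec \<longrightarrow>
      field_apply S \<alpha>s = hom_bracket_eval A n P m Q \<alpha>s)"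
  then show "S = R" using hom_section_eqI[of S "m + n" R] R eq by simp
qed (simp add: R eq)

text \<open>Tensoriality of the bracket. The derivative of f along Q \<beta> arises in P (L (Q
  \<beta>) (f \<alpha>)) and in the bracket of P (f \<alpha>) with Q \<beta>, and the two
  contributions cancel; likewise with P and Q exchanged.\<close>

lemma br11_smul:
  assumes P: "P \<in> homs 1" and Q: "Q \<in> homs 1"
    and s: "\<alpha> \<in> dsec" "\<beta> \<in> dsec" and f: "f \<in> smfuns"
  shows "rep.br11 (op1 P) (op1 Q) (dsmul f \<alpha>) \<beta> = smul f (rep.br11 (op1 P) (op1 Q) \<alpha> \<beta>)"
proof -
  note add = rep.additive_ops_simps[OF op1_additive[OF P]] rep.additive_ops_simps[OF op1_additive[OF Q]]
  show ?thesis
    using s f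
    by (simp add: rep.br11_def rep.lie_def add hom_apply_smul[OF P] hom_apply_smul[OF Q] Lop_smul_left Lop_smul_right
        smul_add_right smul_diff_right)
qed

lemma hom_bracket_11:
  assumes P: "P \<in> homs 1" and Q: "Q \<in> homs 1"
  shows "hom_bracket A 1 P 1 Q \<in> homs 2"
    and "\<alpha> \<in> dsec \<Longrightarrow> \<beta> \<in> dsec \<Longrightarrow>
      field_apply (hom_bracket A 1 P 1 Q) [\<alpha>, \<beta>] = rep.br11 (op1 P) (op1 Q) \<alpha> \<beta>"
proof -
  note ops = op1_additive[OF P] op1_additive[OF Q]
  have "\<exists>R\<in>homs 2. \<forall>\<alpha>\<in>dsec. \<forall>\<beta>\<in>dsec.
      field_apply R [\<alpha>, \<beta>] = rep.br11 (op1 P) (op1 Q) \<alpha> \<beta>"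
    by (rule hom_section_of_map2)
      (rule rep.br11_closed[OF ops] rep.br11_add_arg(1)[OF ops] br11_smul[OF P Q] rep.br11_skew[OF ops]; assumption)+
  then obtain R where R: "R \<in> homs 2"
    "\<And>\<alpha> \<beta>. \<alpha> \<in> dsec \<Longrightarrow> \<beta> \<in> dsec \<Longrightarrow> field_apply R [\<alpha>, \<beta>] = rep.br11 (op1 P) (op1 Q) \<alpha> \<beta>"
    by blast
  have "hom_bracket A 1 P 1 Q = R"
  proof (rule hom_bracket_eqI)
    fix \<alpha>s :: "('m \<Rightarrow> 'v \<Rightarrow> real) list" assume "length \<alpha>s = 1 + 1" "set \<alpha>s \<subseteq> dsec"
    then obtain \<alpha> \<beta> where "\<alpha>s = [\<alpha>, \<beta>]" "\<alpha> \<in> dsec" "\<beta> \<in> dsec"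
      by (auto simp: length_Suc_conv)
    then show "field_apply R \<alpha>s = hom_bracket_eval A 1 P 1 Q \<alpha>s"
      using R(2) hom_bracket_eval_11[OF P Q] by simp
  qed (use R(1) in \<open>simp add: numeral_2_eq_2\<close>)
  then show "hom_bracket A 1 P 1 Q \<in> homs 2"
    "\<alpha> \<in> dsec \<Longrightarrow> \<beta> \<in> dsec \<Longrightarrow>
      field_apply (hom_bracket A 1 P 1 Q) [\<alpha>, \<beta>] = rep.br11 (op1 P) (op1 Q) \<alpha> \<beta>"
    using R by simp_all
qed

definition shp :: "('m, 'v) tensor_field \<Rightarrow> ('m \<Rightarrow> 'v \<Rightarrow> real) \<Rightarrow> 'm \<Rightarrow> 'v" where
  "shp \<phi> = op1 (Psi A 1 \<phi>)"

lemma shp_additive: "\<phi> \<in> wedge 1 \<Longrightarrow> shp \<phi> \<in> rep.additive_ops"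
  unfolding shp_def by (rule op1_additive[OF Psi_hom_section])

lemma shp_closed: "\<phi> \<in> wedge 1 \<Longrightarrow> \<alpha> \<in> dsec \<Longrightarrow> shp \<phi> \<alpha> \<in> sec"
  by (rule rep.additive_ops_simps(1)[OF shp_additive])

lemma pairing_shp:
  "\<phi> \<in> wedge 1 \<Longrightarrow> \<alpha> \<in> dsec \<Longrightarrow> \<beta> \<in> dsec \<Longrightarrow>
    pairing \<beta> (shp \<phi> \<alpha>) = field_apply \<phi> [\<alpha>, \<beta>]"
  using pairing_Psi[of \<phi> 1 "[\<alpha>]" \<beta>] by (simp add: shp_def)

lemma KV_bracket_22:
  assumes \<phi>: "\<phi> \<in> wedge 1" and \<psi>: "\<psi> \<in> wedge 1"
  shows "KV_bracket A 2 \<phi> 2 \<psi> \<in> wedge 2"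
    and "a \<in> dsec \<Longrightarrow> b \<in> dsec \<Longrightarrow> c \<in> dsec \<Longrightarrow>
      field_apply (KV_bracket A 2 \<phi> 2 \<psi>) [a, b, c] = pairing c (rep.br11 (shp \<phi>) (shp \<psi>) a b)"
proof -
  note h = hom_bracket_11[OF Psi_hom_section[OF \<phi>] Psi_hom_section[OF \<psi>], folded shp_def]
  let ?R = "hom_bracket A 1 (Psi A 1 \<phi>) 1 (Psi A 1 \<psi>)"
  have KV: "KV_bracket A 2 \<phi> 2 \<psi> = the_inv_into (wedge 2) (Psi A 2) ?R"
    by (simp add: KV_bracket_def KV_cochains_def)
  obtain B where B: "B \<in> wedge 2" "Psi A 2 B = ?R" using Psi_surj[OF h(1)] by blast
  then have KV_B: "KV_bracket A 2 \<phi> 2 \<psi> = B" using the_inv_into_f_f[OF Psi_inj B(1)] KV by simp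
  then show "KV_bracket A 2 \<phi> 2 \<psi> \<in> wedge 2" using B by simp
  assume s: "a \<in> dsec" "b \<in> dsec" "c \<in> dsec"
  then show "field_apply (KV_bracket A 2 \<phi> 2 \<psi>) [a, b, c] = pairing c (rep.br11 (shp \<phi>) (shp \<psi>) a b)"
    using pairing_Psi[OF B(1), of "[a, b]" c] h(2)[OF s(1,2)] B(2) KV_B by simp
qed

text \<open>The vanishing of a bracket in arity three needs no \<open>C\<^sup>\<infinity>\<close>-trilinearity: the zero field
  satisfies the defining property.\<close>

lemma KV_bracket_23_zero:
  assumes H: "H \<in> wedge 1"
    and Z: "\<And>\<alpha> \<beta>. \<alpha> \<in> dsec \<Longrightarrow> \<beta> \<in> dsec \<Longrightarrow> field_apply (Psi A 2 \<phi>) [\<alpha>, \<beta>] = S \<alpha> \<beta>"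
    and S: "\<And>\<alpha> \<beta>. \<alpha> \<in> dsec \<Longrightarrow> \<beta> \<in> dsec \<Longrightarrow> S \<alpha> \<beta> \<in> sec"
      "\<And>\<alpha> \<beta>. \<alpha> \<in> dsec \<Longrightarrow> \<beta> \<in> dsec \<Longrightarrow> S \<beta> \<alpha> = - S \<alpha> \<beta>"
    and zero: "\<And>a b c. a \<in> dsec \<Longrightarrow> b \<in> dsec \<Longrightarrow> c \<in> dsec \<Longrightarrow>
      rep.br12 (shp H) S a b c = 0"
  shows "KV_bracket A 2 H 3 \<phi> = (\<lambda>p cs. 0)"
proof -
  have "hom_bracket A 1 (Psi A 1 H) 2 (Psi A 2 \<phi>) = (\<lambda>p cs. 0)"
  proof (rule hom_bracket_eqI)
    show "(\<lambda>p cs. 0) \<in> homs (2 + 1)"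
      using Psi_hom_section[OF wedge_zero] by (simp only: Psi_zero)
    fix \<alpha>s :: "('m \<Rightarrow> 'v \<Rightarrow> real) list" assume "length \<alpha>s = 2 + 1" "set \<alpha>s \<subseteq> dsec"
    then obtain a b c where s: "\<alpha>s = [a, b, c]" "a \<in> dsec" "b \<in> dsec" "c \<in> dsec"
      by (auto simp: length_Suc_conv numeral_2_eq_2)
    have "hom_bracket_eval A 1 (Psi A 1 H) 2 (Psi A 2 \<phi>) [a, b, c] = rep.br12 (shp H) S a b c"
      unfolding shp_def by (rule hom_bracket_eval_12[OF Psi_hom_section[OF H] Z S s(2-4)])
    then show "field_apply (\<lambda>p cs. 0) \<alpha>s = hom_bracket_eval A 1 (Psi A 1 H) 2 (Psi A 2 \<phi>) \<alpha>s"
      using zero[OF s(2-4)] s(1) by (simp add: field_apply_def fun_eq_iff)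
  qed
  moreover have "the_inv_into (wedge 3) (Psi A 3) (\<lambda>p cs. 0) = (\<lambda>p cs. 0)"
    using the_inv_into_f_f[OF Psi_inj[of 3] wedge_zero] by (simp only: Psi_zero)
  ultimately show ?thesis by (simp add: KV_bracket_def KV_cochains_def)
qed

end

section \<open>The obstruction class\<close>

context lsa
begin

lemma smooth_const [simp]: "(\<lambda>q. a) \<in> smfuns"
  by (simp add: smooth_fun_on_const mem_Collect_eq)

section \<open>Symmetric tensors\<close>

lemma Sym2_wedge: "H \<in> Sym2 A \<Longrightarrow> H \<in> wedge 1"
  by (simp add: Sym2_def mem_Collect_eq)

lemma Sym2_symmetric:
  "H \<in> Sym2 A \<Longrightarrow> \<alpha> \<in> dsec \<Longrightarrow> \<beta> \<in> dsec \<Longrightarrow> pairing \<beta> (shp H \<alpha>) = pairing \<alpha> (shp H \<beta>)"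
  using pairing_shp[OF Sym2_wedge] by (simp add: Sym2_def mem_Collect_eq)

lemma Sym2_zero: "(\<lambda>p cs. 0) \<in> Sym2 A"
  using wedge_zero[of 1] by (simp add: Sym2_def mem_Collect_eq field_apply_def)

lemma Sym2_diff:
  assumes "H \<in> Sym2 A" "K \<in> Sym2 A"
  shows "(\<lambda>p cs. H p cs - K p cs) \<in> Sym2 A"
proof -
  have "field_apply (\<lambda>p cs. H p cs - K p cs) \<alpha>s = field_apply H \<alpha>s - field_apply K \<alpha>s" for \<alpha>s
    by (simp add: field_apply_def fun_eq_iff)
  then show ?thesis using assms wedge_diff[of H 1 K] by (auto simp: Sym2_def mem_Collect_eq)
qed

text \<open>Hence the candidates for the next coefficient are exactly the 2-cochains of the
  subcomplex, for every H.\<close>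

lemma KV_cochains_tilde_2: "KV_cochains_tilde A H 2 = Sym2 A"
  by (simp add: KV_cochains_tilde_def KV_cochains_def Sym2_def)

definition KV_polar where
  "KV_polar P Q a b c =
     anchor_deriv A (P a) (pairing c (Q b)) - anchor_deriv A (P b) (pairing c (Q a))
     + pairing a (star A (P b) (Q c)) - pairing b (star A (P a) (Q c))
     - pairing c (star A (P a) (Q b) - star A (P b) (Q a))"

text \<open>Symmetry of H moves \<open>shp H\<close> from its argument onto c; the definition of L
  then turns pairings with L into the anchor terms and the product terms of the form. The same is
  done for K.\<close>

lemma KV_polar_symmetrized:
  assumes H: "H \<in> Sym2 A" and K: "K \<in> Sym2 A"
    and s: "a \<in> dsec" "b \<in> dsec" "c \<in> dsec"
  shows "KV_polar (shp H) (shp K) a b c + KV_polar (shp K) (shp H) a b c = pairing c (rep.br11 (shp H) (shp K) a b)"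
proof -
  note cl = shp_closed[OF Sym2_wedge[OF H]] shp_closed[OF Sym2_wedge[OF K]]
  have move: "pairing c (shp G \<xi>) = pairing \<xi> (shp G c)" if "G \<in> Sym2 A" "\<xi> \<in> dsec" for G \<xi>
    using Sym2_symmetric[OF that s(3)] .
  show ?thesis
    using s cl
    by (simp add: KV_polar_def rep.br11_def rep.lie_def move[OF H] move[OF K] algebra_simps)
qed

text \<open>The anchor terms cancel in pairs by symmetry of K, and each product paired with a, b or
  c occurs twice with opposite signs. This puts the obstruction into the third space of the
  subcomplex.\<close>

lemma KV_polar_cyclic:
  assumes H: "H \<in> Sym2 A" and K: "K \<in> Sym2 A"
    and s: "a \<in> dsec" "b \<in> dsec" "c \<in> dsec"
  shows "KV_polar (shp H) (shp K) a b c + KV_polar (shp H) (shp K) b c a + KV_polar (shp H) (shp K) c a b = 0"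
  using s shp_closed[OF Sym2_wedge[OF H]] shp_closed[OF Sym2_wedge[OF K]]
  by (simp add: KV_polar_def Sym2_symmetric[OF K s(1,2)] Sym2_symmetric[OF K s(2,3)] Sym2_symmetric[OF K s(3,1)]
      algebra_simps)

lemma pairing_sum:
  "c \<in> dsec \<Longrightarrow> (\<And>i. i \<in> I \<Longrightarrow> x i \<in> sec) \<Longrightarrow> pairing c (\<Sum>i\<in>I. x i) = (\<Sum>i\<in>I. pairing c (x i))"
  by (induction I rule: infinite_finite_induct) (simp_all add: section_sum)

section \<open>Coefficients of the square of a power series\<close>

lemma ps_KV_square_eq:
  assumes H: "\<And>i. Ht i \<in> Sym2 A"
    and s: "a \<in> dsec" "b \<in> dsec" "c \<in> dsec"
  shows "ps_KV_square A Ht a b c k = (\<Sum>i\<le>k. KV_polar (shp (Ht i)) (shp (Ht (k - i))) a b c)"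
proof
  fix p
  note cl = shp_closed[OF Sym2_wedge[OF H]]
  have sh: "sharp A (Ht i) \<alpha> = shp (Ht i) \<alpha>" if "\<alpha> \<in> dsec" for i \<alpha>
    unfolding shp_def by (rule sharp_eq[OF that])
  have star_sum: "pairing \<xi> (\<lambda>p. \<Sum>i\<le>k. star A (shp (Ht i) \<alpha>) (shp (Ht (k - i)) \<beta>) p) p =
      (\<Sum>i\<le>k. pairing \<xi> (star A (shp (Ht i) \<alpha>) (shp (Ht (k - i)) \<beta>)) p)"
    if "\<xi> \<in> dsec" "\<alpha> \<in> dsec" "\<beta> \<in> dsec" for \<xi> \<alpha> \<beta>
    using fun_cong[OF pairing_sum[OF that(1), of "{..k}" "\<lambda>i. star A (shp (Ht i) \<alpha>) (shp (Ht (k - i)) \<beta>)"], of p]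
      cl that by (simp add: pairing_def)
  have star_sum': "pairing c (\<lambda>p. (\<Sum>i\<le>k. star A (shp (Ht i) a) (shp (Ht (k - i)) b) p)
        - (\<Sum>i\<le>k. star A (shp (Ht i) b) (shp (Ht (k - i)) a) p)) p =
      (\<Sum>i\<le>k. pairing c (star A (shp (Ht i) a) (shp (Ht (k - i)) b) - star A (shp (Ht i) b) (shp (Ht (k - i)) a)) p)"
    using fun_cong[OF pairing_sum[OF s(3), of "{..k}"
        "\<lambda>i. star A (shp (Ht i) a) (shp (Ht (k - i)) b) - star A (shp (Ht i) b) (shp (Ht (k - i)) a)"], of p]
      cl s by (simp add: pairing_def[of c] sum_subtractf)
  show "ps_KV_square A Ht a b c k p = (\<Sum>i\<le>k. KV_polar (shp (Ht i)) (shp (Ht (k - i))) a b c) p"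
    by (simp add: ps_KV_square_def ps_anchor_deriv_def ps_pairing_def ps_star_def ps_lie_bracket_def ps_sharp_def
        sh s star_sum star_sum' KV_polar_def sum.distrib sum_subtractf del: pairing_diff)
qed

text \<open>Cancels the factors two inherited from the scalar-free algebra.\<close>

lemma fun_double_zero: "x + x = 0 \<longleftrightarrow> x = 0" for x :: "'a \<Rightarrow> 'w::real_vector"
proof
  assume "x + x = 0"
  then have "2 *\<^sub>R x p = 0" for p by (metis plus_fun_apply scaleR_2 zero_fun_apply)
  then show "x = 0" by (simp add: fun_eq_iff)
qed simp

lemma ps_KV_square_zero_iff:
  assumes H: "\<And>i. Ht i \<in> Sym2 A"
  shows "(\<forall>a\<in>dsec. \<forall>b\<in>dsec. \<forall>c\<in>dsec. ps_KV_square A Ht a b c k = (\<lambda>p. 0)) \<longleftrightarrow>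
    (\<forall>a\<in>dsec. \<forall>b\<in>dsec. (\<Sum>i\<le>k. rep.br11 (shp (Ht i)) (shp (Ht (k - i))) a b) = 0)"
proof -
  note ops = shp_additive[OF Sym2_wedge[OF H]]
  have cl: "(\<Sum>i\<le>k. rep.br11 (shp (Ht i)) (shp (Ht (k - i))) a b) \<in> sec"
    if "a \<in> dsec" "b \<in> dsec" for a b
    using that by (intro section_sum rep.br11_closed ops)
  have eq: "pairing c (\<Sum>i\<le>k. rep.br11 (shp (Ht i)) (shp (Ht (k - i))) a b) =
      ps_KV_square A Ht a b c k + ps_KV_square A Ht a b c k"
    if s: "a \<in> dsec" "b \<in> dsec" "c \<in> dsec" for a b c
  proof -
    \<comment> \<open>Reflecting i to k - i symmetrises the convolution, so that
      \<open>KV_polar_symmetrized\<close> applies to each summand; hence the doubled square.\<close>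
    have "(\<Sum>i\<le>k. KV_polar (shp (Ht (k - i))) (shp (Ht i)) a b c) =
        (\<Sum>i\<le>k. KV_polar (shp (Ht i)) (shp (Ht (k - i))) a b c)"
      by (rule sum.reindex_bij_witness[of _ "\<lambda>i. k - i" "\<lambda>i. k - i"]) auto
    moreover have "pairing c (\<Sum>i\<le>k. rep.br11 (shp (Ht i)) (shp (Ht (k - i))) a b) =
        (\<Sum>i\<le>k. KV_polar (shp (Ht i)) (shp (Ht (k - i))) a b c + KV_polar (shp (Ht (k - i))) (shp (Ht i)) a b c)"
      using s by (subst pairing_sum) (auto intro!: rep.br11_closed ops simp: KV_polar_symmetrized[OF H H s])
    ultimately show ?thesis by (simp add: ps_KV_square_eq[OF H s] sum.distrib)
  qed
  have z: "(\<lambda>p. 0) = (0 :: 'm \<Rightarrow> real)" by (simp add: zero_fun_def)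
  show ?thesis
  proof (intro iffI ballI)
    fix a b assume l: "\<forall>a\<in>dsec. \<forall>b\<in>dsec. \<forall>c\<in>dsec. ps_KV_square A Ht a b c k = (\<lambda>p. 0)"
      and s: "a \<in> dsec" "b \<in> dsec"
    show "(\<Sum>i\<le>k. rep.br11 (shp (Ht i)) (shp (Ht (k - i))) a b) = 0"
      by (rule section_eqI[OF cl[OF s] section_zero]) (use l s in \<open>simp add: eq z\<close>)
  next
    fix a b c assume r: "\<forall>a\<in>dsec. \<forall>b\<in>dsec. (\<Sum>i\<le>k. rep.br11 (shp (Ht i)) (shp (Ht (k - i))) a b) = 0"
      and s: "a \<in> dsec" "b \<in> dsec" "c \<in> dsec"
    have "ps_KV_square A Ht a b c k + ps_KV_square A Ht a b c k = 0"
      using eq[OF s] r s by simp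
    then have "ps_KV_square A Ht a b c k = 0" by (simp only: fun_double_zero)
    then show "ps_KV_square A Ht a b c k = (\<lambda>p. 0)" using z by simp
  qed
qed

section \<open>The Jacobi identity summed over an order\<close>

lemma br12_zero: "P \<in> rep.additive_ops \<Longrightarrow> a \<in> dsec \<Longrightarrow> b \<in> dsec \<Longrightarrow> c \<in> dsec \<Longrightarrow>
    rep.br12 P (\<lambda>a b. 0) a b c = 0"
  using rep.br12_add_right[of P a b c "\<lambda>a b. 0" "\<lambda>a b. 0" "\<lambda>a b. 0"] by simp

lemma br12_sum:
  assumes P: "P \<in> rep.additive_ops" and s: "a \<in> dsec" "b \<in> dsec" "c \<in> dsec"
    and S: "\<And>i a b. i \<in> I \<Longrightarrow> a \<in> dsec \<Longrightarrow> b \<in> dsec \<Longrightarrow> S i a b \<in> sec"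
  shows "rep.br12 P (\<lambda>a b. \<Sum>i\<in>I. S i a b) a b c = (\<Sum>i\<in>I. rep.br12 P (S i) a b c)"
  using S
proof (induction I rule: infinite_finite_induct)
  case (insert i I)
  have "rep.br12 P (\<lambda>a b. \<Sum>i\<in>insert i I. S i a b) a b c =
      rep.br12 P (S i) a b c + rep.br12 P (\<lambda>a b. \<Sum>i\<in>I. S i a b) a b c"
    by (rule rep.br12_add_right[OF P s]) (use insert in \<open>auto intro: section_sum\<close>)
  also have "rep.br12 P (\<lambda>a b. \<Sum>i\<in>I. S i a b) a b c = (\<Sum>i\<in>I. rep.br12 P (S i) a b c)"
    by (rule insert.IH) (rule insert.prems, simp)
  also have "rep.br12 P (S i) a b c + \<dots> = (\<Sum>i\<in>insert i I. rep.br12 P (S i) a b c)"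
    by (rule sum.insert[OF insert.hyps, symmetric])
  finally show ?case .
qed (simp_all add: br12_zero[OF P s] del: sum_fun_apply)

text \<open>Summing the Jacobi identity over all triples with \<open>i + j + l = n + 1\<close>, only the terms with
  \<open>i = 0\<close> survive, because \<open>[H\<^sub>t, H\<^sub>t]\<close> vanishes up to order \<open>n\<close>.\<close>

lemma obstruction_br12_zero:
  fixes n :: nat
  assumes ops: "\<And>i. i \<le> n \<Longrightarrow> h i \<in> rep.additive_ops"
    and vanish: "\<And>k a b. k \<le> n \<Longrightarrow> a \<in> dsec \<Longrightarrow> b \<in> dsec \<Longrightarrow>
      (\<Sum>i\<le>k. rep.br11 (h i) (h (k - i)) a b) = 0"
    and s: "a \<in> dsec" "b \<in> dsec" "c \<in> dsec"
  shows "rep.br12 (h 0) (\<lambda>a b. \<Sum>(i,j)\<in>{(i,j). i + j = n + 1 \<and> 1 \<le> i \<and> 1 \<le> j}. rep.br11 (h i) (h j) a b) a b c = 0"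
proof -
  define T where "T = (\<lambda>(i,j,l). rep.br12 (h i) (rep.br11 (h j) (h l)) a b c)"
  \<comment> \<open>The bound n on each index is needed because \<open>h\<close> is controlled only
    up to n. It removes exactly the triples with an entry n + 1 and is invariant under cyclic
    rotation.\<close>
  define N where "N = {(i,j,l). i + j + l = n + 1 \<and> i \<le> n \<and> j \<le> n \<and> l \<le> n}"
  have finN: "finite N" by (rule finite_subset[of _ "{..n} \<times> {..n} \<times> {..n}"]) (auto simp: N_def mem_Collect_eq)
  define X where "X = sum T N"
  have rot: "(\<Sum>(i,j,l)\<in>N. T (j,l,i)) = X" "(\<Sum>(i,j,l)\<in>N. T (l,i,j)) = X"
    unfolding X_def
    by (rule sum.reindex_bij_witness[of _ "\<lambda>(i,j,l). (l,i,j)" "\<lambda>(i,j,l). (j,l,i)"]; auto simp: N_def mem_Collect_eq)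
      (rule sum.reindex_bij_witness[of _ "\<lambda>(i,j,l). (j,l,i)" "\<lambda>(i,j,l). (l,i,j)"]; auto simp: N_def mem_Collect_eq)
  \<comment> \<open>The three rotated sums agree, so the doubled Jacobi identity yields 6 X = 0; the
    2 is cancelled by \<open>fun_double_zero\<close> and the 3 pointwise.\<close>
  have "(X + X + X) + (X + X + X) = (\<Sum>(i,j,l)\<in>N. (T (i,j,l) + T (j,l,i) + T (l,i,j)) + (T (i,j,l) + T (j,l,i) + T (l,i,j)))"
    using rot X_def by (simp add: case_prod_unfold sum.distrib)
  also have "\<dots> = 0"
  proof (rule sum.neutral, clarify)
    fix i j l assume "(i, j, l) \<in> N"
    then show "(T (i,j,l) + T (j,l,i) + T (l,i,j)) + (T (i,j,l) + T (j,l,i) + T (l,i,j)) = 0"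
      unfolding T_def prod.case
      using ops s by (intro rep.br12_Jacobi) (auto simp: N_def mem_Collect_eq)
  qed
  finally have "(X + X + X) + (X + X + X) = 0" .
  then have X3: "X + X + X = 0" by (simp only: fun_double_zero)
  have X: "X = 0"
  proof
    fix p
    have "3 *\<^sub>R X p = X p + X p + X p" by (simp add: scaleR_left_distrib[of 2 1, simplified] scaleR_2)
    also have "\<dots> = 0" using fun_cong[OF X3, of p] by simp
    finally show "X p = 0 p" by simp
  qed
  let ?I = "\<lambda>i. {(j,l). j + l = n + 1 - i \<and> j \<le> n \<and> l \<le> n}"
  have finI: "finite (?I i)" for i by (rule finite_subset[of _ "{..n} \<times> {..n}"]) (auto simp: mem_Collect_eq)
  have inner: "(\<Sum>(j,l)\<in>?I i. T (i,j,l)) = rep.br12 (h i) (\<lambda>a b. \<Sum>(j,l)\<in>?I i. rep.br11 (h j) (h l) a b) a b c"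
    if "i \<le> n" for i
    unfolding T_def case_prod_unfold prod.sel
    by (rule br12_sum[OF ops[OF that] s, symmetric]) (auto intro!: rep.br11_closed ops simp: mem_Collect_eq)
  have "X = (\<Sum>i\<le>n. \<Sum>(j,l)\<in>?I i. T (i,j,l))"
  proof -
    have "N = Sigma {..n} ?I" by (auto simp: N_def mem_Collect_eq)
    then have "X = (\<Sum>(i,y)\<in>Sigma {..n} ?I. case y of (j,l) \<Rightarrow> T (i,j,l))"
      unfolding X_def by (intro sum.cong) auto
    also have "\<dots> = (\<Sum>i\<le>n. \<Sum>(j,l)\<in>?I i. T (i,j,l))"
      by (rule sum.Sigma[symmetric]) (auto simp only: finI finite_atMost)
    finally show ?thesis .
  qed
  \<comment> \<open>For i at least 1 the remaining indices sum to at most n, so the slice is a full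
    coefficient of the square and vanishes.\<close>
  also have "\<dots> = (\<Sum>(j,l)\<in>?I 0. T (0,j,l)) + (\<Sum>i\<in>{1..n}. \<Sum>(j,l)\<in>?I i. T (i,j,l))"
    by (subst atMost_atLeast0) (simp add: sum.atLeast_Suc_atMost)
  also have "(\<Sum>i\<in>{1..n}. \<Sum>(j,l)\<in>?I i. T (i,j,l)) = 0"
  proof (rule sum.neutral, rule ballI)
    fix i assume i: "i \<in> {1..n}"
    have v: "(\<Sum>(j,l)\<in>?I i. rep.br11 (h j) (h l) a b) = 0"
      if "a \<in> dsec" "b \<in> dsec" for a b
    proof -
      define m where "m = n + 1 - i"
      have m: "m \<le> n" using i by (auto simp: m_def)
      have "(\<Sum>(j,l)\<in>?I i. rep.br11 (h j) (h l) a b) = (\<Sum>j\<le>m. rep.br11 (h j) (h (m - j)) a b)"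
        unfolding m_def[symmetric]
        by (rule sum.reindex_bij_witness[of _ "\<lambda>j. (j, m - j)" fst]) (use m in \<open>auto simp: mem_Collect_eq\<close>)
      also have "\<dots> = 0" by (rule vanish[OF m that])
      finally show ?thesis .
    qed
    have "i \<le> n" using i by simp
    have "(\<Sum>(j,l)\<in>?I i. T (i,j,l)) = rep.br12 (h i) (\<lambda>a b. \<Sum>(j,l)\<in>?I i. rep.br11 (h j) (h l) a b) a b c"
      by (rule inner) fact
    also have "\<dots> = rep.br12 (h i) (\<lambda>a b. 0) a b c"
      by (rule rep.br12_cong[OF ops[OF \<open>i \<le> n\<close>] s]) (rule v)
    also have "\<dots> = 0" by (rule br12_zero[OF ops[OF \<open>i \<le> n\<close>] s])
    finally show "(\<Sum>(j,l)\<in>?I i. T (i,j,l)) = 0" .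
  qed
  finally have "X = (\<Sum>(j,l)\<in>?I 0. T (0,j,l)) + 0" .
  from trans[OF sym[OF trans[OF this add_0_right]] X]
  have "(\<Sum>(j,l)\<in>?I 0. T (0,j,l)) = 0" .
  \<comment> \<open>If j + l = n + 1, both indices are at most n exactly when both are at least
    1.\<close>
  moreover have "?I 0 = {(i,j). i + j = n + 1 \<and> 1 \<le> i \<and> 1 \<le> j}" by auto
  ultimately show ?thesis using inner[of 0] by simp
qed

end

locale kv_deformation = lsa A
  for A :: "('m::{t2_space,second_countable_topology}, 'v::real_vector, 'z) algebroid_scheme" +
  fixes H :: "('m, 'v) tensor_field" and n :: nat and Hs :: "nat \<Rightarrow> ('m, 'v) tensor_field"
  assumes KV_H: "KV_structure A H" and order_deformation: "order_deformation A H n Hs"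
begin

section \<open>The obstruction cocycle of a deformation\<close>

lemma H_Sym2: "H \<in> Sym2 A"
  using KV_H by (simp add: KV_structure_def)

lemma Hs_0: "Hs 0 = H" and Hs_Sym2: "i \<le> n \<Longrightarrow> Hs i \<in> Sym2 A"
  using order_deformation by (auto simp: order_deformation_def)

definition h where "h i = shp (Hs i)"

lemma h_additive: "i \<le> n \<Longrightarrow> h i \<in> rep.additive_ops"
  unfolding h_def by (intro shp_additive Sym2_wedge Hs_Sym2)

lemma ps_truncate_Sym2: "(\<And>i. i \<le> k \<Longrightarrow> Ks i \<in> Sym2 A) \<Longrightarrow> ps_truncate k Ks i \<in> Sym2 A"
  by (simp add: ps_truncate_def Sym2_zero)

lemma coefficient_vanishes:
  assumes "k \<le> n" "a \<in> dsec" "b \<in> dsec"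
  shows "(\<Sum>i\<le>k. rep.br11 (h i) (h (k - i)) a b) = 0"
proof -
  have "\<forall>a\<in>dsec. \<forall>b\<in>dsec. \<forall>c\<in>dsec.
      ps_KV_square A (ps_truncate n Hs) a b c k = (\<lambda>p. 0)"
    using order_deformation assms(1) by (simp add: order_deformation_def)
  then have "(\<Sum>i\<le>k. rep.br11 (shp (ps_truncate n Hs i)) (shp (ps_truncate n Hs (k - i))) a b) = 0"
    using ps_KV_square_zero_iff[of "ps_truncate n Hs" k, OF ps_truncate_Sym2[OF Hs_Sym2]] assms(2,3) by blast
  \<comment> \<open>Truncation at n does not affect coefficients of order at most n.\<close>
  moreover have "(\<Sum>i\<le>k. rep.br11 (shp (ps_truncate n Hs i)) (shp (ps_truncate n Hs (k - i))) a b) =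
      (\<Sum>i\<le>k. rep.br11 (h i) (h (k - i)) a b)"
    by (rule sum.cong) (use assms(1) in \<open>auto simp: ps_truncate_def h_def\<close>)
  ultimately show ?thesis by simp
qed

definition index_pairs :: "(nat \<times> nat) set" where
  "index_pairs = {(i,j). i + j = n + 1 \<and> 1 \<le> i \<and> 1 \<le> j}"

lemma index_pairsD: "(i, j) \<in> index_pairs \<Longrightarrow> i \<le> n" "(i, j) \<in> index_pairs \<Longrightarrow> j \<le> n"
  by (auto simp: index_pairs_def mem_Collect_eq)

definition obstruction :: "('m, 'v) tensor_field" where
  "obstruction = (\<lambda>p cs. 1 / 2 * (\<Sum>(i,j)\<in>index_pairs. KV_bracket A 2 (Hs i) 2 (Hs j) p cs))"

definition W where "W a b = (\<Sum>(i,j)\<in>index_pairs. rep.br11 (h i) (h j) a b)"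

lemma W_closed [simp]: "a \<in> dsec \<Longrightarrow> b \<in> dsec \<Longrightarrow> W a b \<in> sec"
  unfolding W_def case_prod_unfold
  by (rule section_sum) (auto intro!: rep.br11_closed h_additive dest: index_pairsD)

lemma W_skew:
  assumes "a \<in> dsec" "b \<in> dsec"
  shows "W b a = - W a b"
proof -
  have "W b a = (\<Sum>(i,j)\<in>index_pairs. - rep.br11 (h i) (h j) a b)"
    unfolding W_def
    by (intro sum.cong refl) (use assms in \<open>auto intro!: rep.br11_skew h_additive dest: index_pairsD\<close>)
  then show ?thesis by (simp add: W_def sum_negf case_prod_unfold)
qed

lemma obstruction_wedge: "obstruction \<in> wedge 2"
  unfolding obstruction_def case_prod_unfold
  by (intro wedge_scale wedge_sum KV_bracket_22 Sym2_wedge Hs_Sym2) (auto dest: index_pairsD)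

lemma obstruction_apply:
  assumes s: "a \<in> dsec" "b \<in> dsec" "c \<in> dsec"
  shows "field_apply obstruction [a, b, c] = (\<lambda>p. 1 / 2) * pairing c (W a b)"
proof -
  have "pairing c (W a b) = (\<Sum>x\<in>index_pairs. pairing c (rep.br11 (h (fst x)) (h (snd x)) a b))"
    unfolding W_def case_prod_unfold
    by (rule pairing_sum[OF s(3)]) (auto intro!: rep.br11_closed h_additive s dest: index_pairsD)
  also have "\<dots> = (\<Sum>x\<in>index_pairs. field_apply (KV_bracket A 2 (Hs (fst x)) 2 (Hs (snd x))) [a, b, c])"
    unfolding h_def
    by (intro sum.cong refl KV_bracket_22(2)[symmetric] Sym2_wedge Hs_Sym2 s) (auto dest: index_pairsD)
  finally show ?thesis
    by (simp add: fun_eq_iff field_apply_def obstruction_def case_prod_unfold)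
qed

text \<open>The obstruction as an arity-two cochain. The factor 1/2 is kept out of \<open>W\<close>,
  to which the additive calculus of \<open>br11\<close> and \<open>br12\<close> applies.\<close>

definition Z where "Z a b = smul (\<lambda>p. 1 / 2) (W a b)"

lemma Z_closed: "a \<in> dsec \<Longrightarrow> b \<in> dsec \<Longrightarrow> Z a b \<in> sec"
  and Z_skew: "a \<in> dsec \<Longrightarrow> b \<in> dsec \<Longrightarrow> Z b a = - Z a b"
  and Z_double: "Z a b + Z a b = W a b"
proof -
  show "a \<in> dsec \<Longrightarrow> b \<in> dsec \<Longrightarrow> Z a b \<in> sec"
    by (simp add: Z_def)
  show "a \<in> dsec \<Longrightarrow> b \<in> dsec \<Longrightarrow> Z b a = - Z a b"
    unfolding Z_def by (subst W_skew, assumption+) (simp add: smul_def fun_eq_iff)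
  show "Z a b + Z a b = W a b"
    by (simp add: Z_def smul_def fun_eq_iff scaleR_left_distrib[symmetric])
qed

lemma Psi_obstruction:
  assumes "a \<in> dsec" "b \<in> dsec"
  shows "field_apply (Psi A 2 obstruction) [a, b] = Z a b"
  by (rule field_apply_Psi_eqI[OF obstruction_wedge])
    (use assms in \<open>simp_all add: Z_closed obstruction_apply Z_def\<close>)

lemma KV_delta_obstruction: "KV_delta A H 3 obstruction = (\<lambda>p cs. 0)"
proof -
  have "KV_bracket A 2 H 3 obstruction = (\<lambda>p cs. 0)"
  proof (rule KV_bracket_23_zero[OF Sym2_wedge[OF H_Sym2] Psi_obstruction Z_closed Z_skew])
    fix a b c assume s: "a \<in> dsec" "b \<in> dsec" "c \<in> dsec"
    have H: "h 0 = shp H" by (simp add: h_def Hs_0)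
    have "rep.br12 (h 0) W a b c = 0"
      using obstruction_br12_zero[of n h, OF h_additive coefficient_vanishes s]
      by (simp add: W_def[abs_def] index_pairs_def)
    \<comment> \<open>Additivity together with W = Z + Z takes the place of homogeneity in the
      factor 1/2.\<close>
    moreover have "rep.br12 (h 0) W a b c = rep.br12 (h 0) Z a b c + rep.br12 (h 0) Z a b c"
      by (rule rep.br12_add_right[OF h_additive s]) (simp_all add: Z_closed Z_double)
    ultimately have "rep.br12 (h 0) Z a b c + rep.br12 (h 0) Z a b c = 0" by simp
    then have "rep.br12 (h 0) Z a b c = 0" by (simp only: fun_double_zero)
    then show "rep.br12 (shp H) Z a b c = 0" using H by simp
  qed
  then show ?thesis by (simp add: KV_delta_def)
qed

text \<open>Membership in the third space of the subcomplex: each bracket is a sum of two forms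
  \<open>KV_polar\<close>, whose cyclic sums vanish separately.\<close>

lemma obstruction_cyclic:
  assumes s: "a \<in> dsec" "b \<in> dsec" "c \<in> dsec"
  shows "field_apply obstruction [a, b, c] p + field_apply obstruction [b, c, a] p + field_apply obstruction [c, a, b] p = 0"
proof -
  have cyc: "pairing c (rep.br11 (h i) (h j) a b) + pairing a (rep.br11 (h i) (h j) b c)
      + pairing b (rep.br11 (h i) (h j) c a) = 0" if "i \<le> n" "j \<le> n" for i j
  proof -
    note S = Hs_Sym2[OF that(1)] Hs_Sym2[OF that(2)]
    show ?thesis
      using KV_polar_cyclic[OF S s] KV_polar_cyclic[OF S(2,1) s]
      unfolding h_def KV_polar_symmetrized[OF S s, symmetric] KV_polar_symmetrized[OF S s(2,3,1), symmetric]
        KV_polar_symmetrized[OF S s(3,1,2), symmetric]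
      by (metis (no_types, lifting) add.assoc add.commute add.left_commute add_0)
  qed
  have pair: "pairing c (W a b) = (\<Sum>x\<in>index_pairs. pairing c (rep.br11 (h (fst x)) (h (snd x)) a b))"
    if "a \<in> dsec" "b \<in> dsec" "c \<in> dsec" for a b c
    unfolding W_def case_prod_unfold
    by (rule pairing_sum[OF that(3)]) (auto intro!: rep.br11_closed h_additive that dest: index_pairsD)
  have "pairing c (W a b) + pairing a (W b c) + pairing b (W c a) = 0"
    unfolding pair[OF s] pair[OF s(2,3,1)] pair[OF s(3,1,2)] sum.distrib[symmetric]
    by (rule sum.neutral) (auto intro!: cyc dest: index_pairsD)
  from fun_cong[OF this, of p] show ?thesis
    using s by (simp add: obstruction_apply)
qed

lemma obstruction_cocycle: "obstruction \<in> KV_cocycles_tilde A H 3"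
  using obstruction_wedge obstruction_cyclic KV_delta_obstruction
  by (simp add: KV_cocycles_tilde_def KV_cochains_tilde_def KV_cochains_def mem_Collect_eq)

text \<open>Needed for the class of zero to be an honest cohomology class, with which the class of
  the obstruction is compared.\<close>

lemma zero_cocycle: "(\<lambda>p cs. 0) \<in> KV_cocycles_tilde A H 3"
proof -
  have "KV_bracket A 2 H 3 (\<lambda>p cs. 0) = (\<lambda>p cs. 0)"
    by (rule KV_bracket_23_zero[OF Sym2_wedge[OF H_Sym2], where S = "\<lambda>a b. 0"])
      (simp_all add: Psi_zero field_apply_def fun_eq_iff[of _ 0] br12_zero[OF shp_additive[OF Sym2_wedge[OF H_Sym2]]]
        del: fun_eq_iff)
  then show ?thesis
    using wedge_zero[of 2]
    by (simp add: KV_cocycles_tilde_def KV_cochains_tilde_def KV_cochains_def KV_delta_def mem_Collect_eq field_apply_def)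
qed

text \<open>The minus sign is the factor (-1)^(k - 1) of the differential at k = 2.\<close>

lemma KV_delta_2:
  assumes K: "K \<in> Sym2 A"
  shows "KV_delta A H 2 K \<in> wedge 2"
    and "a \<in> dsec \<Longrightarrow> b \<in> dsec \<Longrightarrow> c \<in> dsec \<Longrightarrow>
      field_apply (KV_delta A H 2 K) [a, b, c] = - pairing c (rep.br11 (shp H) (shp K) a b)"
proof -
  note B = KV_bracket_22[OF Sym2_wedge[OF H_Sym2] Sym2_wedge[OF K]]
  show "KV_delta A H 2 K \<in> wedge 2"
    unfolding KV_delta_def by (rule wedge_scale[OF B(1)])
  show "field_apply (KV_delta A H 2 K) [a, b, c] = - pairing c (rep.br11 (shp H) (shp K) a b)"
    if "a \<in> dsec" "b \<in> dsec" "c \<in> dsec"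
    using B(2)[OF that] by (simp add: fun_eq_iff field_apply_def KV_delta_def)
qed

lemma wedge_2_eqI:
  assumes "\<phi> \<in> wedge 2" "\<psi> \<in> wedge 2"
    and "\<And>a b c. a \<in> dsec \<Longrightarrow> b \<in> dsec \<Longrightarrow> c \<in> dsec \<Longrightarrow>
      field_apply \<phi> [a, b, c] = field_apply \<psi> [a, b, c]"
  shows "\<phi> = \<psi>"
proof (rule wedge_eqI[OF assms(1,2)])
  fix \<alpha>s :: "('m \<Rightarrow> 'v \<Rightarrow> real) list" assume "length \<alpha>s = 2 + 1" "set \<alpha>s \<subseteq> dsec"
  then obtain a b c where "\<alpha>s = [a, b, c]" "a \<in> dsec" "b \<in> dsec" "c \<in> dsec"
    by (auto simp: length_Suc_conv numeral_2_eq_2)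
  then show "field_apply \<phi> \<alpha>s = field_apply \<psi> \<alpha>s" using assms(3) by simp
qed

lemma KV_delta_2_eq_obstruction_iff:
  assumes K: "K \<in> Sym2 A"
  shows "KV_delta A H 2 K = obstruction \<longleftrightarrow>
    (\<forall>a\<in>dsec. \<forall>b\<in>dsec. rep.br11 (shp H) (shp K) a b + Z a b = 0)"
proof -
  note cl = rep.br11_closed[OF shp_additive[OF Sym2_wedge[OF H_Sym2]] shp_additive[OF Sym2_wedge[OF K]]]
  have app: "field_apply obstruction [a, b, c] = pairing c (Z a b)"
    if "a \<in> dsec" "b \<in> dsec" "c \<in> dsec" for a b c
    using that by (simp add: obstruction_apply Z_def)
  show ?thesis
  proof (intro iffI ballI)
    fix a b assume eq: "KV_delta A H 2 K = obstruction" and s: "a \<in> dsec" "b \<in> dsec"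
    show "rep.br11 (shp H) (shp K) a b + Z a b = 0"
    proof (rule section_eqI)
      fix c assume c: "c \<in> dsec"
      show "pairing c (rep.br11 (shp H) (shp K) a b + Z a b) = pairing c 0"
        using KV_delta_2(2)[OF K s c] app[OF s c] eq s c by (simp add: cl Z_closed)
    qed (use s in \<open>simp_all add: cl Z_closed\<close>)
  next
    assume z: "\<forall>a\<in>dsec. \<forall>b\<in>dsec. rep.br11 (shp H) (shp K) a b + Z a b = 0"
    show "KV_delta A H 2 K = obstruction"
    proof (rule wedge_2_eqI[OF KV_delta_2(1)[OF K] obstruction_wedge])
      fix a b c assume s: "a \<in> dsec" "b \<in> dsec" "c \<in> dsec"
      have "pairing c (rep.br11 (shp H) (shp K) a b) + pairing c (Z a b) = 0"
        using arg_cong[where f = "pairing c", OF bspec[OF bspec[OF z s(1)] s(2)]] s by (simp add: cl Z_closed)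
      then show "field_apply (KV_delta A H 2 K) [a, b, c] = field_apply obstruction [a, b, c]"
        using KV_delta_2(2)[OF K s] app[OF s] by (simp add: add_eq_0_iff2)
    qed
  qed
qed

section \<open>The extension equation\<close>

lemma extension_iff:
  assumes K: "K \<in> Sym2 A"
  shows "order_deformation A H (n + 1) (Hs(n + 1 := K)) \<longleftrightarrow> KV_delta A H 2 K = obstruction"
proof -
  let ?Ks = "Hs(n + 1 := K)"
  let ?g = "\<lambda>i. shp (?Ks i)"
  have Ks: "?Ks i \<in> Sym2 A" if "i \<le> n + 1" for i
    using that Hs_Sym2[of i] K by (cases "i = n + 1") auto
  have g: "?g i = h i" if "i \<le> n" for i using that by (simp add: h_def)
  have trunc: "(\<Sum>i\<le>k. rep.br11 (shp (ps_truncate (n + 1) ?Ks i)) (shp (ps_truncate (n + 1) ?Ks (k - i))) a b) =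
      (\<Sum>i\<le>k. rep.br11 (?g i) (?g (k - i)) a b)" if "k \<le> n + 1" for k a b
    by (rule sum.cong) (use that in \<open>auto simp: ps_truncate_def\<close>)
  have low: "(\<Sum>i\<le>k. rep.br11 (?g i) (?g (k - i)) a b) = 0"
    if "k \<le> n" "a \<in> dsec" "b \<in> dsec" for k a b
  proof -
    have "(\<Sum>i\<le>k. rep.br11 (?g i) (?g (k - i)) a b) = (\<Sum>i\<le>k. rep.br11 (h i) (h (k - i)) a b)"
      by (rule sum.cong) (use that(1) g in auto)
    then show ?thesis using coefficient_vanishes[OF that] by simp
  qed
  \<comment> \<open>The indices 0 and n + 1 each contribute the bracket of H and K, by
    commutativity, and the indices between contribute W, which is Z + Z.\<close>
  have top: "(\<Sum>i\<le>n + 1. rep.br11 (?g i) (?g (n + 1 - i)) a b) =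
      (rep.br11 (shp H) (shp K) a b + Z a b) + (rep.br11 (shp H) (shp K) a b + Z a b)" for a b
  proof -
    have split: "(\<Sum>i\<le>n + 1. rep.br11 (?g i) (?g (n + 1 - i)) a b) =
        rep.br11 (?g 0) (?g (n + 1)) a b + (rep.br11 (?g (n + 1)) (?g 0) a b
          + (\<Sum>i\<in>{1..n}. rep.br11 (?g i) (?g (n + 1 - i)) a b))"
    proof -
      have "{..n + 1} = insert 0 (insert (n + 1) {1..n})" by auto
      then show ?thesis by (simp del: fun_upd_apply sum_fun_apply)
    qed
    have mid: "(\<Sum>i\<in>{1..n}. rep.br11 (?g i) (?g (n + 1 - i)) a b) = W a b"
      unfolding W_def
      by (rule sum.reindex_bij_witness[of _ fst "\<lambda>i. (i, n + 1 - i)"])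
        (auto simp: index_pairs_def mem_Collect_eq h_def)
    have ends: "?g 0 = shp H" "?g (n + 1) = shp K" by (simp_all add: Hs_0)
    show ?thesis
      by (rule trans[OF split])
        (simp only: mid ends rep.br11_commute[of "shp K" "shp H"] Z_double[symmetric], simp only: add_ac)
  qed
  have sq: "(\<forall>a\<in>dsec. \<forall>b\<in>dsec. \<forall>c\<in>dsec.
        ps_KV_square A (ps_truncate (n + 1) ?Ks) a b c k = (\<lambda>p. 0)) \<longleftrightarrow>
      (\<forall>a\<in>dsec. \<forall>b\<in>dsec. (\<Sum>i\<le>k. rep.br11 (?g i) (?g (k - i)) a b) = 0)"
    if "k \<le> n + 1" for k
  proof -
    have "ps_truncate (n + 1) ?Ks i \<in> Sym2 A" for i by (rule ps_truncate_Sym2[OF Ks])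
    then show ?thesis by (simp only: ps_KV_square_zero_iff trunc[OF that])
  qed
  have top_only: "(\<forall>k\<le>n + 1. Q k) \<longleftrightarrow> Q (n + 1)" if "\<And>k. k \<le> n \<Longrightarrow> Q k" for Q :: "nat \<Rightarrow> bool"
    using that by (metis Suc_eq_plus1 le_Suc_eq order_refl)
  have "order_deformation A H (n + 1) ?Ks \<longleftrightarrow>
      (\<forall>k\<le>n + 1. \<forall>a\<in>dsec. \<forall>b\<in>dsec. \<forall>c\<in>dsec.
        ps_KV_square A (ps_truncate (n + 1) ?Ks) a b c k = (\<lambda>p. 0))"
    using Ks Hs_0 unfolding order_deformation_def by auto
  also have "\<dots> \<longleftrightarrow> (\<forall>k\<le>n + 1. \<forall>a\<in>dsec. \<forall>b\<in>dsec.
        (\<Sum>i\<le>k. rep.br11 (?g i) (?g (k - i)) a b) = 0)"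
    using sq by blast
  also have "\<dots> \<longleftrightarrow> (\<forall>a\<in>dsec. \<forall>b\<in>dsec.
        (\<Sum>i\<le>n + 1. rep.br11 (?g i) (?g (n + 1 - i)) a b) = 0)"
    by (rule top_only) (use low in blast)
  also have "\<dots> \<longleftrightarrow> KV_delta A H 2 K = obstruction"
    unfolding top fun_double_zero KV_delta_2_eq_obstruction_iff[OF K] ..
  finally show ?thesis .
qed

text \<open>Gives closure of the coboundaries under differences, on which the comparison of classes
  rests. It is derived from additivity of the bracket applied to K = (K - L) + L.\<close>

lemma KV_delta_2_diff:
  assumes K: "K \<in> Sym2 A" and L: "L \<in> Sym2 A"
  shows "KV_delta A H 2 (\<lambda>p cs. K p cs - L p cs) = (\<lambda>p cs. KV_delta A H 2 K p cs - KV_delta A H 2 L p cs)"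
proof (rule wedge_2_eqI[OF KV_delta_2(1)[OF Sym2_diff[OF K L]] wedge_diff[OF KV_delta_2(1)[OF K] KV_delta_2(1)[OF L]]])
  fix a b c assume s: "a \<in> dsec" "b \<in> dsec" "c \<in> dsec"
  note KL = Sym2_diff[OF K L]
  note ops = shp_additive[OF Sym2_wedge[OF H_Sym2]] shp_additive[OF Sym2_wedge[OF K]]
    shp_additive[OF Sym2_wedge[OF L]] shp_additive[OF Sym2_wedge[OF KL]]
  have shp: "shp K \<alpha> = shp (\<lambda>p cs. K p cs - L p cs) \<alpha> + shp L \<alpha>" if \<alpha>: "\<alpha> \<in> dsec" for \<alpha>
  proof (rule section_eqI)
    fix \<beta> assume \<beta>: "\<beta> \<in> dsec"
    show "pairing \<beta> (shp K \<alpha>) = pairing \<beta> (shp (\<lambda>p cs. K p cs - L p cs) \<alpha> + shp L \<alpha>)"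
      using \<alpha> \<beta> shp_closed Sym2_wedge[OF K] Sym2_wedge[OF L] Sym2_wedge[OF KL]
      by (simp add: pairing_shp) (simp add: field_apply_def fun_eq_iff)
  qed (use \<alpha> shp_closed Sym2_wedge[OF K] Sym2_wedge[OF L] Sym2_wedge[OF KL] in auto)
  \<comment> \<open>The two operators are known to agree on dual sections only, so the replacement
    is made in the unfolded bracket, where all arguments are dual sections.\<close>
  have "rep.br11 (shp K) (shp H) a b = rep.br11 (shp (\<lambda>p cs. K p cs - L p cs) + shp L) (shp H) a b"
    using s ops by (simp add: rep.br11_def shp del: rep.additive_ops_simps(3))
  also have "\<dots> = rep.br11 (shp (\<lambda>p cs. K p cs - L p cs)) (shp H) a b + rep.br11 (shp L) (shp H) a b"
    by (rule rep.br11_add_left) (use s ops in simp_all)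
  finally have "pairing c (rep.br11 (shp H) (shp K) a b) =
      pairing c (rep.br11 (shp H) (shp (\<lambda>p cs. K p cs - L p cs)) a b) + pairing c (rep.br11 (shp H) (shp L) a b)"
    using s ops by (simp add: rep.br11_commute[of _ "shp H"])
  then show "field_apply (KV_delta A H 2 (\<lambda>p cs. K p cs - L p cs)) [a, b, c] =
      field_apply (\<lambda>p cs. KV_delta A H 2 K p cs - KV_delta A H 2 L p cs) [a, b, c]"
    using fun_cong[OF KV_delta_2(2)[OF K s]] fun_cong[OF KV_delta_2(2)[OF L s]]
    by (simp add: KV_delta_2(2)[OF KL s] fun_eq_iff) (simp add: field_apply_def)
qed

lemma coboundaries_3: "KV_coboundaries_tilde A H 3 = KV_delta A H 2 ` Sym2 A"
  by (simp add: KV_coboundaries_tilde_def KV_cochains_tilde_2)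

lemma coboundary_diff:
  assumes "\<phi> \<in> KV_coboundaries_tilde A H 3" "\<psi> \<in> KV_coboundaries_tilde A H 3"
  shows "(\<lambda>p cs. \<phi> p cs - \<psi> p cs) \<in> KV_coboundaries_tilde A H 3"
proof -
  obtain K L where "K \<in> Sym2 A" "L \<in> Sym2 A" "\<phi> = KV_delta A H 2 K" "\<psi> = KV_delta A H 2 L"
    using assms unfolding coboundaries_3 by blast
  then show ?thesis
    unfolding coboundaries_3
    by (intro image_eqI[of _ _ "\<lambda>p cs. K p cs - L p cs"]) (simp_all only: KV_delta_2_diff Sym2_diff)
qed

lemma zero_coboundary: "(\<lambda>p cs. 0) \<in> KV_coboundaries_tilde A H 3"
  \<comment> \<open>Zero is written as delta H - delta H.\<close>
  using coboundary_diff[of "KV_delta A H 2 H" "KV_delta A H 2 H"] H_Sym2 unfolding coboundaries_3 by simp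

text \<open>Classes are sets of cocycles. In one direction the obstruction lies in its own class,
  hence in that of zero; in the other the two classes have the same elements, since subtracting a
  coboundary does not change being a coboundary.\<close>

lemma class_trivial_iff:
  "KV_class_tilde A H 3 obstruction = KV_class_tilde A H 3 (\<lambda>p cs. 0) \<longleftrightarrow>
    obstruction \<in> KV_coboundaries_tilde A H 3"
proof
  let ?B = "KV_coboundaries_tilde A H 3"
  assume "KV_class_tilde A H 3 obstruction = KV_class_tilde A H 3 (\<lambda>p cs. 0)"
  moreover have "obstruction \<in> KV_class_tilde A H 3 obstruction"
    using obstruction_cocycle zero_coboundary
    by (simp add: KV_class_tilde_def KV_cohomologous_tilde_def mem_Collect_eq)
  ultimately have "(\<lambda>p cs. 0 - obstruction p cs) \<in> ?B"
    by (simp add: KV_class_tilde_def KV_cohomologous_tilde_def mem_Collect_eq)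
  from coboundary_diff[OF zero_coboundary this] show "obstruction \<in> ?B" by simp
next
  let ?B = "KV_coboundaries_tilde A H 3"
  assume B: "obstruction \<in> ?B"
  have "(\<lambda>p cs. obstruction p cs - \<psi> p cs) \<in> ?B \<longleftrightarrow> (\<lambda>p cs. 0 - \<psi> p cs) \<in> ?B" for \<psi>
  proof
    assume "(\<lambda>p cs. obstruction p cs - \<psi> p cs) \<in> ?B"
    from coboundary_diff[OF this B] show "(\<lambda>p cs. 0 - \<psi> p cs) \<in> ?B" by simp
  next
    assume "(\<lambda>p cs. 0 - \<psi> p cs) \<in> ?B"
    from coboundary_diff[OF B coboundary_diff[OF zero_coboundary this]]
    show "(\<lambda>p cs. obstruction p cs - \<psi> p cs) \<in> ?B" by simp
  qed
  then show "KV_class_tilde A H 3 obstruction = KV_class_tilde A H 3 (\<lambda>p cs. 0)"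
    using obstruction_cocycle zero_cocycle
    by (auto simp: KV_class_tilde_def KV_cohomologous_tilde_def mem_Collect_eq)
qed

lemma extendable_iff:
  "extendable_deformation A H n Hs \<longleftrightarrow> obstruction \<in> KV_coboundaries_tilde A H 3"
proof -
  have "obstruction \<in> KV_delta A H 2 ` Sym2 A \<longleftrightarrow> (\<exists>K\<in>Sym2 A. KV_delta A H 2 K = obstruction)"
    unfolding image_iff by (rule bex_cong) (rule refl, rule eq_commute)
  then show ?thesis
    unfolding extendable_deformation_def coboundaries_3 using extension_iff by blast
qed

end

theorem theorem6p22:
  fixes A :: "('m::{t2_space,second_countable_topology}, 'v::real_vector) algebroid"
    and H \<Theta> :: "('m, 'v) tensor_field"
    and n :: nat
    and Hs :: "nat \<Rightarrow> ('m, 'v) tensor_field"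
  assumes "left_symmetric_algebroid A"
    and "KV_structure A H"
    and "order_deformation A H n Hs"
    and "\<Theta> = (\<lambda>p \<xi>s. 1 / 2 *
           (\<Sum>(i,j)\<in>{(i,j). i + j = n + 1 \<and> 1 \<le> i \<and> 1 \<le> j}. KV_bracket A 2 (Hs i) 2 (Hs j) p \<xi>s))"
  shows "\<Theta> \<in> KV_cochains_tilde A H 3 \<and>
    KV_delta A H 3 \<Theta> = (\<lambda>p \<xi>s. 0) \<and>
    KV_class_tilde A H 3 \<Theta> \<in> KV_cohomology_tilde A H 3 \<and>
    (extendable_deformation A H n Hs \<longleftrightarrow>
      KV_class_tilde A H 3 \<Theta> = KV_class_tilde A H 3 (\<lambda>p \<xi>s. 0))"
proof -
  interpret kv_deformation A H n Hs
    using assms(1-3) by unfold_locales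
  have \<Theta>: "\<Theta> = obstruction" by (simp add: assms(4) obstruction_def index_pairs_def)
  have "KV_class_tilde A H 3 obstruction \<in> KV_cohomology_tilde A H 3"
    unfolding KV_class_tilde_def KV_cohomology_tilde_def by (rule quotientI[OF obstruction_cocycle])
  then show ?thesis
    unfolding \<Theta> using obstruction_cocycle class_trivial_iff extendable_iff
    by (simp add: KV_cocycles_tilde_def mem_Collect_eq)
qed

end
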